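(* Let $\mathbf{X}\subset\mathbb{R}$ be a Hawkes process with immigrant intensity $\nu>0$ and fertility rate $h:(0,\infty)\to[0,\infty)$, and let $\mu=\int_0^\infty h(t)\,\mathrm{d}t$. Assume $0<\mu<1$ and $$\int_0^\infty t\,h(t)\,\mathrm{d}t<\infty.$$ Then the family $\{N_{\mathbf{X}}(0,t]/t\}_{t>0}$ satisfies a large deviation principle on $\mathbb{R}$ (as $t\to\infty$) with speed $t$ and good rate function $$\Lambda^*(x)=\begin{cases} x\theta_x+\nu-\dfrac{\nu x}{\nu+\mu x} & \text{if } x\in(0,\infty),\\ \nu & \text{if } x=0,\\ +\infty & \text{if } x\in(-\infty,0),\end{cases}$$ where, for $x>0$, $\theta=\theta_x$ is the unique solution in $(-\infty,\mu-1-\log\mu)$ of $$\mathrm{E}[S\mathrm{e}^{\theta S}]=x/\nu,$$ or equivalently of $$\mathrm{E}[\mathrm{e}^{\theta S}]=\frac{x}{\nu+x\mu},$$ and $S$ denotes the number of points in a cluster of $\mathbf{X}$.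
   Context: Hawkes process. The immigrants form a homogeneous Poisson process $I$ on $\mathbb{R}$ with points $X_i$ and intensity $\nu>0$. Each immigrant $X_i$ generates a cluster $C_i=C_{X_i}$, the random set formed by the points of generations $n=0,1,\ldots$ with the following branching structure: $X_i$ is of generation $0$; given generations $0,1,\ldots,n$ in $C_i$, each point $Y\in C_i$ of generation $n$ generates (independently of the others) a Poisson process on $(Y,\infty)$ of offspring of generation $n+1$ with intensity function $h(\cdot-Y)$, where the fertility rate $h:(0,\infty)\to[0,\infty)$ is a non-negative Borel function. Given the immigrants, the centered clusters $C_i-X_i=\{Y-X_i:Y\in C_i\}$ are independent, identically distributed, and independent of $I$. $\mathbf{X}$ is the union of all clusters. $S$ is the total number of points in a cluster (including the immigrant); it is the total progeny of a Galton-Watson process with one ancestor and Poisson($\mu$) offspring distribution, so that $P(S=k)=\mathrm{e}^{-k\mu}(k\mu)^{k-1}/k!$ for $k=1,2,\ldots$. $N_{\mathbf{X}}(0,t]$ is the number of points of $\mathbf{X}$ in $(0,t]$. Large deviation principle (LDP): a family $\{V_\alpha\}_{\alpha\in(0,\infty)}$ of random variables with values in a topological space $M$ satisfies the LDP with rate function $J$ and speed $v$ if $J:M\to[0,\infty]$ is lower semi-continuous, $v:[0,\infty)\to[0,\infty)$ is measurable and increases to infinity, and for every Borel set $B\subset M$, $$-\inf_{x\in B^\circ}J(x)\le\liminf_{\alpha\to\infty}\frac{1}{v(\alpha)}\log P(V_\alpha\in B)\le\limsup_{\alpha\to\infty}\frac{1}{v(\alpha)}\log P(V_\alpha\in B)\le-\inf_{x\in\overline{B}}J(x).$$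 The rate function is good if its level sets $\{x:J(x)\le a\}$, $a\ge 0$, are compact. *)

theory Defs
  imports "HOL-Probability.Probability"
begin

section \<open>Large deviation principles\<close>

(* The library convention ln 0 = 0 on the reals is wrong for log-probabilities. *)
definition log_prob :: "real \<Rightarrow> ereal" where
  "log_prob p = (if p = 0 then -\<infinity> else ereal (ln p))"

definition rate_function :: "('m::topological_space \<Rightarrow> ereal) \<Rightarrow> bool" where
  "rate_function J \<longleftrightarrow> (\<forall>x. 0 \<le> J x) \<and> (\<forall>a::real. closed {x. J x \<le> ereal a})"

definition good_rate_function :: "('m::topological_space \<Rightarrow> ereal) \<Rightarrow> bool" where
  "good_rate_function J \<longleftrightarrow>
     rate_function J \<and> (\<forall>a::real. a \<ge> 0 \<longrightarrow> compact {x. J x \<le> ereal a})"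

definition speed_function :: "(real \<Rightarrow> real) \<Rightarrow> bool" where
  "speed_function v \<longleftrightarrow>
     (\<forall>a\<ge>0. 0 \<le> v a) \<and> v \<in> borel_measurable (restrict_space borel {0..}) \<and>
     mono_on {0..} v \<and> filterlim v at_top at_top"

(* Infima are taken in the complete lattice ereal, so that the infimum over the empty set is
   infinity. Only the values V a with a > 0 matter. *)
definition (in prob_space) satisfies_LDP ::
    "(real \<Rightarrow> 'a \<Rightarrow> 'm::topological_space) \<Rightarrow> ('m \<Rightarrow> ereal) \<Rightarrow> (real \<Rightarrow> real) \<Rightarrow> bool" where
  "satisfies_LDP V J v \<longleftrightarrow>
     (\<forall>a>0. random_variable borel (V a)) \<and> rate_function J \<and> speed_function v \<and>
     (\<forall>B\<in>sets borel.
        - (INF x\<in>interior B. J x)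
          \<le> Liminf at_top (\<lambda>a. ereal (1 / v a) * log_prob (prob {\<omega>\<in>space M. V a \<omega> \<in> B})) \<and>
        Limsup at_top (\<lambda>a. ereal (1 / v a) * log_prob (prob {\<omega>\<in>space M. V a \<omega> \<in> B}))
          \<le> - (INF x\<in>closure B. J x))"

section \<open>Poisson processes\<close>

(* A point process on the line is presented by a measurable enumeration Y 0, Y 1, ... of its
   points. An infinite value of Y k means that there is no k-th point, so that processes with a
   random, possibly finite, number of points are covered. *)
definition point_set :: "(nat \<Rightarrow> 'a \<Rightarrow> ereal) \<Rightarrow> 'a \<Rightarrow> real set" where
  "point_set Y \<omega> = {x. \<exists>k. Y k \<omega> = ereal x}"

(* Poisson process with diffuse intensity measure L; no point is enumerated twice.
   The finiteness clause is needed because card is 0 on infinite sets. The point probabilities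
   are spelled out because poisson_pmf is unspecified for rate 0. *)
definition (in prob_space) poisson_process :: "real measure \<Rightarrow> (nat \<Rightarrow> 'a \<Rightarrow> ereal) \<Rightarrow> bool" where
  "poisson_process L Y \<longleftrightarrow>
     (\<forall>k. random_variable borel (Y k)) \<and>
     (AE \<omega> in M. inj_on (\<lambda>k. Y k \<omega>) {k. \<bar>Y k \<omega>\<bar> \<noteq> \<infinity>}) \<and>
     (\<forall>B\<in>sets borel. emeasure L B < \<infinity> \<longrightarrow>
        (AE \<omega> in M. finite (point_set Y \<omega> \<inter> B)) \<and>
        (\<forall>n. prob {\<omega>\<in>space M. card (point_set Y \<omega> \<inter> B) = n}
               = measure L B ^ n / fact n * exp (- measure L B))) \<and>
     (\<forall>(J::nat set) B. finite J \<and> disjoint_family_on B J \<and>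
        (\<forall>j\<in>J. B j \<in> sets borel \<and> emeasure L (B j) < \<infinity>) \<longrightarrow>
        indep_vars (\<lambda>_. count_space UNIV) (\<lambda>j \<omega>. card (point_set Y \<omega> \<inter> B j)) J)"

section \<open>Hawkes processes\<close>

(* Ulam-Harris labelling: X i is the i-th immigrant, and the individuals of its cluster are
   labelled by nat lists. The k-th potential child of the individual (i, w) is (i, k # w), and
   D i w enumerates the displacements from (i, w) to its children, so that the offspring of an
   individual at y form y plus the points of D i w. In position, an infinite value means
   that the individual does not exist; this is inherited by all its descendants, since adding to
   an infinite extended real never yields a finite one. *)
primrec position ::
    "(nat \<Rightarrow> 'a \<Rightarrow> real) \<Rightarrow> (nat \<Rightarrow> nat list \<Rightarrow> nat \<Rightarrow> 'a \<Rightarrow> ereal) \<Rightarrow> nat \<Rightarrow> nat list \<Rightarrow> 'a \<Rightarrow> ereal"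
where
  "position X D i [] \<omega> = ereal (X i \<omega>)"
| "position X D i (k # w) \<omega> = position X D i w \<omega> + D i w k \<omega>"

definition generation ::
    "(nat \<Rightarrow> 'a \<Rightarrow> real) \<Rightarrow> (nat \<Rightarrow> nat list \<Rightarrow> nat \<Rightarrow> 'a \<Rightarrow> ereal) \<Rightarrow> nat \<Rightarrow> nat \<Rightarrow> 'a \<Rightarrow> real set"
where
  "generation X D i n \<omega> = {y. \<exists>w. length w = n \<and> position X D i w \<omega> = ereal y}"

definition cluster ::
    "(nat \<Rightarrow> 'a \<Rightarrow> real) \<Rightarrow> (nat \<Rightarrow> nat list \<Rightarrow> nat \<Rightarrow> 'a \<Rightarrow> ereal) \<Rightarrow> nat \<Rightarrow> 'a \<Rightarrow> real set"
where
  "cluster X D i \<omega> = (\<Union>n. generation X D i n \<omega>)"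

definition hawkes_points ::
    "(nat \<Rightarrow> 'a \<Rightarrow> real) \<Rightarrow> (nat \<Rightarrow> nat list \<Rightarrow> nat \<Rightarrow> 'a \<Rightarrow> ereal) \<Rightarrow> 'a \<Rightarrow> real set"
where
  "hawkes_points X D \<omega> = (\<Union>i. cluster X D i \<omega>)"

(* The independence assumption concerns the immigrant process (index None) and all the offspring
   processes (indices Some (i, w)), each as a random sequence. *)
locale hawkes_process = prob_space M
  for M :: "'a measure" +
  fixes \<nu> :: real and h :: "real \<Rightarrow> real"
    and X :: "nat \<Rightarrow> 'a \<Rightarrow> real"
    and D :: "nat \<Rightarrow> nat list \<Rightarrow> nat \<Rightarrow> 'a \<Rightarrow> ereal"
  assumes intensity_pos: "\<nu> > 0"
    and fertility_nonneg: "\<And>t. t > 0 \<Longrightarrow> h t \<ge> 0"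
    and fertility_borel: "set_borel_measurable borel {0<..} h"
    and immigrants: "poisson_process (density lborel (\<lambda>_. ennreal \<nu>)) (\<lambda>i \<omega>. ereal (X i \<omega>))"
    and offspring:
      "\<And>i w. poisson_process (density lborel (\<lambda>t. ennreal (indicator {0<..} t * h t))) (D i w)"
    and independent:
      "indep_vars (\<lambda>_. PiM UNIV (\<lambda>_. borel))
         (\<lambda>j \<omega>. case j of None \<Rightarrow> (\<lambda>k. ereal (X k \<omega>)) | Some (i, w) \<Rightarrow> (\<lambda>k. D i w k \<omega>)) UNIV"

definition hawkes_theta :: "'a measure \<Rightarrow> ('a \<Rightarrow> real) \<Rightarrow> real \<Rightarrow> real \<Rightarrow> real \<Rightarrow> real" where
  "hawkes_theta M S \<nu> \<mu> x =
     (THE \<theta>. \<theta> < \<mu> - 1 - ln \<mu> \<and> (LINT \<omega>|M. S \<omega> * exp (\<theta> * S \<omega>)) = x / \<nu>)"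

definition hawkes_rate :: "'a measure \<Rightarrow> ('a \<Rightarrow> real) \<Rightarrow> real \<Rightarrow> real \<Rightarrow> real \<Rightarrow> ereal" where
  "hawkes_rate M S \<nu> \<mu> x =
     (if x > 0 then ereal (x * hawkes_theta M S \<nu> \<mu> x + \<nu> - \<nu> * x / (\<nu> + \<mu> * x))
      else if x = 0 then ereal \<nu>
      else \<infinity>)"

end

theory Submission
  imports Defs "HOL-Real_Asymp.Real_Asymp"
begin

text \<open>The moment generating function \<open>m\<close> of the cluster size satisfies \<open>m = exp (\<theta> + \<mu> (m - 1))\<close>, so that
  \<open>m \<mapsto> ln m - \<mu> (m - 1)\<close> inverts it on \<open>(0, 1 / \<mu>)\<close>; this makes \<open>\<theta>\<^sub>x\<close> and the rate function explicit.
  By the Laplace functional of a Poisson process, the Laplace transform of the number of points in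
  \<open>(0, t]\<close> is \<open>exp (\<nu> \<integral> (F - 1))\<close>, where \<open>F x\<close> is the contribution of the cluster of an immigrant at \<open>x\<close>.
  Inside the window \<open>F\<close> is close to \<open>m\<close> except near the right end, and the first moment of the fertility
  rate bounds the total contribution of the immigrants before \<open>0\<close> uniformly in \<open>t\<close>. Hence the scaled
  cumulants converge to \<open>\<nu> (m - 1)\<close> for all \<open>\<theta> < \<mu> - 1 - ln \<mu>\<close>. The derivative of this limit takes all
  positive values there, so Chernoff bounds and exponential tilting give the large deviation
  principle; the point \<open>x = 0\<close> follows by continuity of the rate function from the right.\<close>

section \<open>Signed exponentials on the extended nonnegative reals\<close>

text \<open>Two gaps separate the labelled trees from the counts. The process is a set, so a count
  agrees with a sum over labels only once coincidences of positions are excluded almost surely. And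
  \<open>card\<close> is 0 on infinite sets, so finiteness must be known before exponential moments
  of \<open>card\<close> mean anything; it follows from a finite exponential moment at some positive
  parameter, whose finiteness is itself to be proved. Hence Laplace transforms are computed in
  \<open>ennreal\<close>, where every identity makes sense, and finiteness is decided afterwards.
  For 0 < \<theta> < \<mu> - 1 - ln \<mu> the equation for m has two positive roots; iteration from
  below finds the one with m < 1 / \<mu>. The same inequality controls the immigrants before 0:
  bounding the recursion by a linear one gives the factor \<mu> * m < 1. The bound on \<theta> is
  the maximum of ln m - \<mu> * (m - 1), attained at m = 1 / \<mu>. There the derivative of the
  inverse vanishes, so the slope of the limiting cumulant blows up at the right end and no large x
  is missed, whereas at the other end the slope tends to 0 without reaching it.\<close>

text \<open>Both signs of the Laplace parameter are treated at once: \<open>sexp p z\<close> is \<open>exp z\<close> or \<open>exp (- z)\<close>, and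
  \<open>sexpm1 p z\<close> is its distance to 1. All quantities in the exponent are then monotone limits in
  \<open>ennreal\<close>.\<close>
definition sexp :: "bool \<Rightarrow> ennreal \<Rightarrow> ennreal" where
  "sexp p z = (if z = \<top> then (if p then \<top> else 0)
     else ennreal (exp (if p then enn2real z else - enn2real z)))"

definition sexpm1 :: "bool \<Rightarrow> ennreal \<Rightarrow> ennreal" where
  "sexpm1 p z = (if p then sexp p z - 1 else 1 - sexp p z)"

lemma sexp_ennreal: "0 \<le> x \<Longrightarrow> sexp p (ennreal x) = ennreal (exp (if p then x else - x))"
  by (simp add: sexp_def)

lemma sexp_top: "sexp p \<top> = (if p then \<top> else 0)"
  by (simp add: sexp_def)

lemma sexp_0 [simp]: "sexp p 0 = 1"
  by (simp add: sexp_def)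

text \<open>No product of 0 with \<top> occurs: \<open>sexp True\<close> is at least 1 and
  \<open>sexp False\<close> at most 1, so the conventions of \<open>ennreal\<close> respect the
  exponential law also at \<top>.\<close>

lemma sexp_add: "sexp p (a + b) = sexp p a * sexp p b"
proof (cases "a = \<top> \<or> b = \<top>")
  case True
  then show ?thesis
    by (auto simp: sexp_def ennreal_mult_top ennreal_top_mult)
next
  case False
  then obtain x y where "a = ennreal x" "b = ennreal y" "0 \<le> x" "0 \<le> y"
    by (metis ennreal_cases)
  then show ?thesis
    by (simp add: sexp_ennreal ennreal_mult[symmetric] exp_add[symmetric] flip: ennreal_plus)
qed

lemma sexp_sum: "finite A \<Longrightarrow> sexp p (\<Sum>a\<in>A. f a) = (\<Prod>a\<in>A. sexp p (f a))"
  by (induction A rule: finite_induct) (auto simp: sexp_add)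

text \<open>The second bound squeezes \<open>sexp True\<close> up to \<top> as its argument tends to
  \<top>; for the other sign, the bound by \<open>inverse\<close> below plays this part.\<close>

lemma sexp_True_ge: "1 \<le> sexp True z" "z \<le> sexp True z"
proof -
  have "1 + x \<le> exp x" for x :: real by (rule exp_ge_add_one_self)
  then have *: "x \<le> exp x" for x :: real by (smt (verit))
  show "1 \<le> sexp True z"
    by (cases z) (auto simp: sexp_def simp flip: ennreal_1)
  show "z \<le> sexp True z"
    by (cases z) (auto simp: sexp_def * intro!: ennreal_leI)
qed

lemma sexp_False_le: "sexp False z \<le> 1" "sexp False z \<le> inverse z"
proof -
  show "sexp False z \<le> 1"
    by (cases z) (auto simp: sexp_def ennreal_le_1)
  show "sexp False z \<le> inverse z"
  proof (cases z)
    case (real r)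
    show ?thesis
    proof (cases "r = 0")
      case False
      with real have "r > 0" by simp
      have "r \<le> exp r"
        using exp_ge_add_one_self[of r] by linarith
      then have "exp (- r) \<le> inverse r"
        using \<open>r > 0\<close> by (simp add: exp_minus le_imp_inverse_le)
      then show ?thesis
        using \<open>r > 0\<close> real by (simp add: sexp_def inverse_ennreal)
    qed (use real in simp)
  qed (simp add: sexp_def)
qed

lemma sexp_tendsto:
  assumes f: "(f \<longlongrightarrow> l) F"
  shows "((\<lambda>x. sexp p (f x)) \<longlongrightarrow> sexp p l) F"
proof (cases l)
  case (real r)
  then have "\<forall>\<^sub>F x in F. f x < \<top>"
    using f by (intro order_tendstoD) auto
  moreover have "((\<lambda>x. ennreal (exp (if p then enn2real (f x) else - enn2real (f x)))) \<longlongrightarrow>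
     ennreal (exp (if p then r else - r))) F"
    using tendsto_enn2real[of f r F] f real by (cases p) (auto intro!: tendsto_intros)
  ultimately have "((\<lambda>x. sexp p (f x)) \<longlongrightarrow> ennreal (exp (if p then r else - r))) F"
    by (elim Lim_transform_eventually) (auto simp: sexp_def elim: eventually_mono)
  then show ?thesis
    using real by (simp add: sexp_ennreal)
next
  case top
  show ?thesis
  proof (cases p)
    case True
    have "((\<lambda>x. sexp True (f x)) \<longlongrightarrow> \<top>) F"
      by (rule tendsto_sandwich[of f "\<lambda>x. sexp True (f x)" F "\<lambda>_. \<top>" "\<top>"])
        (use f top in \<open>simp_all add: always_eventually sexp_True_ge\<close>)
    then show ?thesis using True top by (simp add: sexp_def)
  next
    case False
    have "((\<lambda>x. sexp False (f x)) \<longlongrightarrow> 0) F"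
    proof (rule tendsto_sandwich[of "\<lambda>_. 0" _ _ "\<lambda>x. inverse (f x)"])
      have "((\<lambda>x. inverse (f x)) \<longlongrightarrow> inverse \<top>) F"
        using f top
      by (intro continuous_on_tendsto_compose[OF continuous_on_inverse_ennreal[OF continuous_on_id, of UNIV]])
        auto
      then show "((\<lambda>x. inverse (f x)) \<longlongrightarrow> 0) F" by simp
    qed (auto simp: sexp_False_le intro!: always_eventually)
    then show ?thesis using False top by (simp add: sexp_def)
  qed
qed

lemma borel_measurable_sexp [measurable]: "sexp p \<in> borel_measurable borel"
  unfolding sexp_def by measurable

lemma sexp_mono: "a \<le> b \<Longrightarrow> sexp True a \<le> sexp True b"
  by (cases a; cases b) (auto simp: sexp_def top_unique intro!: ennreal_leI)

lemma sexp_antimono: "a \<le> b \<Longrightarrow> sexp False b \<le> sexp False a"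
  by (cases a; cases b) (auto simp: sexp_def top_unique intro!: ennreal_leI)

lemma sexpm1_ennreal:
  "0 \<le> x \<Longrightarrow> sexpm1 p (ennreal x) = ennreal (if p then exp x - 1 else 1 - exp (- x))"
  by (auto simp: sexpm1_def sexp_ennreal ennreal_minus simp flip: ennreal_1)

lemma sexpm1_0 [simp]: "sexpm1 p 0 = 0"
  by (simp add: sexpm1_def)

lemma sexpm1_mono: "a \<le> b \<Longrightarrow> sexpm1 p a \<le> sexpm1 p b"
  unfolding sexpm1_def by (auto intro!: ennreal_minus_mono sexp_mono sexp_antimono)

lemma borel_measurable_sexpm1 [measurable]: "sexpm1 p \<in> borel_measurable borel"
  unfolding sexpm1_def by measurable

lemma sexpm1_tendsto:
  assumes f: "(f \<longlongrightarrow> l) F"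
  shows "((\<lambda>x. sexpm1 p (f x)) \<longlongrightarrow> sexpm1 p l) F"
proof (cases p)
  case True
  show ?thesis
  proof (cases "l = \<top>")
    case False
    then have "sexp True l \<noteq> \<top>"
      by (simp add: sexp_def)
    then show ?thesis
      unfolding sexpm1_def using True sexp_tendsto[OF f, of p]
      by (auto intro!: tendsto_diff_ennreal)
  next
    case l: True
    have "z \<le> sexpm1 True z" for z
    proof (cases z)
      case (real r)
      have "r \<le> exp r - 1"
        using exp_ge_add_one_self[of r] by linarith
      then show ?thesis
        using real by (auto simp: sexpm1_ennreal intro!: ennreal_leI)
    qed (simp add: sexpm1_def sexp_top)
    note le = this
    have "((\<lambda>x. sexpm1 True (f x)) \<longlongrightarrow> \<top>) F"
      by (rule tendsto_sandwich[of f "\<lambda>x. sexpm1 True (f x)" F "\<lambda>_. \<top>" "\<top>"])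
        (use f l in \<open>simp_all add: always_eventually le\<close>)
    then show ?thesis
      using True l by (simp add: sexpm1_def sexp_top)
  qed
next
  case False
  have "sexp False l \<noteq> \<top>"
    by (simp add: sexp_def)
  then show ?thesis
    unfolding sexpm1_def using False sexp_tendsto[OF f, of p]
    by (auto intro!: tendsto_diff_ennreal)
qed

lemma sexpm1_SUP:
  assumes "incseq f"
  shows "sexpm1 p (SUP n. f n) = (SUP n. sexpm1 p (f n))"
proof -
  have "(\<lambda>n. sexpm1 p (f n)) \<longlonglongrightarrow> sexpm1 p (SUP n. f n)"
    by (intro sexpm1_tendsto LIMSEQ_SUP assms)
  moreover have "(\<lambda>n. sexpm1 p (f n)) \<longlonglongrightarrow> (SUP n. sexpm1 p (f n))"
    using assms by (intro LIMSEQ_SUP) (auto simp: incseq_def intro!: sexpm1_mono)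
  ultimately show ?thesis by (rule LIMSEQ_unique)
qed

text \<open>The sign decides which convergence theorem applies: with \<open>True\<close> the
  integrands increase, with \<open>False\<close> they decrease and are bounded by 1 on a probability
  space.\<close>

lemma (in prob_space) nn_integral_sexp_tendsto:
  assumes [measurable]: "\<And>n. f n \<in> borel_measurable M"
    and inc: "\<And>\<omega>. incseq (\<lambda>n. f n \<omega>)"
  shows "(\<lambda>n. \<integral>\<^sup>+\<omega>. sexp p (f n \<omega>) \<partial>M) \<longlonglongrightarrow> (\<integral>\<^sup>+\<omega>. sexp p (SUP n. f n \<omega>) \<partial>M)"
proof (cases p)
  case True
  have *: "(SUP n. sexp p (f n \<omega>)) = sexp p (SUP n. f n \<omega>)" for \<omega>
  proof (rule LIMSEQ_unique)
    show "(\<lambda>n. sexp p (f n \<omega>)) \<longlonglongrightarrow> (SUP n. sexp p (f n \<omega>))"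
      using inc[of \<omega>] True by (intro LIMSEQ_SUP) (auto simp: incseq_def sexp_mono)
    show "(\<lambda>n. sexp p (f n \<omega>)) \<longlonglongrightarrow> sexp p (SUP n. f n \<omega>)"
      by (intro sexp_tendsto LIMSEQ_SUP inc)
  qed
  have mono: "incseq (\<lambda>n \<omega>. sexp p (f n \<omega>))"
    using inc True by (auto simp: incseq_def le_fun_def sexp_mono)
  have "(\<integral>\<^sup>+\<omega>. sexp p (SUP n. f n \<omega>) \<partial>M) = (SUP n. \<integral>\<^sup>+\<omega>. sexp p (f n \<omega>) \<partial>M)"
    unfolding *[symmetric] using mono by (intro nn_integral_monotone_convergence_SUP) measurable
  moreover have "(\<lambda>n. \<integral>\<^sup>+\<omega>. sexp p (f n \<omega>) \<partial>M) \<longlonglongrightarrow> (SUP n. \<integral>\<^sup>+\<omega>. sexp p (f n \<omega>) \<partial>M)"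
    using mono by (intro LIMSEQ_SUP) (auto simp: incseq_def le_fun_def intro!: nn_integral_mono)
  ultimately show ?thesis by simp
next
  case False
  show ?thesis
  proof (rule nn_integral_dominated_convergence[where w = "\<lambda>_. 1"])
    show "AE \<omega> in M. (\<lambda>n. sexp p (f n \<omega>)) \<longlonglongrightarrow> sexp p (SUP n. f n \<omega>)"
      by (intro AE_I2 sexp_tendsto LIMSEQ_SUP inc)
  qed (use False sexp_False_le(1) in \<open>auto simp: emeasure_space_1\<close>)
qed

text \<open>A Laplace identity known along an increasing approximation passes to its limit. It is
  applied to approximation by simple functions, to partial sums over points, and to the number of
  generations.\<close>

lemma (in prob_space) nn_integral_sexp_SUP:
  assumes "\<And>n. f n \<in> borel_measurable M" "\<And>\<omega>. incseq (\<lambda>n. f n \<omega>)"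
    and "\<And>n. (\<integral>\<^sup>+\<omega>. sexp p (f n \<omega>) \<partial>M) = sexp p (g n)" and "g \<longlonglongrightarrow> l"
  shows "(\<integral>\<^sup>+\<omega>. sexp p (SUP n. f n \<omega>) \<partial>M) = sexp p l"
  using nn_integral_sexp_tendsto[OF assms(1,2), of p] sexp_tendsto[OF assms(4), of p]
  unfolding assms(3) by (rule LIMSEQ_unique)

section \<open>Laplace functionals of Poisson processes\<close>

text \<open>Infinite values encode points that do not exist, and these carry no weight.\<close>
definition on_reals :: "(real \<Rightarrow> 'b::zero) \<Rightarrow> ereal \<Rightarrow> 'b" where
  "on_reals u y = (if \<bar>y\<bar> = \<infinity> then 0 else u (real_of_ereal y))"

lemma on_reals_simps [simp]: "on_reals u (ereal x) = u x" "on_reals u \<infinity> = 0" "on_reals u (- \<infinity>) = 0"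
  by (simp_all add: on_reals_def)

lemma borel_measurable_on_reals [measurable]:
  fixes u :: "real \<Rightarrow> ennreal"
  assumes [measurable]: "u \<in> borel_measurable borel"
  shows "on_reals u \<in> borel_measurable borel"
  unfolding on_reals_def by measurable

text \<open>The bridge from an enumeration to the set that it enumerates: injectivity prevents
  double counting, and \<open>on_reals\<close> discards the labels without a point.\<close>

lemma nn_integral_count_points:
  fixes p :: "'i \<Rightarrow> ereal"
  assumes inj: "inj_on p {j. \<bar>p j\<bar> \<noteq> \<infinity>}"
  shows "(\<integral>\<^sup>+j. on_reals (indicator B) (p j) \<partial>count_space UNIV)
     = emeasure (count_space UNIV) ({x. \<exists>j. p j = ereal x} \<inter> B)"
proof -
  let ?J = "{j. \<bar>p j\<bar> \<noteq> \<infinity> \<and> real_of_ereal (p j) \<in> B}"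
  have "(\<lambda>j. on_reals (indicator B) (p j) :: ennreal) = indicator ?J"
    by (auto simp: fun_eq_iff on_reals_def indicator_def)
  then have "(\<integral>\<^sup>+j. on_reals (indicator B) (p j) \<partial>count_space UNIV) = emeasure (count_space UNIV) ?J"
    by simp
  also have "\<dots> = emeasure (count_space UNIV) ({x. \<exists>j. p j = ereal x} \<inter> B)"
  proof -
    have "inj_on (\<lambda>j. real_of_ereal (p j)) ?J"
    proof (rule inj_onI)
      fix i j assume *: "i \<in> ?J" "j \<in> ?J" "real_of_ereal (p i) = real_of_ereal (p j)"
      then have "p i = p j"
        by (metis (mono_tags, lifting) mem_Collect_eq ereal_real')
      then show "i = j"
        using * by (intro inj_onD[OF inj]) auto
    qed
    moreover have "(\<lambda>j. real_of_ereal (p j)) ` ?J = {x. \<exists>j. p j = ereal x} \<inter> B"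
    proof (intro equalityI subsetI)
      fix x assume "x \<in> {x. \<exists>j. p j = ereal x} \<inter> B"
      then obtain j where "p j = ereal x" "x \<in> B" by auto
      then show "x \<in> (\<lambda>j. real_of_ereal (p j)) ` ?J" by (intro image_eqI[of _ _ j]) auto
    qed (auto simp: ereal_real')
    ultimately have "bij_betw (\<lambda>j. real_of_ereal (p j)) ?J ({x. \<exists>j. p j = ereal x} \<inter> B)"
      by (simp add: bij_betw_def)
    from bij_betw_finite[OF this] bij_betw_same_card[OF this] show ?thesis
      by (simp add: emeasure_count_space)
  qed
  finally show ?thesis .
qed

text \<open>The Laplace transform of a Poisson variable with mean l. With e = exp r or e = exp (- r)
  the series sums to exp ((e - 1) * l), and e - 1 has the sign that p encodes.\<close>

lemma sexp_exponential_series: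
  assumes "0 \<le> r" "0 \<le> l"
  shows "(\<Sum>n. sexp p (ennreal r * of_nat n) * ennreal (l ^ n / fact n * exp (- l)))
    = sexp p (sexpm1 p (ennreal r) * ennreal l)"
proof -
  define e where "e = exp (if p then r else - r)"
  have "(\<lambda>n. (e * l) ^ n /\<^sub>R fact n) sums exp (e * l)"
    by (rule exp_converges)
  then have "(\<lambda>n. (e * l) ^ n /\<^sub>R fact n * exp (- l)) sums (exp (e * l) * exp (- l))"
    by (rule sums_mult2)
  then have s: "(\<lambda>n. e ^ n * (l ^ n / fact n * exp (- l))) sums exp (e * l - l)"
    by (simp add: power_mult_distrib divide_inverse mult_ac flip: exp_add)
  have e: "sexp p (ennreal r * of_nat n) = ennreal (e ^ n)" for n
    using assms by (auto simp: e_def sexp_ennreal exp_of_nat_mult[symmetric] mult.commute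
      simp flip: ennreal_mult ennreal_of_nat_eq_real_of_nat)
       (auto simp: ennreal_of_nat_eq_real_of_nat sexp_ennreal mult_ac simp flip: ennreal_mult exp_of_nat_mult)
  have "0 \<le> e" by (simp add: e_def)
  then have "(\<Sum>n. sexp p (ennreal r * of_nat n) * ennreal (l ^ n / fact n * exp (- l)))
     = (\<Sum>n. ennreal (e ^ n * (l ^ n / fact n * exp (- l))))"
    unfolding e by (subst ennreal_mult) (auto simp: assms)
  also have "\<dots> = ennreal (exp (e * l - l))"
    using s \<open>0 \<le> e\<close> assms by (intro suminf_ennreal_eq) auto
  also have "\<dots> = sexp p (sexpm1 p (ennreal r) * ennreal l)"
    using assms
    by (auto simp: sexpm1_ennreal sexp_ennreal e_def algebra_simps simp flip: ennreal_mult)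
  finally show ?thesis .
qed

lemma (in prob_space) poisson_process_laplace_count:
  assumes P: "poisson_process L Y" and B: "B \<in> sets borel" and fin: "emeasure L B < \<infinity>" and "0 \<le> r"
  shows "(\<integral>\<^sup>+\<omega>. sexp p (ennreal r * of_nat (card (point_set Y \<omega> \<inter> B))) \<partial>M)
    = sexp p (sexpm1 p (ennreal r) * emeasure L B)"
proof -
  define l where "l = measure L B"
  let ?N = "\<lambda>\<omega>. card (point_set Y \<omega> \<inter> B)"
  \<comment> \<open>Measurability of the count is read off the independence clause, taken with a
    single index.\<close>
  have [measurable]: "?N \<in> measurable M (count_space UNIV)"
  proof -
    have "indep_vars (\<lambda>_. count_space UNIV) (\<lambda>j \<omega>. card (point_set Y \<omega> \<inter> B)) {0::nat}"
      using P B fin unfolding poisson_process_def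
      by (auto dest!: spec[of _ "{0::nat}"] spec[of _ "\<lambda>_::nat. B"] simp: disjoint_family_on_def)
    then show ?thesis by (auto simp: indep_vars_def)
  qed
  have prob: "emeasure M {\<omega>\<in>space M. ?N \<omega> = n} = ennreal (l ^ n / fact n * exp (- l))" for n
    using P B fin by (simp add: poisson_process_def emeasure_eq_measure l_def)
  have "(\<integral>\<^sup>+\<omega>. sexp p (ennreal r * of_nat (?N \<omega>)) \<partial>M)
     = (\<integral>\<^sup>+\<omega>. (\<Sum>n. sexp p (ennreal r * of_nat n) * indicator {\<omega>\<in>space M. ?N \<omega> = n} \<omega>) \<partial>M)"
  proof (rule nn_integral_cong)
    fix \<omega> assume "\<omega> \<in> space M"
    then have "(\<Sum>n. sexp p (ennreal r * of_nat n) * indicator {\<omega>\<in>space M. ?N \<omega> = n} \<omega>)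
       = (\<Sum>n\<in>{?N \<omega>}. sexp p (ennreal r * of_nat n) * indicator {\<omega>\<in>space M. ?N \<omega> = n} \<omega>)"
      by (intro suminf_finite) auto
    then show "sexp p (ennreal r * of_nat (?N \<omega>))
       = (\<Sum>n. sexp p (ennreal r * of_nat n) * indicator {\<omega>\<in>space M. ?N \<omega> = n} \<omega>)"
      using \<open>\<omega> \<in> space M\<close> by simp
  qed
  also have "\<dots> = (\<Sum>n. sexp p (ennreal r * of_nat n) * emeasure M {\<omega>\<in>space M. ?N \<omega> = n})"
    by (subst nn_integral_suminf) (auto simp: nn_integral_cmult)
  also have "\<dots> = sexp p (sexpm1 p (ennreal r) * ennreal l)"
    unfolding prob using \<open>0 \<le> r\<close> by (intro sexp_exponential_series) (auto simp: l_def)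
  also have "ennreal l = emeasure L B"
    using fin by (simp add: l_def emeasure_eq_ennreal_measure less_top)
  finally show ?thesis .
qed

lemma (in prob_space) poisson_process_count_AE:
  assumes P: "poisson_process L Y" and B: "B \<in> sets borel" and fin: "emeasure L B < \<infinity>"
  shows "AE \<omega> in M. (\<Sum>k. on_reals (indicator B) (Y k \<omega>)) = (of_nat (card (point_set Y \<omega> \<inter> B)) :: ennreal)"
proof -
  have "AE \<omega> in M. inj_on (\<lambda>k. Y k \<omega>) {k. \<bar>Y k \<omega>\<bar> \<noteq> \<infinity>}" "AE \<omega> in M. finite (point_set Y \<omega> \<inter> B)"
    using P B fin by (auto simp: poisson_process_def)
  then show ?thesis
  proof eventually_elim
    case (elim \<omega>)
    then show ?case
      using nn_integral_count_points[OF elim(1), of B]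
      by (simp add: nn_integral_count_space_nat point_set_def)
  qed
qed

text \<open>The level sets of u are disjoint, so their counts are independent Poisson variables and
  the transform factorises. The set K keeps every relevant level set at finite intensity.\<close>

lemma (in prob_space) poisson_process_laplace_simple:
  assumes P: "poisson_process L Y" and sets_L [measurable_cong, simp]: "sets L = sets borel"
    and u: "simple_function borel u" and u_fin: "\<And>x. u x < \<top>"
    and K [measurable]: "K \<in> sets borel" and K_fin: "emeasure L K < \<infinity>"
    and u_K: "\<And>x. x \<notin> K \<Longrightarrow> u x = 0"
  shows "(\<integral>\<^sup>+\<omega>. sexp p (\<Sum>k. on_reals u (Y k \<omega>)) \<partial>M) = sexp p (\<integral>\<^sup>+x. sexpm1 p (u x) \<partial>L)"
proof -
  \<comment> \<open>The value 0 is left out, since its level set may have infinite intensity; it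
    contributes nothing to the sum.\<close>
  let ?R = "range u - {0}"
  define B where "B r = u -` {r}" for r
  have fin: "finite ?R"
    using u by (auto simp: simple_function_def)
  have B [measurable]: "B r \<in> sets borel" for r
    using simple_functionD(2)[OF u, of "{r}"] by (simp add: B_def)
  have B_fin: "emeasure L (B r) < \<infinity>" if "r \<in> ?R" for r
  proof -
    have "B r \<subseteq> K" using that u_K by (auto simp: B_def)
    then have "emeasure L (B r) \<le> emeasure L K" by (intro emeasure_mono) auto
    then show ?thesis using K_fin by simp
  qed
  have decomp: "g (u x) = (\<Sum>r\<in>?R. g r * indicator (B r) x)" if "g 0 = 0" for g :: "ennreal \<Rightarrow> ennreal" and x
  proof (cases "u x = 0")
    case True
    then show ?thesis using that by (auto simp: B_def indicator_def intro!: sum.neutral[symmetric])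
  next
    case False
    have "(\<Sum>r\<in>?R. g r * indicator (B r) x) = (\<Sum>r\<in>{u x}. g r * indicator (B r) x)"
      using fin False by (intro sum.mono_neutral_right) (auto simp: B_def indicator_def)
    then show ?thesis by (simp add: B_def)
  qed
  have lift: "on_reals u y = (\<Sum>r\<in>?R. r * on_reals (indicator (B r)) y)" for y
    using decomp[of "\<lambda>x. x" "real_of_ereal y"] by (auto simp: on_reals_def)
  \<comment> \<open>The independence clause speaks of families indexed by natural numbers, so the
    values of u are coded as such.\<close>
  define e where "e = to_nat_on ?R"
  define e' where "e' = the_inv_into ?R e"
  have e: "inj_on e ?R"
    unfolding e_def using fin by (intro inj_on_to_nat_on countable_finite)
  have e': "e' (e r) = r" if "r \<in> ?R" for r
    using that e by (simp add: e'_def the_inv_into_f_f)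
  let ?N = "\<lambda>r \<omega>. card (point_set Y \<omega> \<inter> B r)"
  have count: "AE \<omega> in M. \<forall>r\<in>?R. (\<Sum>k. on_reals (indicator (B r)) (Y k \<omega>)) = (of_nat (?N r \<omega>) :: ennreal)"
    using fin B_fin by (intro AE_finite_allI poisson_process_count_AE[OF P]) auto
  have disj: "disjoint_family_on (\<lambda>j. B (e' j)) (e ` ?R)"
    by (auto simp: disjoint_family_on_def B_def e')
  have ind: "indep_vars (\<lambda>_. count_space UNIV) (\<lambda>j \<omega>. ?N (e' j) \<omega>) (e ` ?R)"
    using P fin disj B_fin B unfolding poisson_process_def
    by (auto simp: e' dest!: spec[of _ "e ` ?R"] spec[of _ "\<lambda>j. B (e' j)"])
  have ind': "indep_vars (\<lambda>_. borel) (\<lambda>j \<omega>. sexp p (e' j * of_nat (?N (e' j) \<omega>))) (e ` ?R)"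
    by (rule indep_vars_compose2[OF ind, where Y = "\<lambda>j n. sexp p (e' j * of_nat n)"]) auto
  have "(\<integral>\<^sup>+\<omega>. sexp p (\<Sum>k. on_reals u (Y k \<omega>)) \<partial>M) = (\<integral>\<^sup>+\<omega>. (\<Prod>j\<in>e ` ?R. sexp p (e' j * of_nat (?N (e' j) \<omega>))) \<partial>M)"
  proof (rule nn_integral_cong_AE, use count in eventually_elim)
    case (elim \<omega>)
    have "(\<Sum>k. on_reals u (Y k \<omega>)) = (\<Sum>r\<in>?R. \<Sum>k. r * on_reals (indicator (B r)) (Y k \<omega>))"
      unfolding lift by (rule suminf_sum) auto
    also have "\<dots> = (\<Sum>r\<in>?R. r * of_nat (?N r \<omega>))"
      using elim by (intro sum.cong) auto
    also have "sexp p \<dots> = (\<Prod>r\<in>?R. sexp p (r * of_nat (?N r \<omega>)))"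
      using fin by (rule sexp_sum)
    also have "\<dots> = (\<Prod>j\<in>e ` ?R. sexp p (e' j * of_nat (?N (e' j) \<omega>)))"
      by (subst prod.reindex[OF e]) (auto simp: e' intro!: prod.cong)
    finally show ?case .
  qed
  also have "\<dots> = (\<Prod>j\<in>e ` ?R. \<integral>\<^sup>+\<omega>. sexp p (e' j * of_nat (?N (e' j) \<omega>)) \<partial>M)"
    using fin ind' by (intro indep_vars_nn_integral) auto
  also have "\<dots> = (\<Prod>r\<in>?R. \<integral>\<^sup>+\<omega>. sexp p (r * of_nat (?N r \<omega>)) \<partial>M)"
    by (subst prod.reindex[OF e]) (auto simp: e' intro!: prod.cong)
  also have "\<dots> = (\<Prod>r\<in>?R. sexp p (sexpm1 p r * emeasure L (B r)))"
  proof (rule prod.cong)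
    fix r assume r: "r \<in> ?R"
    then have "r < \<top>" using u_fin by auto
    then obtain x where x: "r = ennreal x" "0 \<le> x" by (cases r) auto
    show "(\<integral>\<^sup>+\<omega>. sexp p (r * of_nat (?N r \<omega>)) \<partial>M) = sexp p (sexpm1 p r * emeasure L (B r))"
      using poisson_process_laplace_count[OF P B B_fin[OF r] x(2)] x(1) by simp
  qed simp
  also have "\<dots> = sexp p (\<Sum>r\<in>?R. sexpm1 p r * emeasure L (B r))"
    using fin by (rule sexp_sum[symmetric])
  also have "(\<Sum>r\<in>?R. sexpm1 p r * emeasure L (B r)) = (\<integral>\<^sup>+x. sexpm1 p (u x) \<partial>L)"
    by (subst decomp[of "sexpm1 p"]) (auto simp: nn_integral_sum nn_integral_cmult)
  finally show ?thesis .
qed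

lemma suminf_SUP_incseq:
  fixes f :: "nat \<Rightarrow> nat \<Rightarrow> ennreal"
  assumes "\<And>k. incseq (\<lambda>n. f n k)"
  shows "(\<Sum>k. SUP n. f n k) = (SUP n. \<Sum>k. f n k)"
  using assms nn_integral_monotone_convergence_SUP[of f "count_space UNIV"]
  by (simp add: nn_integral_count_space_nat incseq_def le_fun_def)

text \<open>Monotone approximation by simple functions with bounded support reduces the formula to
  the simple case; the intensity is assumed finite only on bounded intervals.\<close>

lemma (in prob_space) poisson_process_laplace:
  assumes P: "poisson_process L Y" and sets_L [measurable_cong, simp]: "sets L = sets borel"
    and bounded: "\<And>n::nat. emeasure L {- real n..real n} < \<infinity>"
    and [measurable]: "u \<in> borel_measurable borel"
  shows "(\<integral>\<^sup>+\<omega>. sexp p (\<Sum>k. on_reals u (Y k \<omega>)) \<partial>M) = sexp p (\<integral>\<^sup>+x. sexpm1 p (u x) \<partial>L)"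
proof -
  obtain f where f: "\<And>i. simple_function borel (f i)" "incseq f" "\<And>i x. f i x < \<top>"
      "\<And>x. (SUP i. f i x) = u x"
    using borel_measurable_implies_simple_function_sequence'[of u borel] by auto
  \<comment> \<open>The cut-off to a bounded interval supplies the support of finite intensity that
    the simple case asks for.\<close>
  define g where "g i x = f i x * indicator {- real i..real i} x" for i x
  have Y [measurable]: "Y k \<in> borel_measurable M" for k
    using P by (auto simp: poisson_process_def)
  have g [measurable]: "g i \<in> borel_measurable borel" for i
    unfolding g_def using borel_measurable_simple_function[OF f(1)] by measurable
  have inc: "incseq (\<lambda>i. g i x)" for x
    using f(2) by (auto simp: g_def incseq_def le_fun_def indicator_def)
  have SUP_g: "(SUP i. g i x) = u x" for x
  proof (rule antisym)
    show "(SUP i. g i x) \<le> u x"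
      unfolding f(4)[symmetric] by (intro SUP_mono) (auto simp: g_def indicator_def)
    show "u x \<le> (SUP i. g i x)"
      unfolding f(4)[symmetric]
    proof (rule SUP_mono)
      fix n
      obtain N :: nat where N: "\<bar>x\<bar> \<le> real N" using real_arch_simple by blast
      then have "g (max n N) x = f (max n N) x"
        by (auto simp: g_def abs_le_iff indicator_def of_nat_max)
      moreover have "f n x \<le> f (max n N) x"
        using f(2) by (auto simp: incseq_def le_fun_def)
      ultimately show "\<exists>m\<in>UNIV. f n x \<le> g m x" by (intro bexI[of _ "max n N"]) auto
    qed
  qed
  have inc': "incseq (\<lambda>i. on_reals (g i) y)" for y
    using inc by (auto simp: on_reals_def incseq_def)
  have lift_SUP: "(SUP n. on_reals (g n) y) = on_reals u y" for y
    by (cases y) (auto simp: SUP_g)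
  have eq: "(\<Sum>k. on_reals u (Y k \<omega>)) = (SUP n. \<Sum>k. on_reals (g n) (Y k \<omega>))" for \<omega>
    by (subst suminf_SUP_incseq[symmetric, OF inc']) (simp add: lift_SUP)
  show ?thesis
    unfolding eq
  proof (rule nn_integral_sexp_SUP)
    show "incseq (\<lambda>n. \<Sum>k. on_reals (g n) (Y k \<omega>))" for \<omega>
      using inc' by (auto simp: incseq_def intro!: suminf_le)
    show "(\<integral>\<^sup>+\<omega>. sexp p (\<Sum>k. on_reals (g n) (Y k \<omega>)) \<partial>M) = sexp p (\<integral>\<^sup>+x. sexpm1 p (g n x) \<partial>L)" for n
    proof (rule poisson_process_laplace_simple[OF P sets_L, where K = "{- real n..real n}"])
      show "simple_function borel (g n)"
        unfolding g_def using f(1) by (intro simple_function_mult) auto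
      show "g n x < \<top>" for x
        using f(3) by (auto simp: g_def indicator_def)
    qed (use bounded in \<open>auto simp: g_def\<close>)
    have "(\<lambda>n. \<integral>\<^sup>+x. sexpm1 p (g n x) \<partial>L) \<longlonglongrightarrow> (SUP n. \<integral>\<^sup>+x. sexpm1 p (g n x) \<partial>L)"
      using inc by (intro LIMSEQ_SUP) (auto simp: incseq_def intro!: nn_integral_mono sexpm1_mono)
    also have "(SUP n. \<integral>\<^sup>+x. sexpm1 p (g n x) \<partial>L) = (\<integral>\<^sup>+x. (SUP n. sexpm1 p (g n x)) \<partial>L)"
      using inc by (intro nn_integral_monotone_convergence_SUP[symmetric])
        (auto simp: incseq_def le_fun_def intro!: sexpm1_mono)
    also have "\<dots> = (\<integral>\<^sup>+x. sexpm1 p (u x) \<partial>L)"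
      by (simp add: sexpm1_SUP[OF inc, symmetric] SUP_g)
    finally show "(\<lambda>n. \<integral>\<^sup>+x. sexpm1 p (g n x) \<partial>L) \<longlonglongrightarrow> (\<integral>\<^sup>+x. sexpm1 p (u x) \<partial>L)" .
  qed measurable
qed

text \<open>Conditioning expressed through Fubini: by independence, A may be frozen at one sample
  point while the average is taken over R.\<close>

lemma (in prob_space) nn_integral_indep_var:
  assumes ind: "indep_var S A T R" and [measurable]: "f \<in> borel_measurable (S \<Otimes>\<^sub>M T)"
  shows "(\<integral>\<^sup>+\<omega>. f (A \<omega>, R \<omega>) \<partial>M) = (\<integral>\<^sup>+\<omega>'. \<integral>\<^sup>+\<omega>. f (A \<omega>', R \<omega>) \<partial>M \<partial>M)"
proof -
  have [measurable]: "A \<in> measurable M S" "R \<in> measurable M T"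
    using ind by (auto dest: indep_var_rv1 indep_var_rv2)
  interpret R: prob_space "distr M T R" by (rule prob_space_distr) measurable
  have "(\<integral>\<^sup>+\<omega>. f (A \<omega>, R \<omega>) \<partial>M) = integral\<^sup>N (distr M (S \<Otimes>\<^sub>M T) (\<lambda>\<omega>. (A \<omega>, R \<omega>))) f"
    by (subst nn_integral_distr) auto
  also have "\<dots> = integral\<^sup>N (distr M S A \<Otimes>\<^sub>M distr M T R) f"
    using ind by (simp add: indep_var_distribution_eq)
  also have "\<dots> = (\<integral>\<^sup>+a. \<integral>\<^sup>+r. f (a, r) \<partial>distr M T R \<partial>distr M S A)"
    by (intro R.nn_integral_fst[symmetric]) measurable
  also have "\<dots> = (\<integral>\<^sup>+\<omega>'. \<integral>\<^sup>+r. f (A \<omega>', r) \<partial>distr M T R \<partial>M)"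
    by (subst nn_integral_distr) measurable
  also have "\<dots> = (\<integral>\<^sup>+\<omega>'. \<integral>\<^sup>+\<omega>. f (A \<omega>', R \<omega>) \<partial>M \<partial>M)"
    by (intro nn_integral_cong, subst nn_integral_distr) (auto dest: measurable_space)
  finally show ?thesis .
qed

text \<open>The points \<open>Z j0\<close> carry marks that are read from disjoint blocks
  \<open>K k\<close> of the other coordinates. Given the points, the marks are independent, and a
  point at y contributes V y to the exponent, so the marked sum has the transform of the unmarked
  sum with weight V. This applies both to the children of an individual and to the
  immigrants.\<close>

lemma (in prob_space) marked_poisson_process_laplace:
  fixes Z :: "'j \<Rightarrow> 'a \<Rightarrow> nat \<Rightarrow> ereal"
  defines "N \<equiv> (\<lambda>_::'j. PiM (UNIV :: nat set) (\<lambda>_. borel :: ereal measure))"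
  assumes ind: "indep_vars N Z I"
    and j0: "j0 \<in> I" and K: "\<And>k. K k \<subseteq> I - {j0}" and disj: "disjoint_family K"
    and P: "poisson_process L (\<lambda>k \<omega>. Z j0 \<omega> k)" and sets_L: "sets L = sets borel"
    and bounded: "\<And>n::nat. emeasure L {- real n..real n} < \<infinity>"
    and \<tau>: "\<And>k::nat. (\<lambda>(y, z). \<tau> k y z) \<in> borel_measurable (borel \<Otimes>\<^sub>M PiM (K k) N)"
    and V [measurable]: "V \<in> borel_measurable borel"
    and laplace: "\<And>k y. (\<integral>\<^sup>+\<omega>. sexp p (\<tau> k y (restrict (\<lambda>j. Z j \<omega>) (K k))) \<partial>M) = sexp p (on_reals V y)"
  shows "(\<integral>\<^sup>+\<omega>. sexp p (\<Sum>k. \<tau> k (Z j0 \<omega> k) (restrict (\<lambda>j. Z j \<omega>) (K k))) \<partial>M)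
     = sexp p (\<integral>\<^sup>+x. sexpm1 p (V x) \<partial>L)"
proof -
  define U where "U = (\<Union>k. K k)"
  define A where "A \<omega> = restrict (\<lambda>j. Z j \<omega>) {j0}" for \<omega>
  define R where "R \<omega> = restrict (\<lambda>j. Z j \<omega>) U" for \<omega>
  define f where "f = (\<lambda>(a :: 'j \<Rightarrow> nat \<Rightarrow> ereal, r). sexp p (\<Sum>k. \<tau> k (a j0 k) (restrict r (K k))))"
  have iv: "indep_var (PiM {j0} N) A (PiM U N) R"
    unfolding A_def R_def using K j0 by (intro indep_var_restrict[OF ind]) (auto simp: U_def)
  have iK: "indep_vars (\<lambda>k. PiM (K k) N) (\<lambda>k \<omega>. restrict (\<lambda>j. Z j \<omega>) (K k)) UNIV"
    using K disj by (intro indep_vars_restrict[OF ind]) auto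
  then have rvK [measurable]: "(\<lambda>\<omega>. restrict (\<lambda>j. Z j \<omega>) (K k)) \<in> measurable M (PiM (K k) N)" for k
    by (auto simp: indep_vars_def)
  have \<tau>1: "(\<lambda>z. \<tau> k y z) \<in> borel_measurable (PiM (K k) N)" for k y
    using measurable_Pair2[OF \<tau>, of y k] by simp
  have \<tau>2 [measurable]: "(\<lambda>\<omega>. \<tau> k y (restrict (\<lambda>j. Z j \<omega>) (K k))) \<in> borel_measurable M" for k y
    by (rule measurable_compose[OF rvK \<tau>1])
  have f_meas: "f \<in> borel_measurable (PiM {j0} N \<Otimes>\<^sub>M PiM U N)"
  proof -
    have "(\<lambda>x. (fst x j0 k, restrict (snd x) (K k))) \<in> measurable (PiM {j0} N \<Otimes>\<^sub>M PiM U N) (borel \<Otimes>\<^sub>M PiM (K k) N)" for k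
    proof (rule measurable_Pair)
      have "(\<lambda>x. fst x j0) \<in> measurable (PiM {j0} N \<Otimes>\<^sub>M PiM U N) (N j0)"
        by (rule measurable_compose[OF measurable_fst measurable_component_singleton]) simp
      then show "(\<lambda>x. fst x j0 k) \<in> borel_measurable (PiM {j0} N \<Otimes>\<^sub>M PiM U N)"
        unfolding N_def by (rule measurable_compose[OF _ measurable_component_singleton]) simp
      show "(\<lambda>x. restrict (snd x) (K k)) \<in> measurable (PiM {j0} N \<Otimes>\<^sub>M PiM U N) (PiM (K k) N)"
        by (rule measurable_compose[OF measurable_snd measurable_restrict_subset]) (auto simp: U_def)
    qed
    from measurable_compose[OF this \<tau>] show ?thesis
      unfolding f_def by (simp add: case_prod_beta)
  qed
  \<comment> \<open>Here the points are frozen at a and only the marks are averaged.\<close>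
  have inner: "(\<integral>\<^sup>+\<omega>. sexp p (\<Sum>k. \<tau> k (a k) (restrict (\<lambda>j. Z j \<omega>) (K k))) \<partial>M) = sexp p (\<Sum>k. on_reals V (a k))" for a
  proof -
    \<comment> \<open>Independence gives a product only for finitely many factors, so partial sums
      come first.\<close>
    have "(\<integral>\<^sup>+\<omega>. sexp p (SUP n. \<Sum>k<n. \<tau> k (a k) (restrict (\<lambda>j. Z j \<omega>) (K k))) \<partial>M) = sexp p (\<Sum>k. on_reals V (a k))"
    proof (rule nn_integral_sexp_SUP)
      show "incseq (\<lambda>n. \<Sum>k<n. \<tau> k (a k) (restrict (\<lambda>j. Z j \<omega>) (K k)))" for \<omega>
        by (auto simp: incseq_def intro!: sum_mono2)
      show "(\<integral>\<^sup>+\<omega>. sexp p (\<Sum>k<n. \<tau> k (a k) (restrict (\<lambda>j. Z j \<omega>) (K k))) \<partial>M) = sexp p (\<Sum>k<n. on_reals V (a k))" for n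
      proof -
        have "indep_vars (\<lambda>_. borel) (\<lambda>k \<omega>. sexp p (\<tau> k (a k) (restrict (\<lambda>j. Z j \<omega>) (K k)))) {..<n}"
          by (rule indep_vars_subset[OF indep_vars_compose2[OF iK, where Y = "\<lambda>k z. sexp p (\<tau> k (a k) z)"]])
            (auto intro: measurable_compose[OF \<tau>1])
        then show ?thesis
          by (simp add: sexp_sum indep_vars_nn_integral laplace)
      qed
      show "(\<lambda>n. \<Sum>k<n. on_reals V (a k)) \<longlonglongrightarrow> (\<Sum>k. on_reals V (a k))"
        by (intro summable_LIMSEQ) auto
    qed measurable
    then show ?thesis by (simp add: suminf_eq_SUP)
  qed
  have res: "restrict (R \<omega>) (K k) = restrict (\<lambda>j. Z j \<omega>) (K k)" for \<omega> k
    by (auto simp: R_def U_def fun_eq_iff)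
  have "(\<integral>\<^sup>+\<omega>. sexp p (\<Sum>k. \<tau> k (Z j0 \<omega> k) (restrict (\<lambda>j. Z j \<omega>) (K k))) \<partial>M) = (\<integral>\<^sup>+\<omega>. f (A \<omega>, R \<omega>) \<partial>M)"
    by (simp add: f_def res A_def)
  also have "\<dots> = (\<integral>\<^sup>+\<omega>'. \<integral>\<^sup>+\<omega>. f (A \<omega>', R \<omega>) \<partial>M \<partial>M)"
    by (rule nn_integral_indep_var[OF iv f_meas])
  also have "\<dots> = (\<integral>\<^sup>+\<omega>. sexp p (\<Sum>k. on_reals V (Z j0 \<omega> k)) \<partial>M)"
    by (simp add: f_def res A_def inner)
  also have "\<dots> = sexp p (\<integral>\<^sup>+x. sexpm1 p (V x) \<partial>L)"
    by (rule poisson_process_laplace[OF P sets_L bounded V])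
  finally show ?thesis .
qed

section \<open>Clusters as branching random walks\<close>

text \<open>The total weight of the first \<open>n\<close> generations descending from the individual \<open>(i, w)\<close>, when that
  individual is placed at \<open>y\<close>. In the configuration \<open>z\<close>, the index \<open>None\<close> stands for the immigrants and
  \<open>Some (i, w)\<close> for the displacements of the children of \<open>(i, w)\<close>.\<close>
primrec tree_sum ::
    "(real \<Rightarrow> ennreal) \<Rightarrow> nat \<Rightarrow> nat \<Rightarrow> nat list \<Rightarrow> ereal \<Rightarrow> ((nat \<times> nat list) option \<Rightarrow> nat \<Rightarrow> ereal) \<Rightarrow> ennreal"
where
  "tree_sum b 0 i w y z = on_reals b y"
| "tree_sum b (Suc n) i w y z = on_reals b y + (\<Sum>k. tree_sum b n i (k # w) (y + z (Some (i, w)) k) z)"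

text \<open>Labels grow at the head, so descent from w means having w as a suffix. These are the
  offspring processes on which the subtree at (i, w) depends.\<close>

definition descendants :: "nat \<Rightarrow> nat list \<Rightarrow> (nat \<times> nat list) option set" where
  "descendants i w = {Some (i, v @ w) |v. True}"

lemma descendants_self [simp]: "Some (i, w) \<in> descendants i w"
  by (auto simp: descendants_def)

lemma descendants_Cons: "descendants i (k # w) \<subseteq> descendants i w - {Some (i, w)}"
proof -
  have "\<exists>u. v @ k # w = u @ w" for v
    by (rule exI[of _ "v @ [k]"]) simp
  then show ?thesis by (auto simp: descendants_def)
qed

lemma disjoint_descendants: "disjoint_family (\<lambda>k. descendants i (k # w))"
  by (auto simp: disjoint_family_on_def descendants_def)

lemma tree_sum_restrict:
  "descendants i w \<subseteq> K \<Longrightarrow> tree_sum b n i w y (restrict z K) = tree_sum b n i w y z"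
proof (induction n arbitrary: w y)
  case (Suc n)
  have "descendants i (k # w) \<subseteq> K" for k
    using Suc.prems descendants_Cons[of i k w] by blast
  moreover have "Some (i, w) \<in> K"
    using Suc.prems descendants_self by blast
  ultimately show ?case
    by (simp only: tree_sum.simps Suc.IH restrict_apply')
qed simp

lemma tree_sum_measurable:
  assumes [measurable]: "b \<in> borel_measurable borel" and "descendants i w \<subseteq> K"
  shows "(\<lambda>(y, z). tree_sum b n i w y z)
     \<in> borel_measurable (borel \<Otimes>\<^sub>M PiM K (\<lambda>_. PiM UNIV (\<lambda>_. borel)))"
  using assms(2)
proof (induction n arbitrary: w)
  case (Suc n)
  let ?M = "borel \<Otimes>\<^sub>M PiM K (\<lambda>_. PiM UNIV (\<lambda>_. borel)) :: (ereal \<times> _) measure"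
  have K: "Some (i, w) \<in> K"
    using Suc.prems descendants_self by blast
  have "(\<lambda>x. tree_sum b n i (k # w) (fst x + snd x (Some (i, w)) k) (snd x)) \<in> borel_measurable ?M" for k
  proof -
    have [measurable]: "(\<lambda>x. snd x (Some (i, w)) k) \<in> borel_measurable ?M"
    proof -
      have "(\<lambda>x. snd x (Some (i, w))) \<in> measurable ?M (PiM UNIV (\<lambda>_. borel))"
        by (rule measurable_compose[OF measurable_snd measurable_component_singleton[OF K]])
      then show ?thesis by measurable
    qed
    have "descendants i (k # w) \<subseteq> K"
      using Suc.prems descendants_Cons[of i k w] by blast
    from Suc.IH[OF this] have "(\<lambda>(y, z). tree_sum b n i (k # w) y z) \<in> borel_measurable ?M" .
    from measurable_compose[OF _ this, of "\<lambda>x. (fst x + snd x (Some (i, w)) k, snd x)" ?M]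
    show ?thesis by simp
  qed
  then show ?case by (simp add: case_prod_beta)
next
  case 0
  show ?case by (simp add: case_prod_beta)
qed

lemma tree_sum_infinite: "\<bar>y\<bar> = \<infinity> \<Longrightarrow> tree_sum b n i w y z = 0"
proof (induction n arbitrary: w y)
  case (Suc n)
  then have "\<bar>y + z (Some (i, w)) k\<bar> = \<infinity>" for k
    by (cases y; cases "z (Some (i, w)) k") auto
  with Suc show ?case by (simp add: on_reals_def)
qed (simp add: on_reals_def)

lemma tree_sum_incseq: "incseq (\<lambda>n. tree_sum b n i w y z)"
proof (rule incseq_SucI)
  show "tree_sum b n i w y z \<le> tree_sum b (Suc n) i w y z" for n
    by (induction n arbitrary: w y) (auto intro!: add_mono suminf_le)
qed

text \<open>The exponent of the Laplace transform of a branching random walk stopped after n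
  generations: the individual itself adds b, and the Laplace functional of its Poisson offspring
  adds the integral.\<close>

primrec tree_log_laplace :: "bool \<Rightarrow> real measure \<Rightarrow> (real \<Rightarrow> ennreal) \<Rightarrow> nat \<Rightarrow> real \<Rightarrow> ennreal" where
  "tree_log_laplace p L b 0 y = b y"
| "tree_log_laplace p L b (Suc n) y = b y + (\<integral>\<^sup>+s. sexpm1 p (tree_log_laplace p L b n (y + s)) \<partial>L)"

lemma tree_log_laplace_measurable [measurable]:
  assumes [measurable]: "b \<in> borel_measurable borel" and L: "sigma_finite_measure L"
    and sets_L [measurable_cong]: "sets L = sets borel"
  shows "tree_log_laplace p L b n \<in> borel_measurable borel"
proof (induction n)
  case (Suc n)
  note [measurable] = Suc
  interpret L: sigma_finite_measure L by fact
  show ?case by simp measurable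
qed simp

lemma tree_log_laplace_incseq: "incseq (\<lambda>n. tree_log_laplace p L b n y)"
proof (rule incseq_SucI)
  show "tree_log_laplace p L b n y \<le> tree_log_laplace p L b (Suc n) y" for n
    by (induction n arbitrary: y) (auto intro!: add_left_mono nn_integral_mono sexpm1_mono)
qed

text \<open>The last entry of v is the one split off: in \<open>v @ w\<close> it names the child of
  w through which the line of descent passes, as in the recursion of
  \<open>tree_sum\<close>.\<close>

lemma nn_integral_count_space_snoc:
  fixes f :: "'b list \<Rightarrow> ennreal"
  shows "(\<integral>\<^sup>+v. f v \<partial>count_space UNIV)
    = f [] + (\<integral>\<^sup>+k. \<integral>\<^sup>+v. f (v @ [k]) \<partial>count_space UNIV \<partial>count_space UNIV)"
proof -
  have "bij_betw (\<lambda>(k, v). v @ [k]) UNIV (- {[]} :: 'b list set)"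
  proof (rule bij_betwI[where g = "\<lambda>v. (last v, butlast v)"])
  qed auto
  then have "(\<integral>\<^sup>+x. f (case x of (k, v) \<Rightarrow> v @ [k]) \<partial>count_space UNIV) = (\<integral>\<^sup>+v. f v \<partial>count_space (- {[]}))"
    by (rule nn_integral_bij_count_space)
  then have *: "(\<integral>\<^sup>+v. f v \<partial>count_space (- {[]})) = (\<integral>\<^sup>+k. \<integral>\<^sup>+v. f (v @ [k]) \<partial>count_space UNIV \<partial>count_space UNIV)"
    by (simp add: nn_integral_fst_count_space[symmetric])
  have "(\<integral>\<^sup>+v. f v \<partial>count_space UNIV) = (\<integral>\<^sup>+v. f v * indicator {[]} v + f v * indicator (- {[]}) v \<partial>count_space UNIV)"
    by (intro nn_integral_cong) (auto simp: indicator_def)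
  also have "\<dots> = f [] + (\<integral>\<^sup>+v. f v \<partial>count_space (- {[]}))"
    by (subst nn_integral_add) (auto simp: nn_integral_count_space_indicator)
  finally show ?thesis unfolding * .
qed

section \<open>Sums over generations in terms of the actual positions\<close>

context hawkes_process
begin

definition config :: "(nat \<times> nat list) option \<Rightarrow> 'a \<Rightarrow> nat \<Rightarrow> ereal" where
  "config j \<omega> = (case j of None \<Rightarrow> (\<lambda>k. ereal (X k \<omega>)) | Some (i, w) \<Rightarrow> (\<lambda>k. D i w k \<omega>))"

lemma config_simps [simp]: "config None \<omega> k = ereal (X k \<omega>)" "config (Some (i, w)) \<omega> k = D i w k \<omega>"
  by (simp_all add: config_def)

lemma indep_config: "indep_vars (\<lambda>_. PiM UNIV (\<lambda>_. borel)) config UNIV"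
  using independent unfolding config_def .

lemma X_measurable [measurable]: "X i \<in> borel_measurable M"
  using immigrants by (auto simp: poisson_process_def borel_measurable_ereal_iff)

lemma D_measurable [measurable]: "D i w k \<in> borel_measurable M"
  using offspring[of i w] by (auto simp: poisson_process_def)

lemma position_measurable [measurable]: "position X D i w \<in> borel_measurable M"
proof (induction w)
  case Nil
  have "position X D i [] = (\<lambda>\<omega>. ereal (X i \<omega>))" by (simp add: fun_eq_iff)
  then show ?case by simp
next
  case (Cons k w)
  have "position X D i (k # w) = (\<lambda>\<omega>. position X D i w \<omega> + D i w k \<omega>)" by (simp add: fun_eq_iff)
  then show ?case using Cons by simp
qed

lemma tree_sum_position:
  "tree_sum b n i w (position X D i w \<omega>) (\<lambda>j. config j \<omega>)
    = (\<integral>\<^sup>+v. on_reals b (position X D i (v @ w) \<omega>) * indicator {v. length v \<le> n} v \<partial>count_space UNIV)"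
proof (induction n arbitrary: w)
  case 0
  have "(\<integral>\<^sup>+v. on_reals b (position X D i (v @ w) \<omega>) * indicator {v. length v \<le> 0} v \<partial>count_space UNIV)
     = (\<integral>\<^sup>+v. on_reals b (position X D i (v @ w) \<omega>) * indicator {[]} v \<partial>count_space UNIV)"
    by (intro nn_integral_cong) (auto simp: indicator_def)
  then show ?case by simp
next
  case (Suc n)
  have "(\<integral>\<^sup>+v. on_reals b (position X D i (v @ w) \<omega>) * indicator {v. length v \<le> Suc n} v \<partial>count_space UNIV)
     = on_reals b (position X D i w \<omega>) +
       (\<integral>\<^sup>+k. \<integral>\<^sup>+v. on_reals b (position X D i (v @ k # w) \<omega>) * indicator {v. length v \<le> n} v
          \<partial>count_space UNIV \<partial>count_space UNIV)"
    by (subst nn_integral_count_space_snoc) (simp add: indicator_def)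
  then show ?case
    using Suc.IH[of "_ # w"] by (simp add: nn_integral_count_space_nat)
qed

lemma SUP_tree_sum_position:
  "(SUP n. tree_sum b n i w (position X D i w \<omega>) (\<lambda>j. config j \<omega>))
    = (\<integral>\<^sup>+v. on_reals b (position X D i (v @ w) \<omega>) \<partial>count_space UNIV)"
proof -
  have SUP: "(SUP n. x * indicator {v. length v \<le> n} v) = x" for x :: ennreal and v :: "nat list"
  proof (rule antisym)
    show "x \<le> (SUP n. x * indicator {v. length v \<le> n} v)"
      by (rule SUP_upper2[of "length v"]) auto
  qed (auto intro!: SUP_least simp: indicator_def)
  have "(\<integral>\<^sup>+v. on_reals b (position X D i (v @ w) \<omega>) \<partial>count_space UNIV)
    = (\<integral>\<^sup>+v. (SUP n. on_reals b (position X D i (v @ w) \<omega>) * indicator {v. length v \<le> n} v) \<partial>count_space UNIV)"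
    unfolding SUP ..
  also have "\<dots> = (SUP n. \<integral>\<^sup>+v. on_reals b (position X D i (v @ w) \<omega>) * indicator {v. length v \<le> n} v \<partial>count_space UNIV)"
    by (intro nn_integral_monotone_convergence_SUP) (auto simp: incseq_def le_fun_def indicator_def)
  finally show ?thesis
    unfolding tree_sum_position ..
qed

end

section \<open>Laplace transforms of finitely many generations\<close>

locale subcritical_hawkes = hawkes_process M \<nu> h X D
  for M :: "'a measure" and \<nu> h X D +
  fixes \<mu> :: real
  assumes fertility_integrable: "set_integrable lborel {0<..} h"
    and \<mu>_def: "\<mu> = (LINT t:{0<..}|lborel. h t)"
    and \<mu>_pos: "0 < \<mu>" and \<mu>_less_1: "\<mu> < 1"
    and moment_integrable: "set_integrable lborel {0<..} (\<lambda>t. t * h t)"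
begin

abbreviation fert :: "real measure" where
  "fert \<equiv> density lborel (\<lambda>t. ennreal (indicator {0<..} t * h t))"

abbreviation immi :: "real measure" where
  "immi \<equiv> density lborel (\<lambda>_. ennreal \<nu>)"

lemma fertility_measurable [measurable]: "(\<lambda>t. indicator {0<..} t * h t) \<in> borel_measurable borel"
  using fertility_borel by (simp add: set_borel_measurable_def)

lemma emeasure_fert_UNIV: "emeasure fert UNIV = ennreal \<mu>"
proof -
  have "emeasure fert UNIV = (\<integral>\<^sup>+t. ennreal (indicator {0<..} t * h t) \<partial>lborel)"
    by (simp add: emeasure_density)
  also have "\<dots> = ennreal (LINT t|lborel. indicator {0<..} t * h t)"
    using fertility_integrable fertility_nonneg
    by (intro nn_integral_eq_integral) (auto simp: set_integrable_def indicator_def)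
  finally show ?thesis
    by (simp add: \<mu>_def set_lebesgue_integral_def)
qed

sublocale fert: finite_measure fert
  by (rule finite_measureI) (simp add: emeasure_fert_UNIV)

lemma emeasure_fert_bounded: "emeasure fert {- real n..real n} < \<infinity>"
  using fert.emeasure_finite[of "{- real n..real n}"] by (simp only: less_top infinity_ennreal_def)

lemma emeasure_immi_bounded: "emeasure immi {- real n..real n} < \<infinity>"
  by (subst emeasure_density) (auto simp: nn_integral_cmult ennreal_mult_less_top)

text \<open>The subtrees of the children are marks on the offspring process of (i, w): they depend
  on disjoint sets of offspring processes, none of which is that of (i, w) itself. The induction
  hypothesis gives the transform of each mark.\<close>

lemma laplace_tree:
  assumes b [measurable]: "b \<in> borel_measurable borel"
  shows "(\<integral>\<^sup>+\<omega>. sexp p (tree_sum b n i w y (\<lambda>j. config j \<omega>)) \<partial>M) = sexp p (on_reals (tree_log_laplace p fert b n) y)"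
proof (induction n arbitrary: w y)
  case 0
  show ?case by (simp add: emeasure_space_1 on_reals_def)
next
  case (Suc n)
  let ?V = "tree_log_laplace p fert b"
  note V [measurable] = tree_log_laplace_measurable[OF b fert.sigma_finite_measure_axioms, of p]
  show ?case
  proof (cases "\<bar>y\<bar> = \<infinity>")
    case True
    then show ?thesis
      by (simp add: tree_sum_infinite emeasure_space_1 on_reals_def del: tree_sum.simps tree_log_laplace.simps)
  next
    case False
    then obtain x where y: "y = ereal x" by auto
    let ?\<tau> = "\<lambda>k d z. tree_sum b n i (k # w) (y + d) z"
    have shift: "on_reals (?V n) (y + d) = on_reals (\<lambda>s. ?V n (x + s)) d" for d
      by (cases d) (simp_all add: y)
    have "(\<integral>\<^sup>+\<omega>. sexp p (\<Sum>k. ?\<tau> k (config (Some (i, w)) \<omega> k) (restrict (\<lambda>j. config j \<omega>) (descendants i (k # w)))) \<partial>M)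
       = sexp p (\<integral>\<^sup>+s. sexpm1 p (?V n (x + s)) \<partial>fert)"
    proof (rule marked_poisson_process_laplace[OF indep_config])
      show "poisson_process fert (\<lambda>k \<omega>. config (Some (i, w)) \<omega> k)"
        using offspring by simp
      show "(\<lambda>(d, z). ?\<tau> k d z) \<in> borel_measurable (borel \<Otimes>\<^sub>M PiM (descendants i (k # w)) (\<lambda>_. PiM UNIV (\<lambda>_. borel)))" for k
        using measurable_compose[OF _ tree_sum_measurable[OF b order.refl, of n i "k # w"],
          of "\<lambda>x. (y + fst x, snd x)" "borel \<Otimes>\<^sub>M PiM (descendants i (k # w)) (\<lambda>_. PiM UNIV (\<lambda>_. borel))"]
        by (simp add: case_prod_beta)
      show "(\<integral>\<^sup>+\<omega>. sexp p (?\<tau> k d (restrict (\<lambda>j. config j \<omega>) (descendants i (k # w)))) \<partial>M)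
         = sexp p (on_reals (\<lambda>s. ?V n (x + s)) d)" for k d
        unfolding tree_sum_restrict[OF order.refl] Suc.IH shift ..
    qed (use descendants_Cons disjoint_descendants emeasure_fert_bounded in auto)
    then have *: "(\<integral>\<^sup>+\<omega>. sexp p (\<Sum>k. ?\<tau> k (D i w k \<omega>) (\<lambda>j. config j \<omega>)) \<partial>M)
       = sexp p (\<integral>\<^sup>+s. sexpm1 p (?V n (x + s)) \<partial>fert)"
      unfolding tree_sum_restrict[OF order.refl] by simp
    have "(\<lambda>\<omega>. ?\<tau> k (D i w k \<omega>) (\<lambda>j. config j \<omega>)) \<in> borel_measurable M" for k
    proof -
      have "(\<lambda>\<omega>. (y + D i w k \<omega>, restrict (\<lambda>j. config j \<omega>) UNIV)) \<in> measurable M (borel \<Otimes>\<^sub>M PiM UNIV (\<lambda>_. PiM UNIV (\<lambda>_. borel)))"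
        using indep_config by (intro measurable_Pair measurable_restrict) (auto simp: indep_vars_def)
      from measurable_compose[OF this tree_sum_measurable[OF b subset_UNIV, where i = i and w = "k # w" and n = n]] show ?thesis
        by (simp add: tree_sum_restrict)
    qed
    then show ?thesis
      using * by (simp add: sexp_add nn_integral_cmult y)
  qed
qed

text \<open>One more use of the marking argument, now with the immigrants as points and whole
  clusters as marks.\<close>

lemma laplace_forest:
  assumes b [measurable]: "b \<in> borel_measurable borel"
  shows "(\<integral>\<^sup>+\<omega>. sexp p (\<Sum>i. tree_sum b n i [] (ereal (X i \<omega>)) (\<lambda>j. config j \<omega>)) \<partial>M)
    = sexp p (\<integral>\<^sup>+x. sexpm1 p (tree_log_laplace p fert b n x) \<partial>immi)"
proof -
  have "(\<integral>\<^sup>+\<omega>. sexp p (\<Sum>i. tree_sum b n i [] (config None \<omega> i) (restrict (\<lambda>j. config j \<omega>) (descendants i []))) \<partial>M)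
    = sexp p (\<integral>\<^sup>+x. sexpm1 p (tree_log_laplace p fert b n x) \<partial>immi)"
  proof (rule marked_poisson_process_laplace[OF indep_config])
    show "poisson_process immi (\<lambda>k \<omega>. config None \<omega> k)"
      using immigrants by simp
    show "disjoint_family (\<lambda>i. descendants i [])" "\<And>i. descendants i [] \<subseteq> UNIV - {None}"
      by (auto simp: disjoint_family_on_def descendants_def)
    show "(\<lambda>(y, z). tree_sum b n i [] y z) \<in> borel_measurable (borel \<Otimes>\<^sub>M PiM (descendants i []) (\<lambda>_. PiM UNIV (\<lambda>_. borel)))" for i
      by (rule tree_sum_measurable[OF b order.refl])
    show "tree_log_laplace p fert b n \<in> borel_measurable borel"
      by (rule tree_log_laplace_measurable[OF b fert.sigma_finite_measure_axioms]) simp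
    show "(\<integral>\<^sup>+\<omega>. sexp p (tree_sum b n i [] y (restrict (\<lambda>j. config j \<omega>) (descendants i []))) \<partial>M)
       = sexp p (on_reals (tree_log_laplace p fert b n) y)" for i y
      unfolding tree_sum_restrict[OF order.refl] by (rule laplace_tree[OF b])
  qed (use emeasure_immi_bounded in auto)
  then show ?thesis
    unfolding tree_sum_restrict[OF order.refl] by simp
qed

end

section \<open>Almost sure distinctness of the points\<close>

lemma (in prob_space) poisson_process_null:
  assumes P: "poisson_process L Y" and B: "B \<in> sets borel" and null: "emeasure L B = 0"
  shows "AE \<omega> in M. point_set Y \<omega> \<inter> B = {}"
proof -
  \<comment> \<open>Since \<open>card\<close> is 0 on infinite sets too, a vanishing count yields
    emptiness only together with finiteness.\<close>
  have "AE \<omega> in M. finite (point_set Y \<omega> \<inter> B)"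
    using P B null by (auto simp: poisson_process_def)
  moreover have "prob {\<omega>\<in>space M. card (point_set Y \<omega> \<inter> B) = 0} = 1"
    using P B null by (auto simp: poisson_process_def measure_def)
  then have "AE \<omega> in M. \<omega> \<in> {\<omega>\<in>space M. card (point_set Y \<omega> \<inter> B) = 0}"
    by (intro AE_prob_1)
  ultimately show ?thesis
    by eventually_elim auto
qed

text \<open>Injectivity of the labelling is known only almost surely, whereas measurability concerns
  every \<omega>. Keeping only the first occurrence of each point gives an enumeration that is
  injective everywhere.\<close>

lemma measurable_emeasure_points:
  fixes q :: "'i::countable \<Rightarrow> 'a \<Rightarrow> ereal"
  assumes [measurable]: "\<And>l. q l \<in> borel_measurable M" "B \<in> sets borel"
  shows "(\<lambda>\<omega>. emeasure (count_space UNIV) ({x. \<exists>l. q l \<omega> = ereal x} \<inter> B)) \<in> borel_measurable M"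
proof -
  define r where "r m \<omega> = (if \<exists>k\<in>{..<m}. q (from_nat k) \<omega> = q (from_nat m) \<omega> then \<infinity> else q (from_nat m) \<omega>)"
    for m \<omega>
  have [measurable]: "r m \<in> borel_measurable M" for m
    unfolding r_def by measurable
  have points: "{x. \<exists>m. r m \<omega> = ereal x} = {x. \<exists>l. q l \<omega> = ereal x}" for \<omega>
  proof (intro equalityI subsetI)
    fix x assume "x \<in> {x. \<exists>l. q l \<omega> = ereal x}"
    then obtain l where "q l \<omega> = ereal x" by auto
    then have ex: "\<exists>m. q (from_nat m) \<omega> = ereal x"
      by (intro exI[of _ "to_nat l"]) simp
    define m where "m = (LEAST m. q (from_nat m) \<omega> = ereal x)"
    have "q (from_nat m) \<omega> = ereal x" "\<And>k. k < m \<Longrightarrow> q (from_nat k) \<omega> \<noteq> ereal x"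
      unfolding m_def using LeastI_ex[OF ex] not_less_Least by auto
    then show "x \<in> {x. \<exists>m. r m \<omega> = ereal x}"
      by (auto simp: r_def intro!: exI[of _ m])
  qed (auto simp: r_def split: if_splits)
  have "inj_on (\<lambda>m. r m \<omega>) {m. \<bar>r m \<omega>\<bar> \<noteq> \<infinity>}" for \<omega>
    by (rule linorder_inj_onI) (auto simp: r_def split: if_splits)
  then have "(\<Sum>m. on_reals (indicator B) (r m \<omega>)) = emeasure (count_space UNIV) ({x. \<exists>l. q l \<omega> = ereal x} \<inter> B)" for \<omega>
    using nn_integral_count_points[of "\<lambda>m. r m \<omega>" B] by (simp add: nn_integral_count_space_nat points)
  then have "(\<lambda>\<omega>. emeasure (count_space UNIV) ({x. \<exists>l. q l \<omega> = ereal x} \<inter> B)) =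
      (\<lambda>\<omega>. \<Sum>m. on_reals (indicator B) (r m \<omega>))"
    by simp
  then show ?thesis by simp
qed

lemma real_card_eq: "real (card A) = enn2real (emeasure (count_space UNIV) A)"
  by (simp add: emeasure_count_space ennreal_of_nat_eq_real_of_nat)

lemma measurable_PiM_component_component:
  assumes "j \<in> K"
  shows "(\<lambda>z. z j k) \<in> measurable (PiM K (\<lambda>_. PiM UNIV (\<lambda>_. N))) N"
proof -
  have "(\<lambda>z. z j) \<in> measurable (PiM K (\<lambda>_. PiM UNIV (\<lambda>_. N))) (PiM UNIV (\<lambda>_. N))"
    using assms by (rule measurable_component_singleton)
  then show ?thesis
    by (rule measurable_compose[OF _ measurable_component_singleton]) simp
qed

text \<open>As a function of the configuration, a position reads only the immigrants and the
  offspring processes of proper ancestors, that is, of the proper suffixes v of w.\<close>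

lemma position_restrict:
  assumes "None \<in> K" and "\<And>u k v. w = u @ k # v \<Longrightarrow> Some (i, v) \<in> K"
  shows "position (\<lambda>i z. real_of_ereal (z None i)) (\<lambda>i w k z. z (Some (i, w)) k) i w (restrict z K)
    = position (\<lambda>i z. real_of_ereal (z None i)) (\<lambda>i w k z. z (Some (i, w)) k) i w z"
  using assms(2)
proof (induction w)
  case (Cons k w)
  have "Some (i, w) \<in> K" using Cons.prems[of "[]"] by simp
  moreover have "position (\<lambda>i z. real_of_ereal (z None i)) (\<lambda>i w k z. z (Some (i, w)) k) i w (restrict z K)
    = position (\<lambda>i z. real_of_ereal (z None i)) (\<lambda>i w k z. z (Some (i, w)) k) i w z"
    using Cons.prems[of "k # _"] by (intro Cons.IH) simp
  ultimately show ?case by (simp only: position.simps restrict_apply')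
qed (use assms in simp)

lemma position_measurable_PiM:
  assumes "None \<in> K" and "\<And>u k v. w = u @ k # v \<Longrightarrow> Some (i, v) \<in> K"
  shows "position (\<lambda>i z. real_of_ereal (z None i)) (\<lambda>i w k z. z (Some (i, w)) k) i w
    \<in> borel_measurable (PiM K (\<lambda>_. PiM UNIV (\<lambda>_. borel)))"
  using assms(2)
proof (induction w)
  case Nil
  have "(\<lambda>z. z None i) \<in> borel_measurable (PiM K (\<lambda>_. PiM UNIV (\<lambda>_. borel)))"
    using assms(1) by (rule measurable_PiM_component_component)
  then have "(\<lambda>z. ereal (real_of_ereal (z None i))) \<in> borel_measurable (PiM K (\<lambda>_. PiM UNIV (\<lambda>_. borel)))"
    by (intro borel_measurable_ereal borel_measurable_real_of_ereal)
  then show ?case by simp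
next
  case (Cons k w)
  have "Some (i, w) \<in> K" using Cons.prems[of "[]"] by simp
  then have "(\<lambda>z. z (Some (i, w)) k) \<in> borel_measurable (PiM K (\<lambda>_. PiM UNIV (\<lambda>_. borel)))"
    by (rule measurable_PiM_component_component)
  moreover have "position (\<lambda>i z. real_of_ereal (z None i)) (\<lambda>i w k z. z (Some (i, w)) k) i w
      \<in> borel_measurable (PiM K (\<lambda>_. PiM UNIV (\<lambda>_. borel)))"
    using Cons.prems[of "k # _"] by (intro Cons.IH) simp
  ultimately show ?case unfolding position.simps by measurable
qed

text \<open>A constant weight sees only whether a position is finite. This later lets the root of a
  cluster be moved from its immigrant to 0.\<close>

lemma tree_sum_shift:
  "tree_sum (\<lambda>_. c) n i w (ereal x + y) z = tree_sum (\<lambda>_. c) n i w y z"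
proof (induction n arbitrary: w y)
  have *: "on_reals (\<lambda>_. c) (ereal x + y) = on_reals (\<lambda>_. c) y" for y
    by (cases y) auto
  { case 0 show ?case by (simp add: *) }
  { case (Suc n) then show ?case by (simp add: * add.assoc) }
qed

section \<open>Coincidences of labelled positions\<close>

context hawkes_process
begin

lemma position_config:
  "position X D i w \<omega> =
    position (\<lambda>i z. real_of_ereal (z None i)) (\<lambda>i w k z. z (Some (i, w)) k) i w (\<lambda>j. config j \<omega>)"
  by (induction w) auto

text \<open>The offspring intensity has a density, so a single point has intensity zero.\<close>

lemma displacement_diffuse: "AE \<omega> in M. D i w k \<omega> \<noteq> ereal x"
proof -
  have "set_borel_measurable borel {0<..} h" by (rule fertility_borel)
  then have "(\<lambda>t. indicator {0<..} t * h t) \<in> borel_measurable borel"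
    by (simp add: set_borel_measurable_def)
  then have "emeasure (density lborel (\<lambda>t. ennreal (indicator {0<..} t * h t))) {x}
     = (\<integral>\<^sup>+t. ennreal (indicator {0<..} t * h t) * indicator {x} t \<partial>lborel)"
    by (intro emeasure_density) auto
  also have "\<dots> = 0"
  proof -
    have "AE t in lborel. t \<noteq> x" by (rule AE_lborel_singleton)
    then have "(\<integral>\<^sup>+t. ennreal (indicator {0<..} t * h t) * indicator {x} t \<partial>lborel) = (\<integral>\<^sup>+(t::real). 0 \<partial>lborel)"
      by (intro nn_integral_cong_AE) (auto simp: indicator_def)
    then show ?thesis by simp
  qed
  finally have "AE \<omega> in M. point_set (D i w) \<omega> \<inter> {x} = {}"
    by (intro poisson_process_null[OF offspring]) auto
  then show ?thesis by eventually_elim (auto simp: point_set_def)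
qed

text \<open>The last displacement of the longer label is independent of everything else that enters
  the two positions.\<close>
lemma position_distinct_longer:
  assumes "length u \<le> Suc (length w)" and "\<nexists>k. i = j \<and> u = k # w"
  shows "AE \<omega> in M. position X D i u \<omega> = position X D j (l # w) \<omega> \<longrightarrow> \<bar>position X D i u \<omega>\<bar> = \<infinity>"
proof -
  let ?N = "\<lambda>_ :: (nat \<times> nat list) option. PiM (UNIV :: nat set) (\<lambda>_. borel :: ereal measure)"
  let ?J = "{Some (j, w)}" and ?K = "UNIV - {Some (j, w)}"
  define pos where "pos = position (\<lambda>i z. real_of_ereal (z None i)) (\<lambda>i w k z. z (Some (i, w)) k)"
  define B where "B = {x \<in> space (PiM ?K ?N \<Otimes>\<^sub>M PiM ?J ?N).
    \<bar>pos i u (fst x)\<bar> \<noteq> \<infinity> \<and> pos i u (fst x) = pos j w (fst x) + snd x (Some (j, w)) l}"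
  let ?R = "\<lambda>\<omega>. restrict (\<lambda>j. config j \<omega>) ?K" and ?A = "\<lambda>\<omega>. restrict (\<lambda>j. config j \<omega>) ?J"
  \<comment> \<open>The length bound leaves only one way for a proper ancestor of u to be (j, w),
    namely as its parent. That makes u a sibling of the other label, which is excluded.\<close>
  have u: "Some (i, v) \<in> ?K" if "u = x @ k # v" for x k v
  proof -
    have "(i, v) \<noteq> (j, w)"
    proof
      assume "(i, v) = (j, w)"
      with that assms(1) have "x = []" "i = j" "u = k # w" by auto
      with assms(2) show False by auto
    qed
    then show ?thesis by auto
  qed
  have w: "Some (j, v) \<in> ?K" if "w = x @ k # v" for x k v
    using that by auto
  have [measurable]: "pos i u \<in> borel_measurable (PiM ?K ?N)" "pos j w \<in> borel_measurable (PiM ?K ?N)"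
    unfolding pos_def using u w by (auto intro!: position_measurable_PiM)
  have "(\<lambda>a. a (Some (j, w)) l) \<in> borel_measurable (PiM ?J ?N)"
    by (intro measurable_PiM_component_component) simp
  then have [measurable]: "(\<lambda>x. snd x (Some (j, w)) l) \<in> borel_measurable (PiM ?K ?N \<Otimes>\<^sub>M PiM ?J ?N)"
    by (rule measurable_compose[OF measurable_snd])
  have B [measurable]: "B \<in> sets (PiM ?K ?N \<Otimes>\<^sub>M PiM ?J ?N)"
    unfolding B_def by measurable
  have iv: "indep_var (PiM ?K ?N) ?R (PiM ?J ?N) ?A"
    by (intro indep_var_restrict[OF indep_config]) auto
  then have RA: "?R \<in> measurable M (PiM ?K ?N)" "?A \<in> measurable M (PiM ?J ?N)"
    by (auto dest: indep_var_rv1 indep_var_rv2)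
  have "(\<integral>\<^sup>+\<omega>. indicator B (?R \<omega>, ?A \<omega>) \<partial>M) = (\<integral>\<^sup>+\<omega>'. \<integral>\<^sup>+\<omega>. indicator B (?R \<omega>', ?A \<omega>) \<partial>M \<partial>M)"
    by (rule nn_integral_indep_var[OF iv]) measurable
  also have "\<dots> = (\<integral>\<^sup>+\<omega>'. 0 \<partial>M)"
  proof (rule nn_integral_cong)
    fix \<omega>'
    let ?r = "?R \<omega>'"
    have "AE \<omega> in M. (?r, ?A \<omega>) \<notin> B"
    proof (cases "\<bar>pos i u ?r\<bar> = \<infinity> \<or> \<bar>pos j w ?r\<bar> = \<infinity>")
      case True
      have "(?r, ?A \<omega>) \<notin> B" for \<omega>
        using True
        by (cases "D j w l \<omega>"; cases "pos i u ?r"; cases "pos j w ?r") (auto simp: B_def)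
      then show ?thesis
        by (intro AE_I2)
    next
      case False
      then obtain x y where "pos i u ?r = ereal x" "pos j w ?r = ereal y" by auto
      \<comment> \<open>With both positions frozen, a coincidence forces the displacement to take
        the fixed value x - y.\<close>
      with displacement_diffuse[of j w l "x - y"] show ?thesis
        by (elim eventually_mono) (auto simp: B_def, case_tac "D j w l xa", auto)
    qed
    then have "(\<integral>\<^sup>+\<omega>. indicator B (?r, ?A \<omega>) \<partial>M) = (\<integral>\<^sup>+\<omega>. 0 \<partial>M)"
      by (intro nn_integral_cong_AE) (auto elim: eventually_mono)
    then show "(\<integral>\<^sup>+\<omega>. indicator B (?r, ?A \<omega>) \<partial>M) = 0" by simp
  qed
  finally have "(\<integral>\<^sup>+\<omega>. indicator B (?R \<omega>, ?A \<omega>) \<partial>M) = 0" by simp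
  moreover have "(\<lambda>\<omega>. indicator B (?R \<omega>, ?A \<omega>) :: ennreal) \<in> borel_measurable M"
    by (rule measurable_compose[OF measurable_Pair[OF RA]]) measurable
  ultimately have "AE \<omega> in M. indicator B (?R \<omega>, ?A \<omega>) = (0 :: ennreal)"
    using nn_integral_0_iff_AE by blast
  moreover have "AE \<omega> in M. \<omega> \<in> space M" by (rule AE_space)
  ultimately show ?thesis
  proof eventually_elim
    case (elim \<omega>)
    then have "(?R \<omega>, ?A \<omega>) \<notin> B" by (simp add: indicator_def split: if_splits)
    moreover have "(?R \<omega>, ?A \<omega>) \<in> space (PiM ?K ?N \<Otimes>\<^sub>M PiM ?J ?N)"
      using measurable_space[OF measurable_Pair[OF RA] elim(2)] .
    moreover have "pos i u (?R \<omega>) = position X D i u \<omega>" "pos j w (?R \<omega>) = position X D j w \<omega>"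
      unfolding pos_def position_config using u w by (auto intro!: position_restrict)
    ultimately show ?case by (simp add: B_def) argo
  qed
qed

text \<open>Siblings draw from one offspring process and immigrants from one immigrant process, so
  there the injectivity of the enumeration decides. In all other cases the longer label has a
  displacement that is independent of the rest and diffuse.\<close>

lemma position_distinct:
  assumes "(i, u) \<noteq> (j, w)"
  shows "AE \<omega> in M. position X D i u \<omega> = position X D j w \<omega> \<longrightarrow> \<bar>position X D i u \<omega>\<bar> = \<infinity>"
proof -
  have siblings: "AE \<omega> in M. position X D i (k # v) \<omega> = position X D i (l # v) \<omega> \<longrightarrow> \<bar>position X D i (k # v) \<omega>\<bar> = \<infinity>"
    if "k \<noteq> l" for i k l v
  proof -
    have "AE \<omega> in M. inj_on (\<lambda>k. D i v k \<omega>) {k. \<bar>D i v k \<omega>\<bar> \<noteq> \<infinity>}"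
      using offspring by (auto simp: poisson_process_def)
    then show ?thesis
    proof eventually_elim
      case (elim \<omega>)
      show ?case
      proof (intro impI, rule ccontr)
        assume eq: "position X D i (k # v) \<omega> = position X D i (l # v) \<omega>"
          and fin: "\<bar>position X D i (k # v) \<omega>\<bar> \<noteq> \<infinity>"
        then have "D i v k \<omega> = D i v l \<omega>" "\<bar>D i v k \<omega>\<bar> \<noteq> \<infinity>"
          by (cases "position X D i v \<omega>"; cases "D i v k \<omega>"; cases "D i v l \<omega>"; simp)+
        with inj_onD[OF elim, of k l] \<open>k \<noteq> l\<close> show False by auto
      qed
    qed
  qed
  have longer: "AE \<omega> in M. position X D i u \<omega> = position X D j w \<omega> \<longrightarrow> \<bar>position X D i u \<omega>\<bar> = \<infinity>"
    if "length u \<le> length w" "(i, u) \<noteq> (j, w)" for i u j w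
  proof (cases w)
    case Nil
    with that have "u = []" "i \<noteq> j" by auto
    have "AE \<omega> in M. inj_on (\<lambda>k. ereal (X k \<omega>)) {k. \<bar>ereal (X k \<omega>)\<bar> \<noteq> \<infinity>}"
      using immigrants by (simp add: poisson_process_def)
    then show ?thesis
    proof eventually_elim
      case (elim \<omega>)
      then show ?case
        using inj_onD[OF elim, of i j] Nil \<open>u = []\<close> \<open>i \<noteq> j\<close> by auto
    qed
  next
    case (Cons l v)
    show ?thesis
    proof (cases "\<exists>k. i = j \<and> u = k # v")
      case True
      then obtain k where k: "i = j" "u = k # v" by auto
      then have "k \<noteq> l" using that Cons by auto
      from siblings[OF this, of j v] show ?thesis
        unfolding k Cons .
    next
      case False
      then show ?thesis
        unfolding Cons using that Cons by (intro position_distinct_longer) auto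
    qed
  qed
  show ?thesis
  proof (cases "length u \<le> length w")
    case True
    then show ?thesis using longer assms by simp
  next
    case False
    then have "AE \<omega> in M. position X D j w \<omega> = position X D i u \<omega> \<longrightarrow> \<bar>position X D j w \<omega>\<bar> = \<infinity>"
      using longer[of w u j i] assms by auto
    then show ?thesis by eventually_elim metis
  qed
qed

lemma position_inj:
  "AE \<omega> in M. inj_on (\<lambda>(i, w). position X D i w \<omega>) {(i, w). \<bar>position X D i w \<omega>\<bar> \<noteq> \<infinity>}"
proof -
  have "AE \<omega> in M. \<forall>a b. a \<noteq> b \<longrightarrow> position X D (fst a) (snd a) \<omega> = position X D (fst b) (snd b) \<omega> \<longrightarrow>
      \<bar>position X D (fst a) (snd a) \<omega>\<bar> = \<infinity>"
    by (intro AE_all_countable[THEN iffD2] allI AE_impI position_distinct) (simp add: prod_eq_iff)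
  then show ?thesis
  proof eventually_elim
    case (elim \<omega>)
    show ?case
    proof (rule inj_onI, rule ccontr)
      fix a b
      assume "a \<in> {(i, w). \<bar>position X D i w \<omega>\<bar> \<noteq> \<infinity>}" "a \<noteq> b"
        and "(case a of (i, w) \<Rightarrow> position X D i w \<omega>) = (case b of (i, w) \<Rightarrow> position X D i w \<omega>)"
      with elim[rule_format, of a b] show False
        by (simp add: case_prod_beta)
    qed
  qed
qed

lemma hawkes_points_eq: "hawkes_points X D \<omega> = {x. \<exists>l. (case l of (i, w) \<Rightarrow> position X D i w \<omega>) = ereal x}"
  by (auto simp: hawkes_points_def cluster_def generation_def)

lemma cluster_eq: "cluster X D i \<omega> = {x. \<exists>w. position X D i w \<omega> = ereal x}"
  by (auto simp: cluster_def generation_def)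

lemma hawkes_points_measurable [measurable]:
  assumes "B \<in> sets borel"
  shows "(\<lambda>\<omega>. emeasure (count_space UNIV) (hawkes_points X D \<omega> \<inter> B)) \<in> borel_measurable M"
  unfolding hawkes_points_eq using assms by (intro measurable_emeasure_points) (auto split: prod.splits)

lemma cluster_measurable [measurable]:
  "(\<lambda>\<omega>. emeasure (count_space UNIV) (cluster X D i \<omega>)) \<in> borel_measurable M"
  using measurable_emeasure_points[of "\<lambda>w. position X D i w" M UNIV] by (simp add: cluster_eq)

text \<open>Almost surely no two existing individuals share a position; the count is then an
  increasing limit of the sums whose transforms are known.\<close>

lemma hawkes_count_AE:
  "AE \<omega> in M. c * emeasure (count_space UNIV) (hawkes_points X D \<omega> \<inter> B) =
     (SUP n. \<Sum>i. tree_sum (\<lambda>x. c * indicator B x) n i [] (ereal (X i \<omega>)) (\<lambda>j. config j \<omega>))"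
  using position_inj
proof eventually_elim
  case (elim \<omega>)
  let ?b = "\<lambda>x. c * indicator B x"
  have lift: "on_reals ?b y = c * on_reals (indicator B) y" for y
    by (simp add: on_reals_def)
  have "(SUP n. \<Sum>i. tree_sum ?b n i [] (ereal (X i \<omega>)) (\<lambda>j. config j \<omega>))
    = (\<Sum>i. SUP n. tree_sum ?b n i [] (position X D i [] \<omega>) (\<lambda>j. config j \<omega>))"
    by (subst suminf_SUP_incseq[OF tree_sum_incseq]) simp
  also have "\<dots> = (\<integral>\<^sup>+i. \<integral>\<^sup>+v. on_reals ?b (position X D i v \<omega>) \<partial>count_space UNIV \<partial>count_space UNIV)"
    unfolding SUP_tree_sum_position by (simp add: nn_integral_count_space_nat)
  also have "\<dots> = (\<integral>\<^sup>+l. c * on_reals (indicator B) (case l of (i, v) \<Rightarrow> position X D i v \<omega>) \<partial>count_space UNIV)"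
    by (simp add: nn_integral_fst_count_space[symmetric] lift)
  also have "\<dots> = c * (\<integral>\<^sup>+l. on_reals (indicator B) (case l of (i, v) \<Rightarrow> position X D i v \<omega>) \<partial>count_space UNIV)"
    by (rule nn_integral_cmult) simp
  also have "\<dots> = c * emeasure (count_space UNIV) (hawkes_points X D \<omega> \<inter> B)"
    using nn_integral_count_points[of "\<lambda>(i, w). position X D i w \<omega>" B] elim
    by (simp only: hawkes_points_eq split_def)
  finally show ?case by simp
qed

lemma cluster_count_AE:
  "AE \<omega> in M. c * emeasure (count_space UNIV) (cluster X D i \<omega>) =
     (SUP n. tree_sum (\<lambda>_. c) n i [] 0 (\<lambda>j. config j \<omega>))"
  using position_inj
proof eventually_elim
  case (elim \<omega>)
  have inj: "inj_on (\<lambda>w. position X D i w \<omega>) {w. \<bar>position X D i w \<omega>\<bar> \<noteq> \<infinity>}"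
    by (rule inj_onI) (use inj_onD[OF elim, of "(i, _)" "(i, _)"] in auto)
  have lift: "on_reals (\<lambda>_. c) y = c * on_reals (indicator UNIV) y" for y
    by (simp add: on_reals_def)
  have "(SUP n. tree_sum (\<lambda>_. c) n i [] 0 (\<lambda>j. config j \<omega>))
    = (SUP n. tree_sum (\<lambda>_. c) n i [] (position X D i [] \<omega>) (\<lambda>j. config j \<omega>))"
    using tree_sum_shift[of c _ i "[]" "X i \<omega>" 0] by simp
  also have "\<dots> = (\<integral>\<^sup>+v. c * on_reals (indicator UNIV) (position X D i v \<omega>) \<partial>count_space UNIV)"
    unfolding SUP_tree_sum_position lift by simp
  also have "\<dots> = c * (\<integral>\<^sup>+v. on_reals (indicator UNIV) (position X D i v \<omega>) \<partial>count_space UNIV)"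
    by (rule nn_integral_cmult) simp
  also have "\<dots> = c * emeasure (count_space UNIV) (cluster X D i \<omega>)"
    by (simp only: nn_integral_count_points[OF inj] cluster_eq Int_UNIV_right)
  finally show ?case by simp
qed

end

section \<open>Laplace transforms of the counts\<close>

context subcritical_hawkes
begin

lemma tree_sum_config_measurable [measurable]:
  assumes b: "b \<in> borel_measurable borel" and [measurable]: "y \<in> borel_measurable M"
  shows "(\<lambda>\<omega>. tree_sum b n i w (y \<omega>) (\<lambda>j. config j \<omega>)) \<in> borel_measurable M"
proof -
  have "(\<lambda>\<omega>. (y \<omega>, restrict (\<lambda>j. config j \<omega>) UNIV)) \<in> measurable M (borel \<Otimes>\<^sub>M PiM UNIV (\<lambda>_. PiM UNIV (\<lambda>_. borel)))"
    using indep_config by (intro measurable_Pair measurable_restrict) (auto simp: indep_vars_def)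
  from measurable_compose[OF this tree_sum_measurable[OF b subset_UNIV, where i = i and w = w and n = n]] show ?thesis
    by (simp add: tree_sum_restrict)
qed

definition log_laplace :: "bool \<Rightarrow> (real \<Rightarrow> ennreal) \<Rightarrow> real \<Rightarrow> ennreal" where
  "log_laplace p b x = (SUP n. tree_log_laplace p fert b n x)"

lemma hawkes_count_laplace:
  assumes [measurable]: "B \<in> sets borel"
  shows "(\<integral>\<^sup>+\<omega>. sexp p (c * emeasure (count_space UNIV) (hawkes_points X D \<omega> \<inter> B)) \<partial>M)
    = sexp p (\<integral>\<^sup>+x. sexpm1 p (log_laplace p (\<lambda>x. c * indicator B x) x) \<partial>immi)"
proof -
  let ?b = "\<lambda>x. c * indicator B x"
  have b [measurable]: "?b \<in> borel_measurable borel" by measurable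
  note [measurable] = tree_log_laplace_measurable[OF b fert.sigma_finite_measure_axioms]
  have "(\<integral>\<^sup>+\<omega>. sexp p (c * emeasure (count_space UNIV) (hawkes_points X D \<omega> \<inter> B)) \<partial>M)
    = (\<integral>\<^sup>+\<omega>. sexp p (SUP n. \<Sum>i. tree_sum ?b n i [] (ereal (X i \<omega>)) (\<lambda>j. config j \<omega>)) \<partial>M)"
    using hawkes_count_AE[of c B] by (intro nn_integral_cong_AE) (auto elim!: eventually_mono)
  also have "\<dots> = sexp p (\<integral>\<^sup>+x. sexpm1 p (log_laplace p ?b x) \<partial>immi)"
  proof (rule nn_integral_sexp_SUP[OF _ _ laplace_forest[OF b]])
    show "(\<lambda>\<omega>. \<Sum>i. tree_sum ?b n i [] (ereal (X i \<omega>)) (\<lambda>j. config j \<omega>)) \<in> borel_measurable M" for n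
      by measurable
    show "incseq (\<lambda>n. \<Sum>i. tree_sum ?b n i [] (ereal (X i \<omega>)) (\<lambda>j. config j \<omega>))" for \<omega>
      using tree_sum_incseq by (auto simp: incseq_def intro!: suminf_le)
    have inc: "incseq (\<lambda>n. tree_log_laplace p fert ?b n x)" for x
      by (rule tree_log_laplace_incseq)
    have "(\<lambda>n. \<integral>\<^sup>+x. sexpm1 p (tree_log_laplace p fert ?b n x) \<partial>immi)
       \<longlonglongrightarrow> (SUP n. \<integral>\<^sup>+x. sexpm1 p (tree_log_laplace p fert ?b n x) \<partial>immi)"
      using inc by (intro LIMSEQ_SUP) (auto simp: incseq_def intro!: nn_integral_mono sexpm1_mono)
    also have "(SUP n. \<integral>\<^sup>+x. sexpm1 p (tree_log_laplace p fert ?b n x) \<partial>immi) = (\<integral>\<^sup>+x. (SUP n. sexpm1 p (tree_log_laplace p fert ?b n x)) \<partial>immi)"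
      using inc by (intro nn_integral_monotone_convergence_SUP[symmetric])
        (auto simp: incseq_def le_fun_def intro!: sexpm1_mono)
    finally show "(\<lambda>n. \<integral>\<^sup>+x. sexpm1 p (tree_log_laplace p fert ?b n x) \<partial>immi)
       \<longlonglongrightarrow> (\<integral>\<^sup>+x. sexpm1 p (log_laplace p ?b x) \<partial>immi)"
      by (simp add: log_laplace_def sexpm1_SUP[OF inc])
  qed
  finally show ?thesis .
qed

lemma cluster_count_laplace:
  "(\<integral>\<^sup>+\<omega>. sexp p (c * emeasure (count_space UNIV) (cluster X D i \<omega>)) \<partial>M) = sexp p (log_laplace p (\<lambda>_. c) 0)"
proof -
  have "(\<integral>\<^sup>+\<omega>. sexp p (c * emeasure (count_space UNIV) (cluster X D i \<omega>)) \<partial>M)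
    = (\<integral>\<^sup>+\<omega>. sexp p (SUP n. tree_sum (\<lambda>_. c) n i [] 0 (\<lambda>j. config j \<omega>)) \<partial>M)"
    using cluster_count_AE[of c i] by (intro nn_integral_cong_AE) (auto elim!: eventually_mono)
  also have "\<dots> = sexp p (log_laplace p (\<lambda>_. c) 0)"
  proof (rule nn_integral_sexp_SUP)
    show "(\<integral>\<^sup>+\<omega>. sexp p (tree_sum (\<lambda>_. c) n i [] 0 (\<lambda>j. config j \<omega>)) \<partial>M) = sexp p (tree_log_laplace p fert (\<lambda>_. c) n 0)" for n
      by (subst laplace_tree) (simp_all add: on_reals_def)
    show "(\<lambda>n. tree_log_laplace p fert (\<lambda>_. c) n 0) \<longlonglongrightarrow> log_laplace p (\<lambda>_. c) 0"
      unfolding log_laplace_def by (intro LIMSEQ_SUP tree_log_laplace_incseq)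
  qed (auto intro: tree_sum_incseq)
  finally show ?thesis .
qed

end

section \<open>Asymptotics of the cumulants\<close>

lemma tree_log_laplace_mono:
  "(\<And>y. b y \<le> b' y) \<Longrightarrow> tree_log_laplace p L b n y \<le> tree_log_laplace p L b' n y"
  by (induction n arbitrary: y) (auto intro!: add_mono nn_integral_mono sexpm1_mono)

lemma sexpm1_finite: "v < \<top> \<Longrightarrow> sexpm1 p v < \<top>"
  by (cases v) (auto simp: sexpm1_ennreal)

text \<open>From exp x - 1 \<le> x * exp x and 1 - exp (- x) \<le> x. The factor is the constant
  that has to stay below 1 after multiplication by \<mu>.\<close>

lemma sexpm1_le_linear:
  assumes "0 \<le> v" "u \<le> ennreal v"
  shows "sexpm1 p u \<le> ennreal (if p then exp v else 1) * u"
proof -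
  obtain x where x: "u = ennreal x" "0 \<le> x" "x \<le> v"
    using assms by (cases u) (auto simp: top_unique)
  have "exp x * (1 - x) \<le> exp x * exp (- x)"
    using exp_ge_add_one_self[of "- x"] by (intro mult_left_mono) auto
  then have "exp x - 1 \<le> exp x * x"
    by (simp add: exp_minus algebra_simps)
  also have "\<dots> \<le> exp v * x"
    using x by (intro mult_right_mono) auto
  finally have "exp x - 1 \<le> exp v * x" .
  moreover have "1 - exp (- x) \<le> x"
    using exp_ge_add_one_self[of "- x"] by linarith
  ultimately show ?thesis
    using x by (auto simp: sexpm1_ennreal simp flip: ennreal_mult intro!: ennreal_leI)
qed

section \<open>The recursion for constant weights\<close>

context subcritical_hawkes
begin

lemma fert_density_measurable: "(\<lambda>t. ennreal (indicator {0<..} t * h t)) \<in> borel_measurable lborel"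
  using measurable_compose[OF fertility_measurable measurable_ennreal]
  by (simp only: measurable_lborel2)

lemma nn_integral_fert:
  assumes [measurable]: "f \<in> borel_measurable borel"
  shows "(\<integral>\<^sup>+s. f s \<partial>fert) = (\<integral>\<^sup>+s. ennreal (indicator {0<..} s * h s) * f s \<partial>lborel)"
  by (rule nn_integral_density[OF fert_density_measurable]) simp

lemma AE_fert: "AE s in fert. 0 < s"
  unfolding AE_density[OF fert_density_measurable] by (auto simp: indicator_def)

definition first_moment :: real where
  "first_moment = (LINT t:{0<..}|lborel. t * h t)"

lemma first_moment_nonneg: "0 \<le> first_moment"
  unfolding first_moment_def set_lebesgue_integral_def
  using fertility_nonneg by (intro integral_nonneg_AE) (auto simp: indicator_def)

lemma nn_integral_fert_id: "(\<integral>\<^sup>+s. ennreal s \<partial>fert) = ennreal first_moment"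
proof -
  have "(\<integral>\<^sup>+s. ennreal s \<partial>fert) = (\<integral>\<^sup>+s. ennreal (indicator {0<..} s * h s) * ennreal s \<partial>lborel)"
    by (rule nn_integral_fert) simp
  also have "\<dots> = (\<integral>\<^sup>+s. ennreal (indicator {0<..} s * (s * h s)) \<partial>lborel)"
    using fertility_nonneg
    by (intro nn_integral_cong) (auto simp: indicator_def mult.commute simp flip: ennreal_mult)
  also have "\<dots> = ennreal first_moment"
    unfolding first_moment_def set_lebesgue_integral_def
    using moment_integrable fertility_nonneg
    by (subst nn_integral_eq_integral) (auto simp: set_integrable_def indicator_def)
  finally show ?thesis .
qed

text \<open>A constant weight makes the recursion forget positions; what remains is the
  Galton-Watson recursion with Poisson offspring of mean \<mu>.\<close>

primrec const_log_laplace :: "bool \<Rightarrow> ennreal \<Rightarrow> nat \<Rightarrow> ennreal" where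
  "const_log_laplace p c 0 = c"
| "const_log_laplace p c (Suc n) = c + sexpm1 p (const_log_laplace p c n) * ennreal \<mu>"

lemma tree_log_laplace_const: "tree_log_laplace p fert (\<lambda>_. c) n y = const_log_laplace p c n"
proof (induction n arbitrary: y)
  case (Suc n)
  then show ?case
    using emeasure_fert_UNIV by simp
qed simp

lemma log_laplace_const: "log_laplace p (\<lambda>_. c) y = (SUP n. const_log_laplace p c n)"
  unfolding log_laplace_def tree_log_laplace_const ..

lemma const_log_laplace_incseq: "incseq (const_log_laplace p c)"
  using tree_log_laplace_incseq[of p fert "\<lambda>_. c" 0] unfolding tree_log_laplace_const .

text \<open>Continuity of \<open>sexpm1\<close> lets the recursion pass to the limit. This is the
  equation for m written in the exponent, and it holds even if the limit is \<top>.\<close>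

lemma const_log_laplace_fixpoint:
  "log_laplace p (\<lambda>_. c) y = c + sexpm1 p (log_laplace p (\<lambda>_. c) y) * ennreal \<mu>"
proof (rule LIMSEQ_unique)
  show "(\<lambda>n. const_log_laplace p c (Suc n)) \<longlonglongrightarrow> log_laplace p (\<lambda>_. c) y"
    unfolding log_laplace_const by (intro LIMSEQ_Suc LIMSEQ_SUP const_log_laplace_incseq)
  have "(\<lambda>n. sexpm1 p (const_log_laplace p c n)) \<longlonglongrightarrow> sexpm1 p (log_laplace p (\<lambda>_. c) y)"
    unfolding log_laplace_const by (intro sexpm1_tendsto LIMSEQ_SUP const_log_laplace_incseq)
  then show "(\<lambda>n. const_log_laplace p c (Suc n)) \<longlonglongrightarrow> c + sexpm1 p (log_laplace p (\<lambda>_. c) y) * ennreal \<mu>"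
    using \<mu>_pos by (auto intro!: tendsto_add tendsto_mult_ennreal)
qed

section \<open>Upper bound for a window of length t\<close>

context
  fixes p :: bool and c t v :: real
  assumes c: "0 \<le> c" and t: "0 < t" and v: "0 \<le> v" "log_laplace p (\<lambda>_. ennreal c) 0 = ennreal v"
    and subcrit: "(if p then exp v else 1) * \<mu> < 1"
begin

abbreviation (input) "win \<equiv> (\<lambda>x. ennreal c * indicator {0<..t} x)"

abbreviation (input) "V \<equiv> tree_log_laplace p fert win"

text \<open>The constant of the linear bound on \<open>sexpm1 p\<close> over the interval from 0 to
  v.\<close>

definition slope :: real where "slope = (if p then exp v else 1)"

definition kap :: real where "kap = (if p then exp v - 1 else 1 - exp (- v))"

lemma kap: "sexpm1 p (ennreal v) = ennreal kap" "0 \<le> kap"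
  using v by (auto simp: sexpm1_ennreal kap_def)

lemma V_measurable [measurable]: "V n \<in> borel_measurable borel"
  by (rule tree_log_laplace_measurable[OF _ fert.sigma_finite_measure_axioms]) auto

lemma V_le: "V n y \<le> ennreal v"
proof -
  have "V n y \<le> tree_log_laplace p fert (\<lambda>_. ennreal c) n y"
    by (rule tree_log_laplace_mono) (auto simp: indicator_def)
  also have "\<dots> \<le> log_laplace p (\<lambda>_. ennreal c) 0"
    unfolding log_laplace_const tree_log_laplace_const by (rule SUP_upper) simp
  finally show ?thesis unfolding v .
qed

text \<open>Offspring lie to the right of their parents, so a cluster starting beyond t never meets
  the window.\<close>

lemma V_right: "t < y \<Longrightarrow> V n y = 0"
proof (induction n arbitrary: y)
  case (Suc n)
  have "V n (y + s) = 0" if "0 < s" for s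
    using Suc.prems that by (intro Suc.IH) linarith
  then have "(\<integral>\<^sup>+s. sexpm1 p (V n (y + s)) \<partial>fert) = (\<integral>\<^sup>+s. 0 \<partial>fert)"
    using AE_fert by (intro nn_integral_cong_AE) (auto elim!: eventually_mono)
  then show ?case using Suc.prems by simp
qed simp

text \<open>The fixed point of K = slope * (kap * first_moment + \<mu> * K). It depends on neither t
  nor n, which is why the boundary effect vanishes after division by t.\<close>

definition overhang :: real where "overhang = slope * kap * first_moment / (1 - slope * \<mu>)"

lemma overhang: "0 \<le> overhang" "slope * kap * first_moment + slope * \<mu> * overhang = overhang"
  using subcrit kap(2) first_moment_nonneg
  by (auto simp: overhang_def slope_def field_simps)

text \<open>Points before the window start clusters that may reach into it. Their contribution satisfies
  a contracting linear recursion, whose inhomogeneous term is a multiple of the first moment of the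
  fertility rate.\<close>
lemma V_left: "(\<integral>\<^sup>+y. sexpm1 p (V n y) * indicator {..0} y \<partial>lborel) \<le> ennreal overhang"
proof (induction n)
  case 0
  have "(\<integral>\<^sup>+y. sexpm1 p (V 0 y) * indicator {..0} y \<partial>lborel) = (\<integral>\<^sup>+(y::real). 0 \<partial>lborel)"
    by (intro nn_integral_cong) (auto simp: indicator_def)
  then show ?case by simp
next
  case (Suc n)
  interpret P: pair_sigma_finite lborel fert
    by standard
  \<comment> \<open>A child of y either lands beyond 0, where its contribution is at most
    \<open>kap\<close>, or again at or before 0, where the induction hypothesis applies.\<close>
  let ?g = "\<lambda>y s. ennreal kap * indicator {- s<..0} y + sexpm1 p (V n (y + s)) * indicator {..0} (y + s)"
  have [measurable]: "Measurable.pred (borel \<Otimes>\<^sub>M borel) (\<lambda>x. fst x \<in> {- snd x<..0 :: real})"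
    unfolding greaterThanAtMost_iff by measurable
  have le: "sexpm1 p (V (Suc n) y) * indicator {..0} y \<le> ennreal slope * (\<integral>\<^sup>+s. ?g y s \<partial>fert)" for y
  proof (cases "y \<le> 0")
    case True
    have "sexpm1 p (V (Suc n) y) \<le> ennreal slope * V (Suc n) y"
      unfolding slope_def by (rule sexpm1_le_linear[OF v(1) V_le])
    also have "V (Suc n) y = (\<integral>\<^sup>+s. sexpm1 p (V n (y + s)) \<partial>fert)"
      using True by simp
    also have "\<dots> \<le> (\<integral>\<^sup>+s. ?g y s \<partial>fert)"
      using True sexpm1_mono[OF V_le[of n], of p] kap
      by (intro nn_integral_mono) (auto simp: indicator_def)
    finally show ?thesis
      using True by (simp add: mult_left_mono)
  qed simp
  have "(\<integral>\<^sup>+y. sexpm1 p (V (Suc n) y) * indicator {..0} y \<partial>lborel)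
     \<le> (\<integral>\<^sup>+y. ennreal slope * (\<integral>\<^sup>+s. ?g y s \<partial>fert) \<partial>lborel)"
    by (intro nn_integral_mono le)
  also have "\<dots> = ennreal slope * (\<integral>\<^sup>+y. \<integral>\<^sup>+s. ?g y s \<partial>fert \<partial>lborel)"
    by (intro nn_integral_cmult) measurable
  also have "(\<integral>\<^sup>+y. \<integral>\<^sup>+s. ?g y s \<partial>fert \<partial>lborel) = (\<integral>\<^sup>+s. \<integral>\<^sup>+y. ?g y s \<partial>lborel \<partial>fert)"
    by (rule P.Fubini'[symmetric]) measurable
  \<comment> \<open>For a fixed displacement s, the parents whose child crosses 0 fill an interval
    of length s; integration over s turns this into the first moment.\<close>
  also have "\<dots> \<le> (\<integral>\<^sup>+s. ennreal kap * ennreal s + ennreal overhang \<partial>fert)"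
  proof (intro nn_integral_mono_AE, use AE_fert in eventually_elim)
    case (elim s)
    have "(\<integral>\<^sup>+y. sexpm1 p (V n (y + s)) * indicator {..0} (y + s) \<partial>lborel)
      = (\<integral>\<^sup>+y. sexpm1 p (V n y) * indicator {..0} y \<partial>lborel)"
      by (subst nn_integral_real_affine[of _ 1 s, where f = "\<lambda>y. sexpm1 p (V n y) * indicator {..0} y"])
        (auto simp: add.commute)
    then show ?case
      using elim Suc by (subst nn_integral_add) (auto simp: nn_integral_cmult intro!: add_left_mono)
  qed
  also have "\<dots> = ennreal kap * ennreal first_moment + ennreal overhang * ennreal \<mu>"
    using emeasure_fert_UNIV
    by (subst nn_integral_add) (auto simp: nn_integral_cmult nn_integral_fert_id)
  also have "ennreal slope * (ennreal kap * ennreal first_moment + ennreal overhang * ennreal \<mu>)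
     = ennreal (slope * kap * first_moment + slope * \<mu> * overhang)"
    using kap overhang first_moment_nonneg \<mu>_pos
    by (simp add: slope_def distrib_left mult_ac flip: ennreal_mult ennreal_plus)
  finally show ?case
    unfolding overhang(2) by (simp add: mult_left_mono)
qed

text \<open>Starting points at or before 0 cost \<open>overhang\<close>, those in the window at most
  \<open>kap\<close> per unit length, and those beyond t nothing.\<close>

lemma nn_integral_V_le: "(\<integral>\<^sup>+y. sexpm1 p (V n y) \<partial>lborel) \<le> ennreal (overhang + kap * t)"
proof -
  have "sexpm1 p (V n y) \<le> sexpm1 p (V n y) * indicator {..0} y + ennreal kap * indicator {0<..t} y" for y
    using sexpm1_mono[OF V_le[of n y], of p] kap V_right[of y n]
    by (cases "y \<le> 0"; cases "y \<le> t") (auto simp: indicator_def)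
  then have "(\<integral>\<^sup>+y. sexpm1 p (V n y) \<partial>lborel)
    \<le> (\<integral>\<^sup>+y. sexpm1 p (V n y) * indicator {..0} y + ennreal kap * indicator {0<..t} y \<partial>lborel)"
    by (intro nn_integral_mono)
  also have "\<dots> = (\<integral>\<^sup>+y. sexpm1 p (V n y) * indicator {..0} y \<partial>lborel) + ennreal kap * ennreal t"
    using t by (subst nn_integral_add) (auto simp: nn_integral_cmult)
  also have "\<dots> \<le> ennreal overhang + ennreal kap * ennreal t"
    by (intro add_right_mono V_left)
  finally show ?thesis
    using overhang kap t by (simp flip: ennreal_mult ennreal_plus)
qed

lemma nn_integral_log_laplace_SUP:
  "(\<integral>\<^sup>+y. sexpm1 p (log_laplace p win y) \<partial>lborel) = (SUP n. \<integral>\<^sup>+y. sexpm1 p (V n y) \<partial>lborel)"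
proof -
  have inc: "incseq (\<lambda>n. V n y)" for y
    by (rule tree_log_laplace_incseq)
  have "(\<integral>\<^sup>+y. sexpm1 p (log_laplace p win y) \<partial>lborel) = (\<integral>\<^sup>+y. (SUP n. sexpm1 p (V n y)) \<partial>lborel)"
    by (simp add: log_laplace_def sexpm1_SUP[OF inc])
  also have "\<dots> = (SUP n. \<integral>\<^sup>+y. sexpm1 p (V n y) \<partial>lborel)"
    using inc by (intro nn_integral_monotone_convergence_SUP)
      (auto simp: incseq_def le_fun_def intro!: sexpm1_mono)
  finally show ?thesis .
qed

lemma nn_integral_log_laplace_le:
  "(\<integral>\<^sup>+y. sexpm1 p (log_laplace p win y) \<partial>lborel) \<le> ennreal (overhang + kap * t)"
  unfolding nn_integral_log_laplace_SUP by (intro SUP_least nn_integral_V_le)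

end

text \<open>Allowing only displacements up to \<open>R\<close> keeps \<open>n\<close> generations inside the window, which gives a lower
  bound that depends neither on \<open>t\<close> nor on the starting point.\<close>
primrec trunc_log_laplace :: "bool \<Rightarrow> ennreal \<Rightarrow> real \<Rightarrow> nat \<Rightarrow> ennreal" where
  "trunc_log_laplace p c R 0 = c"
| "trunc_log_laplace p c R (Suc n) = c + sexpm1 p (trunc_log_laplace p c R n) * emeasure fert {0<..R}"

lemma trunc_log_laplace_le:
  assumes "0 < R" "0 < y" "y \<le> t - n * R"
  shows "trunc_log_laplace p c R n \<le> tree_log_laplace p fert (\<lambda>x. c * indicator {0<..t} x) n y"
  using assms
proof (induction n arbitrary: y)
  case (Suc n)
  let ?V = "tree_log_laplace p fert (\<lambda>x. c * indicator {0<..t} x)"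
  have "0 \<le> real n * R" using Suc.prems by simp
  moreover have "y \<le> t - n * R - R" using Suc.prems by (simp add: algebra_simps)
  ultimately have y: "y \<le> t - n * R" "y \<le> t" using Suc.prems by linarith+
  have "sexpm1 p (trunc_log_laplace p c R n) * emeasure fert {0<..R}
    = (\<integral>\<^sup>+s. sexpm1 p (trunc_log_laplace p c R n) * indicator {0<..R} s \<partial>fert)"
    by (simp add: nn_integral_cmult_indicator)
  also have "\<dots> \<le> (\<integral>\<^sup>+s. sexpm1 p (?V n (y + s)) \<partial>fert)"
  proof (intro nn_integral_mono)
    fix s
    have "trunc_log_laplace p c R n \<le> ?V n (y + s)" if "0 < s" "s \<le> R"
      using Suc.prems that by (intro Suc.IH) (auto simp: algebra_simps)
    then show "sexpm1 p (trunc_log_laplace p c R n) * indicator {0<..R} s \<le> sexpm1 p (?V n (y + s))"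
      by (simp add: indicator_def sexpm1_mono)
  qed
  finally show ?case
    using y Suc.prems by (auto intro!: add_mono)
qed simp

lemma const_log_laplace_finite: "c < \<top> \<Longrightarrow> const_log_laplace p c n < \<top>"
  by (induction n) (auto simp: ennreal_mult_less_top sexpm1_finite)

text \<open>The truncated displacements exhaust the positive half-line, which carries the whole mass
  \<mu>.\<close>

lemma trunc_log_laplace_tendsto:
  assumes "c < \<top>"
  shows "(\<lambda>k. trunc_log_laplace p c (real k) n) \<longlonglongrightarrow> const_log_laplace p c n"
proof (induction n)
  case (Suc n)
  have "(\<lambda>k. emeasure fert {0<..real k}) \<longlonglongrightarrow> emeasure fert (\<Union>k. {0<..real k})"
    by (intro Lim_emeasure_incseq) (auto simp: incseq_def)
  also have "(\<Union>k. {0<..real k}) = {0<..}"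
    by (auto intro: real_arch_simple)
  also have "emeasure fert {0<..} = emeasure fert UNIV"
    using AE_fert by (intro emeasure_eq_AE) auto
  finally have "(\<lambda>k. emeasure fert {0<..real k}) \<longlonglongrightarrow> ennreal \<mu>"
    unfolding emeasure_fert_UNIV .
  \<comment> \<open>Finiteness excludes the indeterminate product of \<top> and 0 in the limit of
    products.\<close>
  moreover have "sexpm1 p (const_log_laplace p c n) \<noteq> \<top>"
    using sexpm1_finite[OF const_log_laplace_finite[OF assms], of p p n] by simp
  ultimately show ?case
    by (auto intro!: tendsto_add tendsto_mult_ennreal sexpm1_tendsto Suc)
qed simp

lemma nn_integral_log_laplace_ge:
  assumes "0 < R" "n * R \<le> t"
  shows "ennreal (t - n * R) * sexpm1 p (trunc_log_laplace p c R n)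
    \<le> (\<integral>\<^sup>+y. sexpm1 p (log_laplace p (\<lambda>x. c * indicator {0<..t} x) y) \<partial>lborel)"
proof -
  have "ennreal (t - n * R) * sexpm1 p (trunc_log_laplace p c R n)
     = (\<integral>\<^sup>+y. sexpm1 p (trunc_log_laplace p c R n) * indicator {0<..t - n * R} y \<partial>lborel)"
    using assms by (subst nn_integral_cmult_indicator) (auto simp: mult.commute)
  also have "\<dots> \<le> (\<integral>\<^sup>+y. sexpm1 p (log_laplace p (\<lambda>x. c * indicator {0<..t} x) y) \<partial>lborel)"
  proof (intro nn_integral_mono)
    fix y
    show "sexpm1 p (trunc_log_laplace p c R n) * indicator {0<..t - n * R} y
       \<le> sexpm1 p (log_laplace p (\<lambda>x. c * indicator {0<..t} x) y)"
    proof (cases "y \<in> {0<..t - n * R}")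
      case True
      have "trunc_log_laplace p c R n \<le> tree_log_laplace p fert (\<lambda>x. c * indicator {0<..t} x) n y"
        using assms True by (intro trunc_log_laplace_le) auto
      also have "\<dots> \<le> log_laplace p (\<lambda>x. c * indicator {0<..t} x) y"
        unfolding log_laplace_def by (rule SUP_upper) simp
      finally show ?thesis
        using True by (auto intro!: sexpm1_mono)
    qed simp
  qed
  finally show ?thesis .
qed

text \<open>The upper bound is affine in t with the right slope. The lower bound loses a fixed
  length n * R of the window, and its slope approaches the same value as first R and then n
  grows.\<close>

lemma log_laplace_window_asymptotics:
  assumes c: "0 \<le> c" and v: "0 \<le> v" "log_laplace p (\<lambda>_. ennreal c) 0 = ennreal v"
    and subcrit: "(if p then exp v else 1) * \<mu> < 1"
  defines "G \<equiv> (\<lambda>t. \<integral>\<^sup>+y. sexpm1 p (log_laplace p (\<lambda>x. ennreal c * indicator {0<..t} x) y) \<partial>lborel)"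
  shows "\<And>t. 0 < t \<Longrightarrow> G t < \<top>"
    and "((\<lambda>t. enn2real (G t) / t) \<longlongrightarrow> (if p then exp v - 1 else 1 - exp (- v))) at_top"
proof -
  define \<kappa> where "\<kappa> = kap p v"
  define C where "C = overhang p v"
  have upper: "G t \<le> ennreal (C + \<kappa> * t)" if "0 < t" for t
    unfolding G_def C_def \<kappa>_def using nn_integral_log_laplace_le[OF c that v subcrit] .
  show fin: "G t < \<top>" if "0 < t" for t
    using upper[OF that] by (rule le_less_trans) simp
  have \<kappa>: "sexpm1 p (ennreal v) = ennreal \<kappa>" "0 \<le> \<kappa>" "\<kappa> = (if p then exp v - 1 else 1 - exp (- v))"
    using kap[of c 1 v p] kap_def[of c 1 v p] c v subcrit by (auto simp: \<kappa>_def)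
  have C: "0 \<le> C"
    using overhang[of c 1 v p] c v subcrit by (auto simp: C_def)
  have "((\<lambda>t. enn2real (G t) / t) \<longlongrightarrow> \<kappa>) at_top"
  proof (rule order_tendstoI)
    fix a assume a: "a < \<kappa>"
    show "\<forall>\<^sub>F t in at_top. a < enn2real (G t) / t"
    proof (cases "a < 0")
      case True
      show ?thesis
        using eventually_gt_at_top[of 0]
        by eventually_elim (use True in \<open>auto intro!: less_le_trans[OF True] divide_nonneg_nonneg\<close>)
    next
      case False
      have "(\<lambda>n. sexpm1 p (const_log_laplace p (ennreal c) n)) \<longlonglongrightarrow> ennreal \<kappa>"
        unfolding \<kappa>(1)[symmetric] v(2)[symmetric] log_laplace_const
        by (intro sexpm1_tendsto LIMSEQ_SUP const_log_laplace_incseq)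
      moreover have "ennreal a < ennreal \<kappa>"
        using a False by (simp add: ennreal_less_iff)
      ultimately have "\<forall>\<^sub>F n in sequentially. ennreal a < sexpm1 p (const_log_laplace p (ennreal c) n)"
        by (rule order_tendstoD)
      \<comment> \<open>The number n of generations is chosen before the radius k, and both depend
        on a alone, so the lost length n * k stays fixed while t grows.\<close>
      then obtain n where n: "ennreal a < sexpm1 p (const_log_laplace p (ennreal c) n)"
        by (auto simp: eventually_sequentially)
      have "(\<lambda>k. sexpm1 p (trunc_log_laplace p (ennreal c) (real k) n)) \<longlonglongrightarrow> sexpm1 p (const_log_laplace p (ennreal c) n)"
        by (intro sexpm1_tendsto trunc_log_laplace_tendsto) simp
      from order_tendstoD(1)[OF this n]
      have "\<forall>\<^sub>F k in sequentially. ennreal a < sexpm1 p (trunc_log_laplace p (ennreal c) (real k) n)" .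
      with eventually_gt_at_top[of 0]
      have "\<forall>\<^sub>F k in sequentially. 0 < k \<and> ennreal a < sexpm1 p (trunc_log_laplace p (ennreal c) (real k) n)"
        by eventually_elim auto
      then obtain k :: nat where k: "0 < k" "ennreal a < sexpm1 p (trunc_log_laplace p (ennreal c) (real k) n)"
        by (auto simp: eventually_sequentially)
      \<comment> \<open>The slack between a and a' absorbs the factor (t - d) / t; a' is real even
        if the truncated value were \<top>.\<close>
      then obtain a' where a': "a < a'" "ennreal a' \<le> sexpm1 p (trunc_log_laplace p (ennreal c) (real k) n)"
      proof (cases "sexpm1 p (trunc_log_laplace p (ennreal c) (real k) n)")
        case (real r)
        then show ?thesis
          using that[of r] k False by (auto simp: ennreal_less_iff)
      next
        case top
        then show ?thesis using that[of "a + 1"] by simp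
      qed
      define d where "d = real n * real k"
      have "((\<lambda>t::real. (t - d) / t * a') \<longlongrightarrow> 1 * a') at_top"
        by (intro tendsto_mult_right) real_asymp
      then have "\<forall>\<^sub>F t in at_top. a < (t - d) / t * a'"
        using a' by (intro order_tendstoD) auto
      with eventually_gt_at_top[of 0] eventually_ge_at_top[of d]
      show ?thesis
      proof eventually_elim
        case (elim t)
        have "ennreal ((t - d) * a') \<le> ennreal (t - d) * sexpm1 p (trunc_log_laplace p (ennreal c) (real k) n)"
          using elim a' False by (subst ennreal_mult) (auto intro!: mult_left_mono)
        also have "\<dots> \<le> G t"
          unfolding G_def d_def using k elim by (intro nn_integral_log_laplace_ge) (auto simp: d_def)
        finally have "(t - d) * a' \<le> enn2real (G t)"
          using fin[of t] elim enn2real_mono[of "ennreal ((t - d) * a')" "G t"] a' False by simp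
        then have "(t - d) / t * a' \<le> enn2real (G t) / t"
          using elim by (simp add: divide_simps)
        with elim show ?case by linarith
      qed
    qed
  next
    fix a assume a: "\<kappa> < a"
    have "((\<lambda>t::real. C / t + \<kappa>) \<longlongrightarrow> 0 + \<kappa>) at_top"
      by (intro tendsto_add tendsto_const) real_asymp
    then have "\<forall>\<^sub>F t in at_top. C / t + \<kappa> < a"
      using a by (intro order_tendstoD) auto
    with eventually_gt_at_top[of 0] show "\<forall>\<^sub>F t in at_top. enn2real (G t) / t < a"
    proof eventually_elim
      case (elim t)
      have "enn2real (G t) \<le> C + \<kappa> * t"
        using upper[of t] elim C \<kappa> by (intro enn2real_leI) auto
      then have "enn2real (G t) / t \<le> C / t + \<kappa>"
        using elim by (simp add: divide_simps)
      with elim show ?case by simp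
    qed
  qed
  then show "((\<lambda>t. enn2real (G t) / t) \<longlongrightarrow> (if p then exp v - 1 else 1 - exp (- v))) at_top"
    unfolding \<kappa>(3) .
qed

end

section \<open>Large deviations from convergence of cumulants\<close>

lemma log_prob_le:
  assumes "0 \<le> q" "q \<le> r" "0 < r" "0 < t"
  shows "ereal (1 / t) * log_prob q \<le> ereal (ln r / t)"
  using assms by (auto simp: log_prob_def divide_right_mono)

lemma log_prob_ge:
  assumes "0 < r" "r \<le> q" "0 < t"
  shows "ereal (ln r / t) \<le> ereal (1 / t) * log_prob q"
  using assms by (auto simp: log_prob_def divide_right_mono)

context prob_space
begin

text \<open>On the line a closed set is covered by two half-lines starting at its points nearest to
  x0 on either side, so estimates for the two tails suffice.\<close>

lemma LDP_upper_bound: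
  fixes V :: "real \<Rightarrow> 'a \<Rightarrow> real" and J :: "real \<Rightarrow> ereal"
  assumes V [measurable]: "\<And>t. 0 < t \<Longrightarrow> V t \<in> borel_measurable M"
    and right: "\<And>x b. x0 \<le> x \<Longrightarrow> 0 \<le> b \<Longrightarrow> ereal b < J x \<Longrightarrow>
        \<forall>\<^sub>F t in at_top. prob {\<omega>\<in>space M. x \<le> V t \<omega>} \<le> exp (- t * b)"
    and left: "\<And>x b. x \<le> x0 \<Longrightarrow> 0 \<le> b \<Longrightarrow> ereal b < J x \<Longrightarrow>
        \<forall>\<^sub>F t in at_top. prob {\<omega>\<in>space M. V t \<omega> \<le> x} \<le> exp (- t * b)"
    and B [measurable]: "B \<in> sets borel"
  shows "Limsup at_top (\<lambda>t. ereal (1 / t) * log_prob (prob {\<omega>\<in>space M. V t \<omega> \<in> B}))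
    \<le> - (INF x\<in>closure B. J x)"
    (is "?L \<le> - ?I")
proof -
  have "?I \<le> - ?L"
  proof (rule dense_le)
    fix y assume y: "y < ?I"
    show "y \<le> - ?L"
    proof (cases "y \<le> 0")
      \<comment> \<open>The tail hypotheses require b \<ge> 0; for such y it is enough that
        probabilities are at most 1.\<close>
      case True
      have "\<forall>\<^sub>F t in at_top. ereal (1 / t) * log_prob (prob {\<omega>\<in>space M. V t \<omega> \<in> B}) \<le> 0"
        using eventually_gt_at_top[of 0]
      proof eventually_elim
        case (elim t)
        then show ?case
          using log_prob_le[of "prob {\<omega>\<in>space M. V t \<omega> \<in> B}" 1 t] by (simp add: zero_ereal_def)
      qed
      then have "?L \<le> 0" by (rule Limsup_bounded)
      then have "0 \<le> - ?L" by simp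
      with True show ?thesis by (rule order_trans)
    next
      case False
      then obtain b where b: "y = ereal b" "0 \<le> b"
        using y by (cases y) auto
      have J: "ereal b < J x" if "x \<in> closure B" for x
        using y that unfolding b by (rule less_INF_D)
      have "\<forall>\<^sub>F t in at_top. prob {\<omega>\<in>space M. V t \<omega> \<in> closure B \<inter> {x0..}} \<le> exp (- t * b)"
      proof (cases "closure B \<inter> {x0..} = {}")
        case False
        \<comment> \<open>The infimum is attained because the closure is closed, so the strict
          inequality for J is available at r itself.\<close>
        define r where "r = Inf (closure B \<inter> {x0..})"
        have bdd: "bdd_below (closure B \<inter> {x0..})" by (auto intro: bdd_belowI[of _ x0])
        have "r \<in> closure B \<inter> {x0..}"
          unfolding r_def using False bdd by (intro closed_contains_Inf) auto
        then have ev: "\<forall>\<^sub>F t in at_top. prob {\<omega>\<in>space M. r \<le> V t \<omega>} \<le> exp (- t * b)"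
          using b J by (intro right) auto
        have r: "r \<le> x" if "x \<in> closure B \<inter> {x0..}" for x
          unfolding r_def using bdd that by (rule cInf_lower[rotated])
        show ?thesis
          using ev eventually_gt_at_top[of 0]
        proof eventually_elim
          case (elim t)
          note [measurable] = V[OF elim(2)]
          have "prob {\<omega>\<in>space M. V t \<omega> \<in> closure B \<inter> {x0..}} \<le> prob {\<omega>\<in>space M. r \<le> V t \<omega>}"
            by (intro finite_measure_mono) (use r in auto)
          with elim show ?case by simp
        qed
      qed simp
      moreover have "\<forall>\<^sub>F t in at_top. prob {\<omega>\<in>space M. V t \<omega> \<in> closure B \<inter> {..x0}} \<le> exp (- t * b)"
      proof (cases "closure B \<inter> {..x0} = {}")
        case False
        define r where "r = Sup (closure B \<inter> {..x0})"
        have bdd: "bdd_above (closure B \<inter> {..x0})" by (auto intro: bdd_aboveI[of _ x0])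
        have "r \<in> closure B \<inter> {..x0}"
          unfolding r_def using False bdd by (intro closed_contains_Sup) auto
        then have ev: "\<forall>\<^sub>F t in at_top. prob {\<omega>\<in>space M. V t \<omega> \<le> r} \<le> exp (- t * b)"
          using b J by (intro left) auto
        have r: "x \<le> r" if "x \<in> closure B \<inter> {..x0}" for x
          unfolding r_def using bdd that by (rule cSup_upper[rotated])
        show ?thesis
          using ev eventually_gt_at_top[of 0]
        proof eventually_elim
          case (elim t)
          note [measurable] = V[OF elim(2)]
          have "prob {\<omega>\<in>space M. V t \<omega> \<in> closure B \<inter> {..x0}} \<le> prob {\<omega>\<in>space M. V t \<omega> \<le> r}"
            by (intro finite_measure_mono) (use r in auto)
          with elim show ?case by simp
        qed
      qed simp
      \<comment> \<open>The two tails cost a factor 2, which disappears on the exponential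
        scale.\<close>
      ultimately have "\<forall>\<^sub>F t in at_top. ereal (1 / t) * log_prob (prob {\<omega>\<in>space M. V t \<omega> \<in> B})
          \<le> ereal (ln 2 / t - b)"
        using eventually_gt_at_top[of 0]
      proof eventually_elim
        case (elim t)
        note [measurable] = V[OF elim(3)]
        have [measurable]: "closure B \<in> sets borel" by simp
        have "prob {\<omega>\<in>space M. V t \<omega> \<in> B}
          \<le> prob ({\<omega>\<in>space M. V t \<omega> \<in> closure B \<inter> {x0..}} \<union> {\<omega>\<in>space M. V t \<omega> \<in> closure B \<inter> {..x0}})"
          using closure_subset[of B] by (intro finite_measure_mono) auto
        also have "\<dots> \<le> prob {\<omega>\<in>space M. V t \<omega> \<in> closure B \<inter> {x0..}}
            + prob {\<omega>\<in>space M. V t \<omega> \<in> closure B \<inter> {..x0}}"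
          by (intro measure_Un_le) measurable
        finally have "prob {\<omega>\<in>space M. V t \<omega> \<in> B} \<le> 2 * exp (- t * b)"
          using elim by simp
        then have "ereal (1 / t) * log_prob (prob {\<omega>\<in>space M. V t \<omega> \<in> B}) \<le> ereal (ln (2 * exp (- t * b)) / t)"
          using elim by (intro log_prob_le) auto
        also have "ln (2 * exp (- t * b)) / t = ln 2 / t - b"
          using elim by (simp add: ln_mult field_simps)
        finally show ?case .
      qed
      then have "?L \<le> Limsup at_top (\<lambda>t. ereal (ln 2 / t - b))"
        by (rule Limsup_mono)
      also have "\<dots> = ereal (- b)"
      proof (rule lim_imp_Limsup)
        have "((\<lambda>t. ln 2 / t - b) \<longlongrightarrow> - b) at_top" by real_asymp
        then show "((\<lambda>t. ereal (ln 2 / t - b)) \<longlongrightarrow> ereal (- b)) at_top" by simp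
      qed simp
      finally show ?thesis
        unfolding b using ereal_minus_le_minus[of "ereal (- b)" ?L] by simp
    qed
  qed
  then show ?thesis using ereal_minus_le_minus[of "- ?L" ?I] by simp
qed

text \<open>An interior point has a ball inside B, so the local estimate applies. Where J x =
  \<infinity> that estimate is vacuous.\<close>

lemma LDP_lower_bound:
  fixes V :: "real \<Rightarrow> 'a \<Rightarrow> real" and J :: "real \<Rightarrow> ereal"
  assumes V [measurable]: "\<And>t. 0 < t \<Longrightarrow> V t \<in> borel_measurable M"
    and local: "\<And>x a \<epsilon>. 0 < \<epsilon> \<Longrightarrow> ereal a < - J x \<Longrightarrow>
        \<forall>\<^sub>F t in at_top. exp (t * a) \<le> prob {\<omega>\<in>space M. \<bar>V t \<omega> - x\<bar> < \<epsilon>}"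
    and B [measurable]: "B \<in> sets borel"
  shows "- (INF x\<in>interior B. J x)
    \<le> Liminf at_top (\<lambda>t. ereal (1 / t) * log_prob (prob {\<omega>\<in>space M. V t \<omega> \<in> B}))"
    (is "- ?I \<le> ?L")
proof -
  have "- ?L \<le> J x" if x: "x \<in> interior B" for x
  proof -
    obtain \<epsilon> where \<epsilon>: "0 < \<epsilon>" "ball x \<epsilon> \<subseteq> B"
      using x by (auto simp: mem_interior)
    have "- J x \<le> ?L"
    proof (rule dense_le)
      fix y assume y: "y < - J x"
      show "y \<le> ?L"
      proof (cases y)
        case (real a)
        have "\<forall>\<^sub>F t in at_top. exp (t * a) \<le> prob {\<omega>\<in>space M. \<bar>V t \<omega> - x\<bar> < \<epsilon>}"
          using y real by (intro local \<epsilon>) simp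
        then have "\<forall>\<^sub>F t in at_top. ereal a \<le> ereal (1 / t) * log_prob (prob {\<omega>\<in>space M. V t \<omega> \<in> B})"
          using eventually_gt_at_top[of 0]
        proof eventually_elim
          case (elim t)
          note [measurable] = V[OF elim(2)]
          have "prob {\<omega>\<in>space M. \<bar>V t \<omega> - x\<bar> < \<epsilon>} \<le> prob {\<omega>\<in>space M. V t \<omega> \<in> B}"
            using \<epsilon>(2) by (intro finite_measure_mono) (auto simp: dist_real_def abs_minus_commute subset_eq)
          then have "ereal (ln (exp (t * a)) / t) \<le> ereal (1 / t) * log_prob (prob {\<omega>\<in>space M. V t \<omega> \<in> B})"
            using elim by (intro log_prob_ge) auto
          then show ?case using elim by simp
        qed
        then show ?thesis unfolding real by (rule Liminf_bounded)
      qed (use y in auto)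
    qed
    then show ?thesis by (simp add: ereal_uminus_le_reorder)
  qed
  then have "- ?L \<le> ?I" by (rule INF_greatest)
  then show ?thesis by (simp add: ereal_uminus_le_reorder)
qed

lemma speed_function_id: "speed_function (\<lambda>t. t)"
  by (auto simp: speed_function_def mono_on_def filterlim_ident intro: measurable_restrict_space1)

text \<open>Keeping \<theta> inside the event makes one statement serve both tails, according to the
  sign of \<theta>.\<close>

lemma exponential_chebyshev:
  assumes [measurable]: "N \<in> borel_measurable M" and int: "integrable M (\<lambda>\<omega>. exp (\<theta> * N \<omega>))"
  shows "prob {\<omega>\<in>space M. y \<le> \<theta> * N \<omega>} \<le> exp (- y) * expectation (\<lambda>\<omega>. exp (\<theta> * N \<omega>))"
proof -
  have "prob {\<omega>\<in>space M. y \<le> \<theta> * N \<omega>} = expectation (indicator {\<omega>\<in>space M. y \<le> \<theta> * N \<omega>})"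
    by simp
  also have "\<dots> \<le> expectation (\<lambda>\<omega>. exp (- y) * exp (\<theta> * N \<omega>))"
  proof (rule integral_mono)
    show "indicator {\<omega>\<in>space M. y \<le> \<theta> * N \<omega>} \<omega> \<le> exp (- y) * exp (\<theta> * N \<omega>)" for \<omega>
      by (auto simp: indicator_def simp flip: exp_add)
    show "integrable M (indicator {\<omega>\<in>space M. y \<le> \<theta> * N \<omega>} :: 'a \<Rightarrow> real)"
      by (rule integrable_real_indicator) (auto simp: less_top[symmetric])
  qed (use int in simp)
  finally show ?thesis by simp
qed

lemma exponential_upper_tail:
  fixes N :: "real \<Rightarrow> 'a \<Rightarrow> real"
  assumes N [measurable]: "\<And>t. 0 < t \<Longrightarrow> N t \<in> borel_measurable M"
    and int: "\<And>t. 0 < t \<Longrightarrow> integrable M (\<lambda>\<omega>. exp (\<theta> * N t \<omega>))"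
    and lim: "((\<lambda>t. ln (expectation (\<lambda>\<omega>. exp (\<theta> * N t \<omega>))) / t) \<longlongrightarrow> \<Lambda>) at_top"
    and b: "b < x * \<theta> - \<Lambda>"
  shows "\<forall>\<^sub>F t in at_top. prob {\<omega>\<in>space M. t * (x * \<theta>) \<le> \<theta> * N t \<omega>} \<le> exp (- t * b)"
proof -
  have "\<Lambda> < x * \<theta> - b" using b by simp
  from order_tendstoD(2)[OF lim this] eventually_gt_at_top[of 0] show ?thesis
  proof eventually_elim
    case (elim t)
    let ?Z = "expectation (\<lambda>\<omega>. exp (\<theta> * N t \<omega>))"
    have "0 < ?Z"
      using int[OF elim(2)] by (intro expectation_greater) auto
    moreover have "ln ?Z < t * (x * \<theta> - b)"
      using elim by (simp add: divide_simps mult.commute)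
    ultimately have "?Z \<le> exp (t * (x * \<theta> - b))"
      by (metis exp_ln less_imp_le exp_le_cancel_iff)
    then have "exp (- (t * (x * \<theta>))) * ?Z \<le> exp (- (t * (x * \<theta>))) * exp (t * (x * \<theta> - b))"
      by simp
    also have "\<dots> = exp (- t * b)"
      by (simp add: algebra_simps flip: exp_add)
    finally show ?case
      using exponential_chebyshev[OF N[OF elim(2)] int[OF elim(2)], of "t * (x * \<theta>)"] by simp
  qed
qed

text \<open>Cramer's change of measure: under the law tilted by \<open>\<theta>\<close> the deviations of the mean from \<open>x\<close>
  are exponentially unlikely, as witnessed by the parameters \<open>\<alpha>\<close> and \<open>\<beta>\<close>.\<close>
lemma tilting_lower_bound:
  fixes N :: "real \<Rightarrow> 'a \<Rightarrow> real" and \<Lambda> :: "real \<Rightarrow> real"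
  assumes N [measurable]: "\<And>t. 0 < t \<Longrightarrow> N t \<in> borel_measurable M"
    and int: "\<And>\<eta> t. \<eta> \<in> {\<alpha>, \<theta>, \<beta>} \<Longrightarrow> 0 < t \<Longrightarrow> integrable M (\<lambda>\<omega>. exp (\<eta> * N t \<omega>))"
    and lim: "\<And>\<eta>. \<eta> \<in> {\<alpha>, \<theta>, \<beta>} \<Longrightarrow>
        ((\<lambda>t. ln (expectation (\<lambda>\<omega>. exp (\<eta> * N t \<omega>))) / t) \<longlongrightarrow> \<Lambda> \<eta>) at_top"
    and "0 < \<epsilon>" "\<alpha> < \<theta>" "\<theta> < \<beta>"
    and \<beta>: "\<Lambda> \<beta> - \<Lambda> \<theta> < (\<beta> - \<theta>) * (x + \<epsilon>)" and \<alpha>: "\<Lambda> \<alpha> - \<Lambda> \<theta> < (\<alpha> - \<theta>) * (x - \<epsilon>)"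
    and a: "a < \<Lambda> \<theta> - x * \<theta> - \<bar>\<theta>\<bar> * \<epsilon>"
  shows "\<forall>\<^sub>F t in at_top. exp (t * a) \<le> prob {\<omega>\<in>space M. \<bar>N t \<omega> / t - x\<bar> < \<epsilon>}"
proof -
  define Z where "Z \<eta> t = expectation (\<lambda>\<omega>. exp (\<eta> * N t \<omega>))" for \<eta> t
  have Z_pos: "0 < Z \<eta> t" if "\<eta> \<in> {\<alpha>, \<theta>, \<beta>}" "0 < t" for \<eta> t
    using int[OF that] unfolding Z_def by (intro expectation_greater) auto
  have limZ: "((\<lambda>t. ln (Z \<eta> t) / t) \<longlongrightarrow> \<Lambda> \<eta>) at_top" if "\<eta> \<in> {\<alpha>, \<theta>, \<beta>}" for \<eta>
    using lim[OF that] unfolding Z_def .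
  \<comment> \<open>Each of the two side events carries at most a quarter of the tilted mass, so at
    least half of it remains near x.\<close>
  have small: "\<forall>\<^sub>F t in at_top. exp (- (\<eta> - \<theta>) * (t * y)) * Z \<eta> t \<le> Z \<theta> t / 4"
    if \<eta>: "\<eta> \<in> {\<alpha>, \<theta>, \<beta>}" and y: "\<Lambda> \<eta> - \<Lambda> \<theta> < (\<eta> - \<theta>) * y" for \<eta> y
  proof -
    define d where "d = ((\<eta> - \<theta>) * y - (\<Lambda> \<eta> - \<Lambda> \<theta>)) / 2"
    have "0 < d" using y by (simp add: d_def)
    have "((\<lambda>t. ln (Z \<eta> t) / t - ln (Z \<theta> t) / t) \<longlongrightarrow> \<Lambda> \<eta> - \<Lambda> \<theta>) at_top"
      using \<eta> by (intro tendsto_diff limZ) auto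
    moreover have "\<Lambda> \<eta> - \<Lambda> \<theta> < (\<eta> - \<theta>) * y - d" using y by (simp add: d_def field_simps)
    ultimately have "\<forall>\<^sub>F t in at_top. ln (Z \<eta> t) / t - ln (Z \<theta> t) / t < (\<eta> - \<theta>) * y - d"
      by (rule order_tendstoD)
    with eventually_gt_at_top[of 0] eventually_ge_at_top[of "ln 4 / d"] show ?thesis
    proof eventually_elim
      case (elim t)
      have "(ln (Z \<eta> t) - ln (Z \<theta> t)) / t < (\<eta> - \<theta>) * y - d"
        using elim by (simp add: diff_divide_distrib)
      then have "ln (Z \<eta> t) - ln (Z \<theta> t) < ((\<eta> - \<theta>) * y - d) * t"
        using elim by (simp add: divide_simps)
      moreover have "ln 4 \<le> d * t"
        using elim \<open>0 < d\<close> by (simp add: divide_simps mult.commute)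
      ultimately have "- (\<eta> - \<theta>) * (t * y) + ln (Z \<eta> t) \<le> ln (Z \<theta> t) - ln 4"
        by (simp add: algebra_simps)
      then have "exp (- (\<eta> - \<theta>) * (t * y) + ln (Z \<eta> t)) \<le> exp (ln (Z \<theta> t) - ln 4)"
        by simp
      then show ?case
        using elim Z_pos[OF \<eta>, of t] Z_pos[of \<theta> t] by (simp add: exp_add exp_diff)
    qed
  qed
  \<comment> \<open>The term ln 2 accounts for keeping only half of the mass.\<close>
  have "((\<lambda>t. ln (Z \<theta> t) / t - ln 2 / t) \<longlongrightarrow> \<Lambda> \<theta> - 0) at_top"
    by (intro tendsto_diff limZ) (auto, real_asymp)
  moreover have "a + x * \<theta> + \<bar>\<theta>\<bar> * \<epsilon> < \<Lambda> \<theta> - 0" using a by simp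
  ultimately have ev: "\<forall>\<^sub>F t in at_top. a + x * \<theta> + \<bar>\<theta>\<bar> * \<epsilon> < ln (Z \<theta> t) / t - ln 2 / t"
    by (rule order_tendstoD)
  have "\<forall>\<^sub>F t in at_top. exp (- (\<beta> - \<theta>) * (t * (x + \<epsilon>))) * Z \<beta> t \<le> Z \<theta> t / 4"
    by (rule small) (use \<beta> in auto)
  moreover have "\<forall>\<^sub>F t in at_top. exp (- (\<alpha> - \<theta>) * (t * (x - \<epsilon>))) * Z \<alpha> t \<le> Z \<theta> t / 4"
    by (rule small) (use \<alpha> in auto)
  ultimately show ?thesis
    using ev eventually_gt_at_top[of 0]
  proof eventually_elim
    case (elim t)
    note t = elim(4)
    note [measurable] = N[OF t]
    let ?A = "{\<omega>\<in>space M. \<bar>N t \<omega> / t - x\<bar> < \<epsilon>}"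
    let ?e = "t * (x * \<theta> + \<bar>\<theta>\<bar> * \<epsilon>)"
    \<comment> \<open>Off the event, one of the two weights exp ((\<beta> - \<theta>) * (N - t * (x
      + \<epsilon>))) and exp ((\<alpha> - \<theta>) * (N - t * (x - \<epsilon>))) is at least 1 and
      can be inserted; on the event the exponent is at most \<open>?e\<close>.\<close>
    have "exp (\<theta> * N t \<omega>) \<le> exp ?e * indicator ?A \<omega>
      + exp (- (\<beta> - \<theta>) * (t * (x + \<epsilon>))) * exp (\<beta> * N t \<omega>)
      + exp (- (\<alpha> - \<theta>) * (t * (x - \<epsilon>))) * exp (\<alpha> * N t \<omega>)" if \<omega>: "\<omega> \<in> space M" for \<omega>
    proof -
      consider "\<omega> \<in> ?A" | "t * (x + \<epsilon>) \<le> N t \<omega>" | "N t \<omega> \<le> t * (x - \<epsilon>)"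
        by (cases "t * (x + \<epsilon>) \<le> N t \<omega>"; cases "N t \<omega> \<le> t * (x - \<epsilon>)")
          (use \<omega> t in \<open>auto simp: abs_less_iff field_simps\<close>)
      then show ?thesis
      proof cases
        case 1
        have "\<theta> * (N t \<omega> / t - x) \<le> \<bar>\<theta>\<bar> * \<bar>N t \<omega> / t - x\<bar>"
          by (metis abs_ge_self abs_mult)
        also have "\<dots> \<le> \<bar>\<theta>\<bar> * \<epsilon>"
          using 1 by (intro mult_left_mono) auto
        finally have "t * (\<theta> * (N t \<omega> / t - x)) \<le> t * (\<bar>\<theta>\<bar> * \<epsilon>)"
          using t by (intro mult_left_mono) auto
        then have "\<theta> * N t \<omega> \<le> ?e"
          using t by (simp add: algebra_simps)
        then show ?thesis
          using 1 by (simp add: add_increasing2)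
      next
        case 2
        have "(\<beta> - \<theta>) * (t * (x + \<epsilon>)) \<le> (\<beta> - \<theta>) * N t \<omega>"
          using 2 \<open>\<theta> < \<beta>\<close> by (intro mult_left_mono) auto
        then have "exp (\<theta> * N t \<omega>) \<le> exp (- (\<beta> - \<theta>) * (t * (x + \<epsilon>))) * exp (\<beta> * N t \<omega>)"
          by (simp add: algebra_simps flip: exp_add)
        then show ?thesis
          by (intro add_increasing2 order_trans[OF _ add_increasing[OF _ order.refl]]) auto
      next
        case 3
        have "(\<theta> - \<alpha>) * N t \<omega> \<le> (\<theta> - \<alpha>) * (t * (x - \<epsilon>))"
          using 3 \<open>\<alpha> < \<theta>\<close> by (intro mult_left_mono) auto
        then have "exp (\<theta> * N t \<omega>) \<le> exp (- (\<alpha> - \<theta>) * (t * (x - \<epsilon>))) * exp (\<alpha> * N t \<omega>)"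
          by (simp add: algebra_simps flip: exp_add)
        then show ?thesis
          by (intro add_increasing) auto
      qed
    qed
    note bound = this
    have A: "integrable M (indicator ?A :: 'a \<Rightarrow> real)"
      by (rule integrable_real_indicator) (auto simp: less_top[symmetric])
    have "Z \<theta> t \<le> expectation (\<lambda>\<omega>. exp ?e * indicator ?A \<omega>
      + exp (- (\<beta> - \<theta>) * (t * (x + \<epsilon>))) * exp (\<beta> * N t \<omega>)
      + exp (- (\<alpha> - \<theta>) * (t * (x - \<epsilon>))) * exp (\<alpha> * N t \<omega>))"
      unfolding Z_def
      by (intro integral_mono bound Bochner_Integration.integrable_add integrable_mult_right A int) (use t in auto)
    also have "\<dots> = exp ?e * prob ?A
      + exp (- (\<beta> - \<theta>) * (t * (x + \<epsilon>))) * Z \<beta> t + exp (- (\<alpha> - \<theta>) * (t * (x - \<epsilon>))) * Z \<alpha> t"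
      unfolding Z_def using int t A by simp
    finally have half: "Z \<theta> t / 2 \<le> exp ?e * prob ?A"
      using elim by linarith
    have "(a + x * \<theta> + \<bar>\<theta>\<bar> * \<epsilon>) * t \<le> ln (Z \<theta> t) - ln 2"
      using elim(3) t by (simp add: diff_divide_distrib[symmetric] pos_less_divide_eq less_imp_le)
    then have "t * a + ?e \<le> ln (Z \<theta> t / 2)"
      using Z_pos[of \<theta> t] t by (simp add: ln_div algebra_simps)
    then have "exp (t * a + ?e) \<le> Z \<theta> t / 2"
      using Z_pos[of \<theta> t] t by (simp add: ln_ge_iff)
    with half have "exp ?e * exp (t * a) \<le> exp ?e * prob ?A"
      unfolding exp_add by (simp only: mult.commute)
    then show ?case by (simp only: mult_le_cancel_left_pos exp_gt_zero)
  qed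
qed

end

section \<open>Cluster size and Hawkes process\<close>

context prob_space
begin

lemma AE_finite_points:
  assumes [measurable]: "(\<lambda>\<omega>. emeasure (count_space UNIV) (A \<omega>)) \<in> borel_measurable M"
    and "0 < c" and "(\<integral>\<^sup>+\<omega>. sexp True (ennreal c * emeasure (count_space UNIV) (A \<omega>)) \<partial>M) < \<top>"
  shows "AE \<omega> in M. finite (A \<omega>)"
proof -
  have "AE \<omega> in M. sexp True (ennreal c * emeasure (count_space UNIV) (A \<omega>)) \<noteq> \<infinity>"
    using assms(3) by (intro nn_integral_PInf_AE) auto
  then show ?thesis
    by eventually_elim
      (use \<open>0 < c\<close> in \<open>auto simp: emeasure_count_space ennreal_mult_top sexp_top split: if_splits\<close>)
qed

text \<open>The return from \<open>ennreal\<close> to real expectations: the flag is the sign of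
  \<theta>, and almost sure finiteness makes \<open>card\<close> the true count.\<close>

lemma expectation_exp_card:
  assumes [measurable]: "(\<lambda>\<omega>. emeasure (count_space UNIV) (A \<omega>)) \<in> borel_measurable M"
    and fin: "AE \<omega> in M. finite (A \<omega>)" and "0 \<le> r"
    and eq: "(\<integral>\<^sup>+\<omega>. sexp (0 \<le> \<theta>) (ennreal \<bar>\<theta>\<bar> * emeasure (count_space UNIV) (A \<omega>)) \<partial>M) = ennreal r"
  shows "integrable M (\<lambda>\<omega>. exp (\<theta> * real (card (A \<omega>))))"
    and "expectation (\<lambda>\<omega>. exp (\<theta> * real (card (A \<omega>)))) = r"
proof -
  have [measurable]: "(\<lambda>\<omega>. exp (\<theta> * real (card (A \<omega>)))) \<in> borel_measurable M"
    unfolding real_card_eq by measurable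
  have "(\<integral>\<^sup>+\<omega>. ennreal (exp (\<theta> * real (card (A \<omega>)))) \<partial>M)
    = (\<integral>\<^sup>+\<omega>. sexp (0 \<le> \<theta>) (ennreal \<bar>\<theta>\<bar> * emeasure (count_space UNIV) (A \<omega>)) \<partial>M)"
  proof (intro nn_integral_cong_AE, use fin in eventually_elim)
    case (elim \<omega>)
    then have "ennreal \<bar>\<theta>\<bar> * emeasure (count_space UNIV) (A \<omega>) = ennreal (\<bar>\<theta>\<bar> * real (card (A \<omega>)))"
      by (simp add: emeasure_count_space ennreal_mult ennreal_of_nat_eq_real_of_nat)
    then show ?case
      by (simp add: sexp_ennreal)
  qed
  with eq have *: "(\<integral>\<^sup>+\<omega>. ennreal (exp (\<theta> * real (card (A \<omega>)))) \<partial>M) = ennreal r"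
    by simp
  show "integrable M (\<lambda>\<omega>. exp (\<theta> * real (card (A \<omega>))))"
    using * by (intro integrableI_nonneg) auto
  show "expectation (\<lambda>\<omega>. exp (\<theta> * real (card (A \<omega>)))) = r"
    using * \<open>0 \<le> r\<close> by (subst integral_eq_nn_integral) auto
qed

end

section \<open>Moment generating functions of cluster sizes and window counts\<close>

context subcritical_hawkes
begin

definition \<theta>_max :: real where "\<theta>_max = \<mu> - 1 - ln \<mu>"

text \<open>The branching structure yields \<open>m = exp (\<theta> + \<mu> (m - 1))\<close> for the moment generating function \<open>m\<close> of
  the cluster size at \<open>\<theta>\<close>, so that \<open>cumulant_inv\<close> inverts it.\<close>
definition cumulant_inv :: "real \<Rightarrow> real" where "cumulant_inv m = ln m - \<mu> * (m - 1)"

lemma cumulant_inv_has_derivative: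
  "0 < m \<Longrightarrow> (cumulant_inv has_real_derivative 1 / m - \<mu>) (at m)"
  unfolding cumulant_inv_def [abs_def] by (auto intro!: derivative_eq_intros)

lemma cumulant_inv_continuous: "0 < a \<Longrightarrow> continuous_on {a..b} cumulant_inv"
  by (intro continuous_at_imp_continuous_on ballI DERIV_isCont[OF cumulant_inv_has_derivative]) auto

lemma cumulant_inv_strict_mono:
  assumes "0 < a" "a < b" "b \<le> 1 / \<mu>"
  shows "cumulant_inv a < cumulant_inv b"
proof (rule DERIV_pos_imp_increasing_open[OF assms(2)])
  show "\<exists>y. (cumulant_inv has_real_derivative y) (at x) \<and> 0 < y" if "a < x" "x < b" for x
    using that assms \<mu>_pos
    by (intro exI[of _ "1 / x - \<mu>"] conjI cumulant_inv_has_derivative) (auto simp: field_simps, smt (verit) mult_less_cancel_left_pos)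
qed (use assms in \<open>auto intro: cumulant_inv_continuous\<close>)

lemma cumulant_inv_inj:
  "0 < a \<Longrightarrow> a \<le> 1 / \<mu> \<Longrightarrow> 0 < b \<Longrightarrow> b \<le> 1 / \<mu> \<Longrightarrow> cumulant_inv a = cumulant_inv b \<Longrightarrow> a = b"
  using cumulant_inv_strict_mono[of a b] cumulant_inv_strict_mono[of b a] by linarith

lemma cumulant_inv_1 [simp]: "cumulant_inv 1 = 0"
  by (simp add: cumulant_inv_def)

lemma one_less_inverse_\<mu>: "1 < 1 / \<mu>"
  using \<mu>_pos \<mu>_less_1 by simp

lemma cumulant_inv_max: "cumulant_inv (1 / \<mu>) = \<theta>_max"
  using \<mu>_pos by (simp add: cumulant_inv_def \<theta>_max_def ln_div field_simps)

lemma cumulant_inv_less_max: "0 < m \<Longrightarrow> m < 1 / \<mu> \<Longrightarrow> cumulant_inv m < \<theta>_max"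
  using cumulant_inv_strict_mono[of m "1 / \<mu>"] cumulant_inv_max by simp

lemma \<theta>_max_pos: "0 < \<theta>_max"
  using cumulant_inv_less_max[of 1] one_less_inverse_\<mu> by simp

text \<open>The fixed point equation alone would also allow \<top> or, for positive \<theta>, the
  root above 1 / \<mu>. Since the limit is reached from below, the root m found in the increasing
  range of \<open>cumulant_inv\<close> bounds it. For negative \<theta> finiteness is immediate
  because \<open>sexpm1 False\<close> is at most 1.\<close>

lemma log_laplace_root:
  assumes "\<theta> < \<theta>_max"
  obtains v where "0 \<le> v" "log_laplace (0 \<le> \<theta>) (\<lambda>_. ennreal \<bar>\<theta>\<bar>) 0 = ennreal v"
    "exp (if 0 \<le> \<theta> then v else - v) < 1 / \<mu>" "cumulant_inv (exp (if 0 \<le> \<theta> then v else - v)) = \<theta>"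
proof -
  let ?p = "0 \<le> \<theta>"
  let ?v = "log_laplace ?p (\<lambda>_. ennreal \<bar>\<theta>\<bar>) 0"
  have fix_eq: "?v = ennreal \<bar>\<theta>\<bar> + sexpm1 ?p ?v * ennreal \<mu>"
    by (rule const_log_laplace_fixpoint)
  show ?thesis
  proof (cases "0 \<le> \<theta>")
    case True
    have "\<exists>m\<ge>1. m \<le> 1 / \<mu> \<and> cumulant_inv m = \<theta>"
      using True assms one_less_inverse_\<mu> by (intro IVT') (auto simp: cumulant_inv_max intro: cumulant_inv_continuous)
    then obtain m where m: "1 \<le> m" "m \<le> 1 / \<mu>" "cumulant_inv m = \<theta>" by auto
    have "m \<noteq> 1 / \<mu>" using m assms cumulant_inv_max by auto
    have \<theta>: "\<theta> + (m - 1) * \<mu> = ln m"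
      using m by (simp add: cumulant_inv_def mult.commute)
    \<comment> \<open>The number ln m is a fixed point of the monotone recursion and lies above its
      starting value \<theta>, hence above all iterates.\<close>
    have "const_log_laplace True (ennreal \<theta>) n \<le> ennreal (ln m)" for n
    proof (induction n)
      case 0
      show ?case using \<theta> m \<mu>_pos by (auto intro!: ennreal_leI simp flip: \<theta>)
    next
      case (Suc n)
      have "sexpm1 True (const_log_laplace True (ennreal \<theta>) n) \<le> sexpm1 True (ennreal (ln m))"
        by (rule sexpm1_mono[OF Suc])
      also have "\<dots> = ennreal (m - 1)"
        using m by (simp add: sexpm1_ennreal)
      finally have "const_log_laplace True (ennreal \<theta>) (Suc n) \<le> ennreal \<theta> + ennreal (m - 1) * ennreal \<mu>"
        by (auto intro!: add_left_mono mult_right_mono)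
      also have "\<dots> = ennreal (ln m)"
        using True m \<mu>_pos by (simp flip: ennreal_mult ennreal_plus \<theta>)
      finally show ?case .
    qed
    then have le: "?v \<le> ennreal (ln m)"
      unfolding log_laplace_const using True by (auto intro!: SUP_least)
    then obtain v where v: "?v = ennreal v" "0 \<le> v" "v \<le> ln m"
      using m by (cases ?v) (auto simp: top_unique)
    have "exp v \<le> m" using v m by (metis exp_le_cancel_iff exp_ln less_le_trans zero_less_one)
    then have "exp v < 1 / \<mu>" using m \<open>m \<noteq> 1 / \<mu>\<close> by simp
    moreover have "v = \<theta> + (exp v - 1) * \<mu>"
      using fix_eq True v \<mu>_pos by (simp add: sexpm1_ennreal flip: ennreal_mult ennreal_plus)
    ultimately show ?thesis
      using v True by (intro that[of v]) (auto simp: cumulant_inv_def algebra_simps)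
  next
    case False
    have "sexpm1 False ?v \<le> 1"
      by (simp add: sexpm1_def)
    then have "ennreal \<bar>\<theta>\<bar> + sexpm1 False ?v * ennreal \<mu> < \<top>"
      by (auto simp: ennreal_mult_less_top intro: le_less_trans[of _ 1])
    then have "?v < \<top>"
      using False by (subst fix_eq) simp
    then obtain v where v: "?v = ennreal v" "0 \<le> v"
      by (cases ?v) auto
    have "0 \<le> (1 - exp (- v)) * \<mu>"
      using v \<mu>_pos by simp
    then have "0 \<le> (1 - exp (- v)) * \<mu> - \<theta>"
      using False by linarith
    then have "v = - \<theta> + (1 - exp (- v)) * \<mu>"
      using fix_eq False v \<mu>_pos by (simp add: sexpm1_ennreal flip: ennreal_mult ennreal_plus)
    moreover have "exp (- v) < 1 / \<mu>"
      using v one_less_inverse_\<mu> by (smt (verit) exp_le_one_iff)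
    ultimately show ?thesis
      using v False by (intro that[of v]) (auto simp: cumulant_inv_def algebra_simps)
  qed
qed

text \<open>One finite exponential moment at a positive parameter suffices; half of
  \<open>\<theta>_max\<close> is an arbitrary admissible choice.\<close>

lemma cluster_finite_AE: "AE \<omega> in M. finite (cluster X D i \<omega>)"
proof -
  have \<theta>: "0 < \<theta>_max / 2" "\<theta>_max / 2 < \<theta>_max" using \<theta>_max_pos by auto
  obtain v where v: "0 \<le> v" "log_laplace True (\<lambda>_. ennreal (\<theta>_max / 2)) 0 = ennreal v"
    using log_laplace_root[OF \<theta>(2)] \<theta>(1) by auto
  show ?thesis
    by (rule AE_finite_points[OF cluster_measurable \<theta>(1)])
      (use v in \<open>simp add: cluster_count_laplace sexp_ennreal\<close>)
qed

lemma cluster_mgf: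
  fixes i :: nat
  assumes "\<theta> < \<theta>_max"
  defines "m \<equiv> expectation (\<lambda>\<omega>. exp (\<theta> * real (card (cluster X D i \<omega>))))"
  shows "integrable M (\<lambda>\<omega>. exp (\<theta> * real (card (cluster X D i \<omega>))))"
    and "0 < m" "m < 1 / \<mu>" "cumulant_inv m = \<theta>"
proof -
  obtain v where v: "0 \<le> v" "log_laplace (0 \<le> \<theta>) (\<lambda>_. ennreal \<bar>\<theta>\<bar>) 0 = ennreal v"
    "exp (if 0 \<le> \<theta> then v else - v) < 1 / \<mu>" "cumulant_inv (exp (if 0 \<le> \<theta> then v else - v)) = \<theta>"
    using log_laplace_root[OF assms(1)] by metis
  have "(\<integral>\<^sup>+\<omega>. sexp (0 \<le> \<theta>) (ennreal \<bar>\<theta>\<bar> * emeasure (count_space UNIV) (cluster X D i \<omega>)) \<partial>M)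
     = ennreal (exp (if 0 \<le> \<theta> then v else - v))"
    by (simp add: cluster_count_laplace v sexp_ennreal)
  note * = expectation_exp_card[OF cluster_measurable cluster_finite_AE _ this]
  show "integrable M (\<lambda>\<omega>. exp (\<theta> * real (card (cluster X D i \<omega>))))"
    by (rule *) simp
  have "m = exp (if 0 \<le> \<theta> then v else - v)"
    unfolding m_def by (rule *) simp
  then show "0 < m" "m < 1 / \<mu>" "cumulant_inv m = \<theta>"
    using v by auto
qed

lemma hawkes_mgf:
  fixes i :: nat
  assumes "\<theta> < \<theta>_max"
  shows "\<And>t. 0 < t \<Longrightarrow> integrable M (\<lambda>\<omega>. exp (\<theta> * real (card (hawkes_points X D \<omega> \<inter> {0<..t}))))"
    and "((\<lambda>t. ln (expectation (\<lambda>\<omega>. exp (\<theta> * real (card (hawkes_points X D \<omega> \<inter> {0<..t}))))) / t)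
      \<longlongrightarrow> \<nu> * (expectation (\<lambda>\<omega>. exp (\<theta> * real (card (cluster X D i \<omega>)))) - 1)) at_top"
proof -
  let ?N = "\<lambda>t \<omega>. real (card (hawkes_points X D \<omega> \<inter> {0<..t}))"
  define G where "G p c t = (\<integral>\<^sup>+y. sexpm1 p (log_laplace p (\<lambda>x. ennreal c * indicator {0<..t} x) y) \<partial>lborel)"
    for p c t
  have laplace: "(\<integral>\<^sup>+\<omega>. sexp p (ennreal c * emeasure (count_space UNIV) (hawkes_points X D \<omega> \<inter> {0<..t})) \<partial>M)
    = sexp p (ennreal \<nu> * G p c t)" for p c t
  proof -
    have [measurable]: "log_laplace p (\<lambda>x. ennreal c * indicator {0<..t} x) \<in> borel_measurable borel"
      unfolding log_laplace_def[abs_def]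
      by (intro borel_measurable_SUP tree_log_laplace_measurable[OF _ fert.sigma_finite_measure_axioms]) auto
    show ?thesis
      unfolding G_def by (subst hawkes_count_laplace) (auto simp: nn_integral_density nn_integral_cmult)
  qed
  have root: "\<exists>v\<ge>0. log_laplace (0 \<le> \<eta>) (\<lambda>_. ennreal \<bar>\<eta>\<bar>) 0 = ennreal v \<and>
      (if 0 \<le> \<eta> then exp v else 1) * \<mu> < 1 \<and>
      cumulant_inv (exp (if 0 \<le> \<eta> then v else - v)) = \<eta> \<and> exp (if 0 \<le> \<eta> then v else - v) < 1 / \<mu>"
    if \<eta>: "\<eta> < \<theta>_max" for \<eta>
  proof -
    obtain v where v: "0 \<le> v" "log_laplace (0 \<le> \<eta>) (\<lambda>_. ennreal \<bar>\<eta>\<bar>) 0 = ennreal v"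
      "exp (if 0 \<le> \<eta> then v else - v) < 1 / \<mu>" "cumulant_inv (exp (if 0 \<le> \<eta> then v else - v)) = \<eta>"
      using log_laplace_root[OF \<eta>] by metis
    moreover have "(if 0 \<le> \<eta> then exp v else 1) * \<mu> < 1"
      using v(3) \<mu>_pos \<mu>_less_1 by (cases "0 \<le> \<eta>") (simp_all add: pos_less_divide_eq)
    ultimately show ?thesis by blast
  qed
  \<comment> \<open>A positive parameter is needed here even if \<theta> is negative, since the
    transform at a negative parameter does not by itself exclude infinite counts.\<close>
  have fin: "AE \<omega> in M. finite (hawkes_points X D \<omega> \<inter> {0<..t})" if "0 < t" for t
  proof -
    have \<eta>: "0 < \<theta>_max / 2" "\<theta>_max / 2 < \<theta>_max" using \<theta>_max_pos by auto
    obtain v where v: "0 \<le> v" "log_laplace True (\<lambda>_. ennreal (\<theta>_max / 2)) 0 = ennreal v" "exp v * \<mu> < 1"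
      using root[OF \<eta>(2)] \<eta>(1) by auto
    have "G True (\<theta>_max / 2) t < \<top>"
      unfolding G_def using v \<eta> that by (intro log_laplace_window_asymptotics) auto
    then have "ennreal \<nu> * G True (\<theta>_max / 2) t < \<top>"
      by (simp add: ennreal_mult_less_top)
    then have "sexp True (ennreal \<nu> * G True (\<theta>_max / 2) t) < \<top>"
      by (simp add: sexp_def)
    then show ?thesis
      by (intro AE_finite_points[OF hawkes_points_measurable \<eta>(1)]) (simp_all add: laplace)
  qed
  obtain v where v: "0 \<le> v" "log_laplace (0 \<le> \<theta>) (\<lambda>_. ennreal \<bar>\<theta>\<bar>) 0 = ennreal v"
    "(if 0 \<le> \<theta> then exp v else 1) * \<mu> < 1" "cumulant_inv (exp (if 0 \<le> \<theta> then v else - v)) = \<theta>"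
    "exp (if 0 \<le> \<theta> then v else - v) < 1 / \<mu>"
    using root[OF assms] by blast
  define g where "g t = enn2real (G (0 \<le> \<theta>) \<bar>\<theta>\<bar> t)" for t
  note asymp = log_laplace_window_asymptotics[OF abs_ge_zero v(1,2,3), folded G_def]
  have "(\<integral>\<^sup>+\<omega>. sexp (0 \<le> \<theta>) (ennreal \<bar>\<theta>\<bar> * emeasure (count_space UNIV) (hawkes_points X D \<omega> \<inter> {0<..t})) \<partial>M)
    = ennreal (exp (if 0 \<le> \<theta> then \<nu> * g t else - (\<nu> * g t)))" if "0 < t" for t
  proof -
    have "ennreal \<nu> * G (0 \<le> \<theta>) \<bar>\<theta>\<bar> t = ennreal (\<nu> * g t)"
      using asymp(1)[OF that] intensity_pos by (simp add: g_def ennreal_mult)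
    then show ?thesis
      using intensity_pos by (simp add: laplace sexp_ennreal g_def)
  qed
  note * = expectation_exp_card[OF hawkes_points_measurable fin _ this]
  show "integrable M (\<lambda>\<omega>. exp (\<theta> * ?N t \<omega>))" if "0 < t" for t
    by (rule *(1)) (use that in auto)
  have E: "expectation (\<lambda>\<omega>. exp (\<theta> * ?N t \<omega>)) = exp (if 0 \<le> \<theta> then \<nu> * g t else - (\<nu> * g t))" if "0 < t" for t
    by (rule *(2)) (use that in auto)
  define m where "m = expectation (\<lambda>\<omega>. exp (\<theta> * real (card (cluster X D i \<omega>))))"
  \<comment> \<open>Both sides are preimages of \<theta> in the range where
    \<open>cumulant_inv\<close> is injective. In particular the index of the cluster does not
    matter.\<close>
  have m: "m = exp (if 0 \<le> \<theta> then v else - v)"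
    by (rule cumulant_inv_inj[of m "exp (if 0 \<le> \<theta> then v else - v)"])
      (use cluster_mgf[OF assms, of i, folded m_def] v in \<open>simp_all add: less_imp_le\<close>)
  have "((\<lambda>t. \<nu> * (if 0 \<le> \<theta> then 1 else - 1) * (g t / t)) \<longlongrightarrow>
      \<nu> * (if 0 \<le> \<theta> then 1 else - 1) * (if 0 \<le> \<theta> then exp v - 1 else 1 - exp (- v))) at_top"
    unfolding g_def by (intro tendsto_mult_left asymp)
  also have "\<nu> * (if 0 \<le> \<theta> then 1 else - 1) * (if 0 \<le> \<theta> then exp v - 1 else 1 - exp (- v)) = \<nu> * (m - 1)"
    by (simp add: m)
  finally show "((\<lambda>t. ln (expectation (\<lambda>\<omega>. exp (\<theta> * ?N t \<omega>))) / t) \<longlongrightarrow>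
      \<nu> * (expectation (\<lambda>\<omega>. exp (\<theta> * real (card (cluster X D i \<omega>)))) - 1)) at_top"
    unfolding m_def[symmetric]
  proof (rule Lim_transform_eventually)
    show "\<forall>\<^sub>F t in at_top. \<nu> * (if 0 \<le> \<theta> then 1 else - 1) * (g t / t) = ln (expectation (\<lambda>\<omega>. exp (\<theta> * ?N t \<omega>))) / t"
      using eventually_gt_at_top[of 0] by eventually_elim (simp add: E)
  qed
qed

end

section \<open>The tilted law of the cluster size\<close>

locale hawkes_cluster = subcritical_hawkes M \<nu> h X D \<mu>
  for M :: "'a measure" and \<nu> h X D \<mu> +
  fixes i :: nat and S :: "'a \<Rightarrow> real"
  assumes S_def: "S = (\<lambda>\<omega>. real (card (cluster X D i \<omega>)))"
begin

definition mgf :: "real \<Rightarrow> real" where "mgf \<theta> = expectation (\<lambda>\<omega>. exp (\<theta> * S \<omega>))"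

lemma S_measurable [measurable]: "S \<in> borel_measurable M"
  unfolding S_def real_card_eq by measurable

lemma S_eq: "S \<omega> = real (card (cluster X D i \<omega>))"
  by (simp add: S_def)

lemma S_nonneg: "0 \<le> S \<omega>"
  by (simp add: S_eq)

lemma mgf:
  assumes "\<theta> < \<theta>_max"
  shows "integrable M (\<lambda>\<omega>. exp (\<theta> * S \<omega>))" "0 < mgf \<theta>" "mgf \<theta> < 1 / \<mu>" "cumulant_inv (mgf \<theta>) = \<theta>"
  using cluster_mgf[OF assms, of i] by (simp_all add: mgf_def S_eq)

lemma mgf_cumulant_inv:
  assumes "0 < m" "m < 1 / \<mu>"
  shows "mgf (cumulant_inv m) = m"
  by (rule cumulant_inv_inj[of "mgf (cumulant_inv m)" m])
    (use mgf[OF cumulant_inv_less_max[OF assms]] assms in simp_all)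

lemma mgf_0: "mgf 0 = 1"
  by (simp add: mgf_def prob_space)

lemma mgf_le_1: "\<theta> \<le> 0 \<Longrightarrow> mgf \<theta> \<le> 1"
  using mgf[of \<theta>] \<theta>_max_pos cumulant_inv_strict_mono[of 1 "mgf \<theta>"] by force

lemma tilted_mean_integrable:
  assumes "\<theta> < \<theta>_max"
  shows "integrable M (\<lambda>\<omega>. S \<omega> * exp (\<theta> * S \<omega>))"
proof (rule Bochner_Integration.integrable_bound)
  \<comment> \<open>Half of the room up to \<open>\<theta>_max\<close> pays for the factor S, by S
    \<le> exp (\<delta> * S) / \<delta>.\<close>
  define \<delta> where "\<delta> = (\<theta>_max - \<theta>) / 2"
  have \<delta>: "0 < \<delta>" "\<theta> + \<delta> < \<theta>_max" using assms by (auto simp: \<delta>_def field_simps)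
  show "integrable M (\<lambda>\<omega>. exp ((\<theta> + \<delta>) * S \<omega>) / \<delta>)"
    using mgf(1)[OF \<delta>(2)] by simp
  have "S \<omega> * exp (\<theta> * S \<omega>) \<le> exp ((\<theta> + \<delta>) * S \<omega>) / \<delta>" for \<omega>
  proof -
    have "\<delta> * S \<omega> \<le> exp (\<delta> * S \<omega>)"
      using exp_ge_add_one_self[of "\<delta> * S \<omega>"] by linarith
    then have "\<delta> * S \<omega> * exp (\<theta> * S \<omega>) \<le> exp (\<delta> * S \<omega>) * exp (\<theta> * S \<omega>)"
      by (intro mult_right_mono) auto
    then show ?thesis
      using \<delta> by (simp add: field_simps flip: exp_add)
  qed
  then show "AE \<omega> in M. norm (S \<omega> * exp (\<theta> * S \<omega>)) \<le> norm (exp ((\<theta> + \<delta>) * S \<omega>) / \<delta>)"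
    using \<delta> S_nonneg by (auto simp: abs_mult)
qed measurable

text \<open>The tangent inequality 1 + u \<le> exp u at u = (\<eta> - \<theta>) * S, integrated
  under the tilted weight; no differentiation under the integral is involved.\<close>

lemma mgf_convex:
  assumes "\<theta> < \<theta>_max" "\<eta> < \<theta>_max"
  shows "mgf \<theta> + (\<eta> - \<theta>) * expectation (\<lambda>\<omega>. S \<omega> * exp (\<theta> * S \<omega>)) \<le> mgf \<eta>"
proof -
  note int = mgf(1)[OF assms(1)] mgf(1)[OF assms(2)] tilted_mean_integrable[OF assms(1)]
  have "mgf \<theta> + (\<eta> - \<theta>) * expectation (\<lambda>\<omega>. S \<omega> * exp (\<theta> * S \<omega>))
    = expectation (\<lambda>\<omega>. exp (\<theta> * S \<omega>) + (\<eta> - \<theta>) * (S \<omega> * exp (\<theta> * S \<omega>)))"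
    using int by (simp add: mgf_def)
  also have "\<dots> \<le> mgf \<eta>"
    unfolding mgf_def
  proof (rule integral_mono)
    fix \<omega>
    have "exp (\<theta> * S \<omega>) * (1 + (\<eta> - \<theta>) * S \<omega>) \<le> exp (\<theta> * S \<omega>) * exp ((\<eta> - \<theta>) * S \<omega>)"
      by (intro mult_left_mono) auto
    then show "exp (\<theta> * S \<omega>) + (\<eta> - \<theta>) * (S \<omega> * exp (\<theta> * S \<omega>)) \<le> exp (\<eta> * S \<omega>)"
      by (simp add: algebra_simps flip: exp_add)
  qed (use int in auto)
  finally show ?thesis .
qed

text \<open>By convexity \<open>m' - cumulant_inv m' * E (S exp (\<theta> S))\<close> is minimal at \<open>m' = mgf \<theta>\<close>, so its derivative
  vanishes there.\<close>
lemma tilted_mean: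
  assumes "\<theta> < \<theta>_max"
  shows "expectation (\<lambda>\<omega>. S \<omega> * exp (\<theta> * S \<omega>)) = mgf \<theta> / (1 - \<mu> * mgf \<theta>)"
proof -
  define A where "A = expectation (\<lambda>\<omega>. S \<omega> * exp (\<theta> * S \<omega>))"
  define m where "m = mgf \<theta>"
  have m: "0 < m" "m < 1 / \<mu>" "cumulant_inv m = \<theta>"
    using mgf[OF assms] by (auto simp: m_def)
  have "((\<lambda>m. m - cumulant_inv m * A) has_real_derivative 1 - (1 / m - \<mu>) * A) (at m)"
    using m by (auto intro!: derivative_eq_intros cumulant_inv_has_derivative)
  \<comment> \<open>Within this radius m' stays between 0 and 1 / \<mu>, where
    \<open>cumulant_inv\<close> inverts \<open>mgf\<close>.\<close>
  moreover have "0 < min m (1 / \<mu> - m)" using m by simp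
  moreover have "\<forall>m'. \<bar>m - m'\<bar> < min m (1 / \<mu> - m) \<longrightarrow> m - cumulant_inv m * A \<le> m' - cumulant_inv m' * A"
  proof (intro allI impI)
    fix m' assume "\<bar>m - m'\<bar> < min m (1 / \<mu> - m)"
    then have m': "0 < m'" "m' < 1 / \<mu>" by linarith+
    from mgf_convex[OF assms cumulant_inv_less_max[OF m']]
    show "m - cumulant_inv m * A \<le> m' - cumulant_inv m' * A"
      by (simp add: mgf_cumulant_inv[OF m'] m A_def[symmetric] m_def[symmetric] algebra_simps)
  qed
  ultimately have "1 - (1 / m - \<mu>) * A = 0"
    by (rule DERIV_local_min)
  moreover have "\<mu> * m < 1" using m \<mu>_pos by (simp add: field_simps)
  ultimately have "A = m / (1 - \<mu> * m)"
    using m by (simp add: field_simps)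
  then show ?thesis by (simp add: A_def m_def)
qed

text \<open>The solution m of m / (1 - \<mu> * m) = x / \<nu>, that is, the value of
  \<open>mgf\<close> at the parameter whose tilted mean is x / \<nu>.\<close>

definition tilted_mgf :: "real \<Rightarrow> real" where "tilted_mgf x = x / (\<nu> + x * \<mu>)"

lemma tilted_mgf:
  assumes "0 < x"
  shows "0 < tilted_mgf x" "tilted_mgf x < 1 / \<mu>" "tilted_mgf x / (1 - \<mu> * tilted_mgf x) = x / \<nu>"
proof -
  have pos: "0 < \<nu> + x * \<mu>" using assms intensity_pos \<mu>_pos by (simp add: add_pos_pos)
  show "0 < tilted_mgf x" using assms pos by (simp add: tilted_mgf_def)
  show "tilted_mgf x < 1 / \<mu>" using pos \<mu>_pos intensity_pos by (simp add: tilted_mgf_def field_simps)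
  have "1 - \<mu> * tilted_mgf x = \<nu> / (\<nu> + x * \<mu>)"
    using pos by (simp add: tilted_mgf_def field_simps)
  then show "tilted_mgf x / (1 - \<mu> * tilted_mgf x) = x / \<nu>"
    using pos by (simp add: tilted_mgf_def)
qed

lemma tilted_mgf_strict_mono:
  assumes "0 < x" "x < y"
  shows "tilted_mgf x < tilted_mgf y"
proof -
  have "0 < \<nu> + x * \<mu>" "0 < \<nu> + y * \<mu>"
    using assms intensity_pos \<mu>_pos by (auto intro!: add_pos_pos)
  then show ?thesis
    using assms intensity_pos by (simp add: tilted_mgf_def frac_less_eq field_simps)
qed

lemma tilted_mean_eq_iff:
  assumes "0 < x" "\<theta> < \<theta>_max"
  shows "expectation (\<lambda>\<omega>. S \<omega> * exp (\<theta> * S \<omega>)) = x / \<nu> \<longleftrightarrow> mgf \<theta> = tilted_mgf x"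
proof -
  have "\<mu> * mgf \<theta> < 1"
    using mgf(3)[OF assms(2)] \<mu>_pos by (simp add: field_simps)
  moreover have "0 < \<nu> + x * \<mu>" using assms intensity_pos \<mu>_pos by (simp add: add_pos_pos)
  ultimately show ?thesis
    using intensity_pos by (auto simp: tilted_mean[OF assms(2)] tilted_mgf_def field_simps)
qed

lemma mgf_eq_tilted_mgf_iff:
  assumes "0 < x"
  shows "\<theta> < \<theta>_max \<and> mgf \<theta> = tilted_mgf x \<longleftrightarrow> \<theta> = cumulant_inv (tilted_mgf x)"
  using tilted_mgf[OF assms] mgf mgf_cumulant_inv cumulant_inv_less_max by metis

text \<open>The closed form of \<theta>_x, obtained by applying the inverse of \<open>mgf\<close> to
  the value that it must take.\<close>

definition tilt :: "real \<Rightarrow> real" where "tilt x = cumulant_inv (tilted_mgf x)"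

lemma tilt:
  assumes "0 < x"
  shows "tilt x < \<theta>_max" "mgf (tilt x) = tilted_mgf x"
    "expectation (\<lambda>\<omega>. S \<omega> * exp (tilt x * S \<omega>)) = x / \<nu>"
  using mgf_eq_tilted_mgf_iff[OF assms, of "tilt x"] tilted_mean_eq_iff[OF assms, of "tilt x"]
  by (auto simp: tilt_def)

lemma tilt_unique:
  assumes "0 < x"
  shows "\<exists>!\<theta>. \<theta> < \<theta>_max \<and> expectation (\<lambda>\<omega>. S \<omega> * exp (\<theta> * S \<omega>)) = x / \<nu>"
  using tilt[OF assms] tilted_mean_eq_iff[OF assms] mgf_eq_tilted_mgf_iff[OF assms]
  by (intro ex1I[of _ "tilt x"]) (auto simp: tilt_def)

lemma hawkes_theta_eq: "0 < x \<Longrightarrow> hawkes_theta M S \<nu> \<mu> x = tilt x"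
  unfolding hawkes_theta_def \<theta>_max_def[symmetric]
  by (rule the1_equality[OF tilt_unique]) (auto simp: tilt)

section \<open>The rate function as a Legendre transform\<close>

abbreviation J :: "real \<Rightarrow> ereal" where "J \<equiv> hawkes_rate M S \<nu> \<mu>"

definition cumulant :: "real \<Rightarrow> real" where "cumulant \<theta> = \<nu> * (mgf \<theta> - 1)"

lemma J_pos: "0 < x \<Longrightarrow> J x = ereal (x * tilt x - cumulant (tilt x))"
  by (simp add: hawkes_rate_def hawkes_theta_eq cumulant_def tilt tilted_mgf_def algebra_simps)

text \<open>A tilted mean of x / \<nu> means that the cumulant has slope x at \<open>tilt x\<close>;
  this is its supporting line there.\<close>

lemma cumulant_convex:
  assumes "0 < x" "\<theta> < \<theta>_max"
  shows "cumulant (tilt x) + (\<theta> - tilt x) * x \<le> cumulant \<theta>"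
proof -
  have "mgf (tilt x) + (\<theta> - tilt x) * (x / \<nu>) \<le> mgf \<theta>"
    using mgf_convex[OF tilt(1)[OF assms(1)] assms(2)] tilt(3)[OF assms(1)] by simp
  then have "\<nu> * (mgf (tilt x) + (\<theta> - tilt x) * (x / \<nu>)) \<le> \<nu> * mgf \<theta>"
    using intensity_pos by (intro mult_left_mono) auto
  then show ?thesis
    using intensity_pos by (simp add: cumulant_def algebra_simps)
qed

text \<open>For x > 0 the supremum is attained at \<open>tilt x\<close>; for x \<le> 0 it is
  approached only as \<theta> tends to minus infinity. In this form semicontinuity, nonnegativity
  and both tail bounds are immediate.\<close>

lemma J_eq_SUP: "J x = (SUP \<theta>\<in>{..<\<theta>_max}. ereal (x * \<theta> - cumulant \<theta>))"
proof -
  consider "0 < x" | "x = 0" | "x < 0" by linarith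
  then show ?thesis
  proof cases
    case 1
    show ?thesis
    proof (rule antisym)
      show "J x \<le> (SUP \<theta>\<in>{..<\<theta>_max}. ereal (x * \<theta> - cumulant \<theta>))"
        unfolding J_pos[OF 1] by (rule SUP_upper) (use tilt[OF 1] in simp)
      show "(SUP \<theta>\<in>{..<\<theta>_max}. ereal (x * \<theta> - cumulant \<theta>)) \<le> J x"
        unfolding J_pos[OF 1]
        by (rule SUP_least) (use cumulant_convex[OF 1] in \<open>auto simp: algebra_simps\<close>)
    qed
  next
    case 2
    have "ereal \<nu> = (SUP \<theta>\<in>{..<\<theta>_max}. ereal (x * \<theta> - cumulant \<theta>))"
    proof (rule antisym)
      show "(SUP \<theta>\<in>{..<\<theta>_max}. ereal (x * \<theta> - cumulant \<theta>)) \<le> ereal \<nu>"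
        by (rule SUP_least) (use intensity_pos 2 in \<open>auto simp: cumulant_def algebra_simps
            intro!: mult_nonneg_nonneg less_imp_le[OF mgf(2)]\<close>)
      show "ereal \<nu> \<le> (SUP \<theta>\<in>{..<\<theta>_max}. ereal (x * \<theta> - cumulant \<theta>))"
      proof (rule ereal_le_epsilon2)
        fix e :: real assume "0 < e"
        \<comment> \<open>At x = 0 the objective is \<nu> - \<nu> * m, so m is taken small; the
          second bound keeps it below 1 / \<mu>.\<close>
        define m where "m = min (e / \<nu>) (1 / (2 * \<mu>))"
        have m: "0 < m" "m < 1 / \<mu>" "\<nu> * m \<le> e"
          using \<open>0 < e\<close> intensity_pos \<mu>_pos
          by (auto simp: m_def min_def field_simps)
        have "ereal (x * cumulant_inv m - cumulant (cumulant_inv m)) \<le> (SUP \<theta>\<in>{..<\<theta>_max}. ereal (x * \<theta> - cumulant \<theta>))"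
          using cumulant_inv_less_max[OF m(1,2)] by (intro SUP_upper) simp
        then have "ereal (\<nu> - \<nu> * m) \<le> (SUP \<theta>\<in>{..<\<theta>_max}. ereal (x * \<theta> - cumulant \<theta>))"
          by (simp add: 2 cumulant_def mgf_cumulant_inv[OF m(1,2)] algebra_simps)
        then have le: "ereal (\<nu> - \<nu> * m) + ereal e \<le> (SUP \<theta>\<in>{..<\<theta>_max}. ereal (x * \<theta> - cumulant \<theta>)) + ereal e"
          by (rule add_right_mono)
        have "ereal \<nu> \<le> ereal (\<nu> - \<nu> * m) + ereal e"
          using m by simp
        from this le show "ereal \<nu> \<le> (SUP \<theta>\<in>{..<\<theta>_max}. ereal (x * \<theta> - cumulant \<theta>)) + ereal e"
          by (rule order_trans)
      qed
    qed
    then show ?thesis using 2 by (simp add: hawkes_rate_def)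
  next
    case 3
    have "(SUP \<theta>\<in>{..<\<theta>_max}. ereal (x * \<theta> - cumulant \<theta>)) = \<infinity>"
    proof (rule SUP_PInfty)
      fix n :: nat
      \<comment> \<open>The parameter n / x is at most 0, so the cumulant there is at most 0 and the
        linear term alone gives n.\<close>
      have "n / x \<le> 0" using 3 by (simp add: divide_nonneg_neg)
      then have "mgf (n / x) \<le> 1" by (rule mgf_le_1)
      then have "\<nu> * mgf (n / x) \<le> \<nu> * 1" using intensity_pos by (intro mult_left_mono) auto
      then have "real n \<le> x * (n / x) - cumulant (n / x)"
        using 3 by (simp add: cumulant_def algebra_simps)
      then show "\<exists>\<theta>\<in>{..<\<theta>_max}. ereal (real n) \<le> ereal (x * \<theta> - cumulant \<theta>)"
        using \<open>n / x \<le> 0\<close> \<theta>_max_pos by (intro bexI[of _ "n / x"]) auto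
    qed
    then show ?thesis using 3 by (simp add: hawkes_rate_def)
  qed
qed

text \<open>A supremum of affine functions has intersections of closed half-lines as its sublevel
  sets.\<close>

lemma closed_J_le: "closed {x. J x \<le> ereal a}"
proof -
  have "{x. J x \<le> ereal a} = (\<Inter>\<theta>\<in>{..<\<theta>_max}. {x. x * \<theta> - cumulant \<theta> \<le> a})"
    by (auto simp: J_eq_SUP SUP_le_iff)
  also have "closed \<dots>"
    by (intro closed_INT ballI closed_Collect_le continuous_intros)
  finally show ?thesis .
qed

lemma J_nonneg: "0 \<le> J x"
  unfolding J_eq_SUP
  by (rule SUP_upper2[of 0]) (use \<theta>_max_pos in \<open>auto simp: cumulant_def mgf_0\<close>)

lemma rate_function_J: "rate_function J"
  unfolding rate_function_def using J_nonneg closed_J_le by simp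

lemma good_rate_function_J: "good_rate_function J"
  unfolding good_rate_function_def
proof (intro conjI rate_function_J allI impI)
  fix a :: real
  \<comment> \<open>Any positive admissible parameter bounds the level set from above through its
    supporting line.\<close>
  define \<theta> where "\<theta> = \<theta>_max / 2"
  have \<theta>: "0 < \<theta>" "\<theta> < \<theta>_max" using \<theta>_max_pos by (auto simp: \<theta>_def)
  have "{x. J x \<le> ereal a} \<subseteq> {0..(a + cumulant \<theta>) / \<theta>}"
  proof
    fix x assume x: "x \<in> {x. J x \<le> ereal a}"
    then have "0 \<le> x" by (auto simp: hawkes_rate_def split: if_splits)
    moreover have "ereal (x * \<theta> - cumulant \<theta>) \<le> J x"
      unfolding J_eq_SUP using \<theta> by (intro SUP_upper) simp
    then have "ereal (x * \<theta> - cumulant \<theta>) \<le> ereal a"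
      by (rule order_trans) (use x in simp)
    ultimately show "x \<in> {0..(a + cumulant \<theta>) / \<theta>}"
      using \<theta> by (simp add: field_simps)
  qed
  then show "compact {x. J x \<le> ereal a}"
    unfolding compact_eq_bounded_closed by (auto intro: closed_J_le bounded_subset[OF bounded_closed_interval])
qed

text \<open>The mean number of points per unit time, immigrant rate times mean cluster size. The
  rate function vanishes here, and the two tails are separated at this point.\<close>

definition typical :: real where "typical = \<nu> / (1 - \<mu>)"

lemma typical_pos: "0 < typical"
  using intensity_pos \<mu>_less_1 by (simp add: typical_def)

lemma J_typical: "J typical = 0"
proof -
  have "tilted_mgf typical = 1"
    using intensity_pos \<mu>_less_1 by (simp add: tilted_mgf_def typical_def field_simps)
  then show ?thesis
    using typical_pos by (simp add: J_pos cumulant_def tilt tilt_def mgf_0)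
qed

text \<open>With the closed form of \<open>tilt\<close> this is an elementary limit, dominated by x
  * ln x tending to 0. The limit equals the rate at 0, where no tilting parameter exists.\<close>

lemma J_tendsto_0: "((\<lambda>x. x * tilt x - cumulant (tilt x)) \<longlongrightarrow> \<nu>) (at_right 0)"
proof -
  have "((\<lambda>x. x * (ln (x / (\<nu> + x * \<mu>)) - \<mu> * (x / (\<nu> + x * \<mu>) - 1)) - \<nu> * (x / (\<nu> + x * \<mu>) - 1)) \<longlongrightarrow> \<nu>) (at_right 0)"
    using intensity_pos \<mu>_pos by real_asymp
  moreover have "\<forall>\<^sub>F x in at_right 0. x * (ln (x / (\<nu> + x * \<mu>)) - \<mu> * (x / (\<nu> + x * \<mu>) - 1)) - \<nu> * (x / (\<nu> + x * \<mu>) - 1)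
    = x * tilt x - cumulant (tilt x)"
    using eventually_at_right_less[of 0]
    by eventually_elim (simp add: cumulant_def tilt, simp add: tilt_def tilted_mgf_def cumulant_inv_def)
  ultimately show ?thesis
    by (rule Lim_transform_eventually)
qed

section \<open>Tail and local bounds for the scaled counts\<close>

abbreviation N :: "real \<Rightarrow> 'a \<Rightarrow> real" where
  "N t \<omega> \<equiv> real (card (hawkes_points X D \<omega> \<inter> {0<..t}))"

lemma N_measurable [measurable]: "N t \<in> borel_measurable M"
  unfolding real_card_eq by measurable

lemma N_mgf:
  assumes "\<theta> < \<theta>_max"
  shows "\<And>t. 0 < t \<Longrightarrow> integrable M (\<lambda>\<omega>. exp (\<theta> * N t \<omega>))"
    and "((\<lambda>t. ln (expectation (\<lambda>\<omega>. exp (\<theta> * N t \<omega>))) / t) \<longlongrightarrow> cumulant \<theta>) at_top"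
  using hawkes_mgf(1)[OF assms] hawkes_mgf(2)[OF assms, of i] by (simp_all add: cumulant_def mgf_def S_eq)

text \<open>A parameter with a nonnegative gain at x must be positive: at \<open>typical\<close> the
  rate is 0, so no parameter gains there, and a nonpositive one would gain even less further to the
  right.\<close>

lemma N_upper_tail:
  assumes "typical \<le> x" "0 \<le> b" "ereal b < J x"
  shows "\<forall>\<^sub>F t in at_top. prob {\<omega>\<in>space M. x \<le> N t \<omega> / t} \<le> exp (- t * b)"
proof -
  obtain \<theta> where \<theta>: "\<theta> < \<theta>_max" "b < x * \<theta> - cumulant \<theta>"
    using assms(3) unfolding J_eq_SUP less_SUP_iff by auto
  have "ereal (typical * \<theta> - cumulant \<theta>) \<le> J typical"
    unfolding J_eq_SUP using \<theta> by (intro SUP_upper) simp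
  then have "typical * \<theta> \<le> cumulant \<theta>" by (simp add: J_typical zero_ereal_def)
  have "0 < \<theta>"
  proof (rule ccontr)
    assume "\<not> 0 < \<theta>"
    then have "x * \<theta> \<le> typical * \<theta>" using assms(1) by (intro mult_right_mono_neg) auto
    then show False using \<theta>(2) \<open>typical * \<theta> \<le> cumulant \<theta>\<close> assms(2) by linarith
  qed
  have "\<forall>\<^sub>F t in at_top. prob {\<omega>\<in>space M. t * (x * \<theta>) \<le> \<theta> * N t \<omega>} \<le> exp (- t * b)"
    by (rule exponential_upper_tail[OF N_measurable N_mgf[OF \<theta>(1)] \<theta>(2)])
  with eventually_gt_at_top[of 0] show ?thesis
  proof eventually_elim
    case (elim t)
    have "{\<omega>\<in>space M. x \<le> N t \<omega> / t} = {\<omega>\<in>space M. t * (x * \<theta>) \<le> \<theta> * N t \<omega>}"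
      using elim(1) \<open>0 < \<theta>\<close> by (auto simp: pos_le_divide_eq mult_ac)
    with elim show ?case by simp
  qed
qed

lemma N_lower_tail:
  assumes "x \<le> typical" "0 \<le> b" "ereal b < J x"
  shows "\<forall>\<^sub>F t in at_top. prob {\<omega>\<in>space M. N t \<omega> / t \<le> x} \<le> exp (- t * b)"
proof -
  obtain \<theta> where \<theta>: "\<theta> < \<theta>_max" "b < x * \<theta> - cumulant \<theta>"
    using assms(3) unfolding J_eq_SUP less_SUP_iff by auto
  have "ereal (typical * \<theta> - cumulant \<theta>) \<le> J typical"
    unfolding J_eq_SUP using \<theta> by (intro SUP_upper) simp
  then have "typical * \<theta> \<le> cumulant \<theta>" by (simp add: J_typical zero_ereal_def)
  have "\<theta> < 0"
  proof (rule ccontr)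
    assume "\<not> \<theta> < 0"
    then have "x * \<theta> \<le> typical * \<theta>" using assms(1) by (intro mult_right_mono) auto
    then show False using \<theta>(2) \<open>typical * \<theta> \<le> cumulant \<theta>\<close> assms(2) by linarith
  qed
  have "\<forall>\<^sub>F t in at_top. prob {\<omega>\<in>space M. t * (x * \<theta>) \<le> \<theta> * N t \<omega>} \<le> exp (- t * b)"
    by (rule exponential_upper_tail[OF N_measurable N_mgf[OF \<theta>(1)] \<theta>(2)])
  with eventually_gt_at_top[of 0] show ?thesis
  proof eventually_elim
    case (elim t)
    have "(N t \<omega> / t \<le> x) = (t * (x * \<theta>) \<le> \<theta> * N t \<omega>)" for \<omega>
    proof -
      have "(N t \<omega> / t \<le> x) = (N t \<omega> \<le> t * x)"
        using elim(1) by (simp add: pos_divide_le_eq mult.commute)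
      also have "\<dots> = (\<theta> * (t * x) \<le> \<theta> * N t \<omega>)"
        using \<open>\<theta> < 0\<close> by simp
      finally show ?thesis by (simp add: mult_ac)
    qed
    with elim show ?case by simp
  qed
qed

text \<open>Tilting by \<open>tilt x\<close> gives the cumulant slope x. The parameters belonging to
  two nearby slopes y1 < x < y2 witness that larger deviations are rare under the tilted
  law.\<close>

lemma N_local_pos:
  assumes "0 < x" "0 < \<epsilon>" "ereal a < - J x"
  shows "\<forall>\<^sub>F t in at_top. exp (t * a) \<le> prob {\<omega>\<in>space M. \<bar>N t \<omega> / t - x\<bar> < \<epsilon>}"
proof -
  define \<theta> where "\<theta> = tilt x"
  \<comment> \<open>The interval is shrunk until the error \<bar>\<theta>\<bar> * \<delta> is at
    most half of the available gap; the summand 1 guards against \<theta> = 0.\<close>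
  define \<delta> where "\<delta> = min \<epsilon> ((cumulant \<theta> - x * \<theta> - a) / (2 * (\<bar>\<theta>\<bar> + 1)))"
  have gap: "0 < cumulant \<theta> - x * \<theta> - a"
  proof -
    have "a < - (x * \<theta> - cumulant \<theta>)"
      using assms(3) by (simp only: J_pos[OF assms(1)] \<theta>_def uminus_ereal.simps less_ereal.simps(1))
    then show ?thesis by linarith
  qed
  then have \<delta>: "0 < \<delta>" "\<delta> \<le> \<epsilon>"
    using assms(2) by (auto simp: \<delta>_def)
  have half: "y / 2 < y" if "0 < y" for y :: real
    using that by simp
  have "\<bar>\<theta>\<bar> * \<delta> \<le> (\<bar>\<theta>\<bar> + 1) * ((cumulant \<theta> - x * \<theta> - a) / (2 * (\<bar>\<theta>\<bar> + 1)))"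
    using \<delta> by (intro mult_mono) (auto simp: \<delta>_def)
  also have "\<dots> = (cumulant \<theta> - x * \<theta> - a) / 2"
    by (simp add: field_simps add_pos_nonneg)
  also have "\<dots> < cumulant \<theta> - x * \<theta> - a"
    by (rule half[OF gap])
  finally have a: "a < cumulant \<theta> - x * \<theta> - \<bar>\<theta>\<bar> * \<delta>"
    by linarith
  define y2 where "y2 = x + \<delta> / 2"
  \<comment> \<open>The maximum with x / 2 keeps y1 positive, so that \<open>tilt y1\<close> has the
    required slope.\<close>
  define y1 where "y1 = max (x - \<delta> / 2) (x / 2)"
  have y: "0 < y1" "y1 < x" "x < y2" "0 < y2" "x - \<delta> < y1" "y2 < x + \<delta>"
    using assms(1) \<delta> by (auto simp: y1_def y2_def)
  have "tilt y1 < \<theta>" "\<theta> < tilt y2"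
    unfolding \<theta>_def tilt_def using y assms(1) tilted_mgf tilted_mgf_strict_mono
    by (auto intro!: cumulant_inv_strict_mono simp: less_imp_le)
  have "\<forall>\<^sub>F t in at_top. exp (t * a) \<le> prob {\<omega>\<in>space M. \<bar>N t \<omega> / t - x\<bar> < \<delta>}"
  proof (rule tilting_lower_bound[where \<alpha> = "tilt y1" and \<beta> = "tilt y2" and \<theta> = \<theta> and \<Lambda> = cumulant])
    have "\<eta> < \<theta>_max" if "\<eta> \<in> {tilt y1, \<theta>, tilt y2}" for \<eta>
      using that tilt(1) y assms(1) by (auto simp: \<theta>_def)
    then show "\<And>\<eta> t. \<eta> \<in> {tilt y1, \<theta>, tilt y2} \<Longrightarrow> 0 < t \<Longrightarrow> integrable M (\<lambda>\<omega>. exp (\<eta> * N t \<omega>))"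
      "\<And>\<eta>. \<eta> \<in> {tilt y1, \<theta>, tilt y2} \<Longrightarrow>
        ((\<lambda>t. ln (expectation (\<lambda>\<omega>. exp (\<eta> * N t \<omega>))) / t) \<longlongrightarrow> cumulant \<eta>) at_top"
      using N_mgf by blast+
    \<comment> \<open>The supporting line at \<open>tilt y2\<close>, evaluated at \<theta>, gives
      the inequality with slope y2; y2 < x + \<delta> then makes it strict.\<close>
    have "cumulant (tilt y2) + (\<theta> - tilt y2) * y2 \<le> cumulant \<theta>"
      using cumulant_convex[OF y(4)] tilt(1)[OF assms(1)] by (simp add: \<theta>_def)
    then have "cumulant (tilt y2) - cumulant \<theta> \<le> (tilt y2 - \<theta>) * y2"
      by (simp add: algebra_simps)
    also have "\<dots> < (tilt y2 - \<theta>) * (x + \<delta>)"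
      using y \<open>\<theta> < tilt y2\<close> by (intro mult_strict_left_mono) auto
    finally show "cumulant (tilt y2) - cumulant \<theta> < (tilt y2 - \<theta>) * (x + \<delta>)" .
    have "cumulant (tilt y1) + (\<theta> - tilt y1) * y1 \<le> cumulant \<theta>"
      using cumulant_convex[OF y(1)] tilt(1)[OF assms(1)] by (simp add: \<theta>_def)
    then have "cumulant (tilt y1) - cumulant \<theta> \<le> (tilt y1 - \<theta>) * y1"
      by (simp add: algebra_simps)
    also have "\<dots> < (tilt y1 - \<theta>) * (x - \<delta>)"
      using y \<open>tilt y1 < \<theta>\<close> by (intro mult_strict_left_mono_neg) auto
    finally show "cumulant (tilt y1) - cumulant \<theta> < (tilt y1 - \<theta>) * (x - \<delta>)" .
  qed (use \<delta> a \<open>tilt y1 < \<theta>\<close> \<open>\<theta> < tilt y2\<close> in auto)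
  then show ?thesis
  proof eventually_elim
    case (elim t)
    have "prob {\<omega>\<in>space M. \<bar>N t \<omega> / t - x\<bar> < \<delta>} \<le> prob {\<omega>\<in>space M. \<bar>N t \<omega> / t - x\<bar> < \<epsilon>}"
      using \<delta> by (intro finite_measure_mono) auto
    with elim show ?case by simp
  qed
qed

lemma N_local:
  assumes "0 < \<epsilon>" "ereal a < - J x"
  shows "\<forall>\<^sub>F t in at_top. exp (t * a) \<le> prob {\<omega>\<in>space M. \<bar>N t \<omega> / t - x\<bar> < \<epsilon>}"
proof -
  consider "0 < x" | "x = 0" | "x < 0" by linarith
  then show ?thesis
  proof cases
    case 1
    then show ?thesis by (rule N_local_pos[OF _ assms])
  next
    case 2
    \<comment> \<open>The bound is borrowed from a small y > 0 whose rate is still below - a; with y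
      < \<epsilon> / 2 the interval of radius \<epsilon> / 2 around y fits into the one of radius
      \<epsilon> around 0.\<close>
    then have "\<nu> < - a" using assms(2) by (simp add: hawkes_rate_def)
    from order_tendstoD(2)[OF J_tendsto_0 this] eventually_at_right_less[of 0]
    have "\<forall>\<^sub>F y in at_right 0. 0 < y \<and> y * tilt y - cumulant (tilt y) < - a"
      by eventually_elim simp
    moreover have "\<forall>\<^sub>F y in at_right 0. y < \<epsilon> / 2"
      using assms(1) by (intro order_tendstoD[OF tendsto_ident_at]) auto
    ultimately have "\<forall>\<^sub>F y in at_right (0::real). 0 < y \<and> y * tilt y - cumulant (tilt y) < - a \<and> y < \<epsilon> / 2"
      by eventually_elim simp
    then obtain y where y: "0 < y" "y * tilt y - cumulant (tilt y) < - a" "y < \<epsilon> / 2"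
      using eventually_happens' trivial_limit_at_right_real by blast
    have "ereal a < - J y" using y by (simp add: J_pos)
    with y(1) assms(1) have "\<forall>\<^sub>F t in at_top. exp (t * a) \<le> prob {\<omega>\<in>space M. \<bar>N t \<omega> / t - y\<bar> < \<epsilon> / 2}"
      by (intro N_local_pos) auto
    then show ?thesis
    proof eventually_elim
      case (elim t)
      have "\<bar>N t \<omega> / t - x\<bar> < \<epsilon>" if "\<bar>N t \<omega> / t - y\<bar> < \<epsilon> / 2" for \<omega>
        using that y unfolding 2 by linarith
      then have "prob {\<omega>\<in>space M. \<bar>N t \<omega> / t - y\<bar> < \<epsilon> / 2} \<le> prob {\<omega>\<in>space M. \<bar>N t \<omega> / t - x\<bar> < \<epsilon>}"
        by (intro finite_measure_mono) auto
      with elim show ?case by simp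
    qed
  next
    case 3
    \<comment> \<open>The rate is infinite here, and no real a lies below - \<infinity>.\<close>
    then show ?thesis using assms(2) by (simp add: hawkes_rate_def)
  qed
qed

lemma hawkes_LDP: "satisfies_LDP (\<lambda>t \<omega>. N t \<omega> / t) J (\<lambda>t. t)"
  unfolding satisfies_LDP_def
proof (intro conjI ballI rate_function_J speed_function_id allI impI)
  show "(\<lambda>\<omega>. N t \<omega> / t) \<in> borel_measurable M" for t
    by measurable
  fix B :: "real set" assume B: "B \<in> sets borel"
  show "- (INF x\<in>interior B. J x)
      \<le> Liminf at_top (\<lambda>t. ereal (1 / t) * log_prob (prob {\<omega>\<in>space M. N t \<omega> / t \<in> B}))"
    by (rule LDP_lower_bound[OF _ N_local B]) auto
  show "Limsup at_top (\<lambda>t. ereal (1 / t) * log_prob (prob {\<omega>\<in>space M. N t \<omega> / t \<in> B}))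
      \<le> - (INF x\<in>closure B. J x)"
    by (rule LDP_upper_bound[OF _ N_upper_tail N_lower_tail B]) auto
qed

end

theorem theorem3p4:
  fixes M :: "'a measure" and \<nu> \<mu> :: real and h :: "real \<Rightarrow> real"
    and X :: "nat \<Rightarrow> 'a \<Rightarrow> real"
    and D :: "nat \<Rightarrow> nat list \<Rightarrow> nat \<Rightarrow> 'a \<Rightarrow> ereal"
    and i :: nat and S :: "'a \<Rightarrow> real"
  assumes "hawkes_process M \<nu> h X D"
    and "set_integrable lborel {0<..} h"
    and "\<mu> = (LINT t:{0<..}|lborel. h t)"
    and "0 < \<mu>" and "\<mu> < 1"
    and "set_integrable lborel {0<..} (\<lambda>t. t * h t)"
    and "S = (\<lambda>\<omega>. real (card (cluster X D i \<omega>)))"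
  shows "(\<forall>x>0. \<exists>!\<theta>. \<theta> < \<mu> - 1 - ln \<mu> \<and> (LINT \<omega>|M. S \<omega> * exp (\<theta> * S \<omega>)) = x / \<nu>) \<and>
    (\<forall>x>0. \<forall>\<theta> < \<mu> - 1 - ln \<mu>.
           (LINT \<omega>|M. S \<omega> * exp (\<theta> * S \<omega>)) = x / \<nu> \<longleftrightarrow>
           (LINT \<omega>|M. exp (\<theta> * S \<omega>)) = x / (\<nu> + x * \<mu>)) \<and>
    prob_space.satisfies_LDP M (\<lambda>t \<omega>. real (card (hawkes_points X D \<omega> \<inter> {0<..t})) / t)
           (hawkes_rate M S \<nu> \<mu>) (\<lambda>t. t) \<and>
    good_rate_function (hawkes_rate M S \<nu> \<mu>)"
proof -
  interpret hawkes_process M \<nu> h X D by fact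
  interpret hawkes_cluster M \<nu> h X D \<mu> i S
    by unfold_locales (use assms in auto)
  show ?thesis
    using tilt_unique tilted_mean_eq_iff hawkes_LDP good_rate_function_J
    unfolding \<theta>_max_def mgf_def tilted_mgf_def by blast
qed

end
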